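(* Let $K$ be a field, let $S=K[t_1,\ldots,t_s]$, $s\geq 2$, be a polynomial ring with the standard grading, let $I\subset S$ be a graded ideal, and let $\prec$ be a graded monomial order on $S$. Suppose that the initial ideal ${\rm in}_\prec(I)$ is a complete intersection of height $s-1$ generated by monomials $t^{\alpha_2},\ldots,t^{\alpha_s}$, with $d_i=\deg(t^{\alpha_i})$ for $i=2,\ldots,s$ and $1\leq d_i\leq d_{i+1}$ for $i\geq 2$. Then $\delta_I(d)\geq {\rm fp}_I(d)\geq 1$ for all integers $d\geq 1$, and $$ {\rm fp}_I(d)=\begin{cases}(d_{k+2}-\ell)\,d_{k+3}\cdots d_s & \text{if } d\leq \sum_{i=2}^{s}(d_i-1)-1,\\ 1 & \text{if } d\geq \sum_{i=2}^{s}(d_i-1),\end{cases} $$ where, in the first case, $0\leq k\leq s-2$ and $\ell$ are integers such that $d=\sum_{i=2}^{k+1}(d_i-1)+\ell$ and $1\leq \ell\leq d_{k+2}-1$ (with $d_{k+3}\cdots d_s=1$ if $k=s-2$, and the empty sum equal to $0$ if $k=0$).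
   Context: For $a=(a_1,\ldots,a_s)\in\mathbb{N}^s$, $t^a=t_1^{a_1}\cdots t_s^{a_s}$. An ideal $J\subset S$ is a complete intersection if it can be generated by $r$ elements, where $r$ is the height of $J$. A graded monomial order is one that compares monomials first by total degree. Degree: for a graded ideal $J$ of $S$, put $H_J(d)=\dim_K(S_d/J_d)$ and let $k$ be the Krull dimension of $S/J$. Then $\deg(S/J)=(k-1)!\lim_{d\to\infty}H_J(d)/d^{k-1}$ if $k\geq 1$, and $\deg(S/J)=\dim_K(S/J)$ if $k=0$. Footprint: $\Delta_\prec(I)$ is the set of monomials of $S$ not in ${\rm in}_\prec(I)$. For an integer $d\geq 1$, $\mathcal{M}_{\prec,d}$ is the set of monomials of degree $d$ in $\Delta_\prec(I)$ that are zero-divisors of $S/{\rm in}_\prec(I)$, and $\mathcal{F}_{\prec,d}$ is the set of nonzero $K$-linear combinations $f$ of monomials in $\Delta_\prec(I)$ of degree $d$ such that $f$ is a zero-divisor of $S/I$, i.e. $(I\colon f)\neq I$. Footprint function: ${\rm fp}_I(d)=\deg(S/I)-\max\{\deg(S/({\rm in}_\prec(I),t^a))\mid t^a\in\mathcal{M}_{\prec,d}\}$ if $\mathcal{M}_{\prec,d}\neq\emptyset$, and ${\rm fp}_I(d)=\deg(S/I)$ otherwise. Minimum distance function: $\delta_I(d)=\deg(S/I)-\max\{\deg(S/(I,f))\mid f\in\mathcal{F}_{\prec,d}\}$ if $\mathcal{F}_{\prec,d}\neq\emptyset$, and $\delta_I(d)=\deg(S/I)$ otherwise. *)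

theory Defs
  imports
    "HOL-Algebra.Algebra"
    "HOL-Algebra.Algebraic_Closure_Type"
    "HOL-Library.Poly_Mapping"
    "HOL-Library.Extended_Nat"
    "HOL-Library.Cardinality"
begin

section \<open>Height, Krull dimension, complete intersections\<close>

text \<open>A strict chain \<open>P 0 \<subset> \<dots> \<subset> P n\<close> of prime ideals has length \<open>n\<close>.\<close>

definition prime_chain :: "('a, 'm) ring_scheme \<Rightarrow> nat \<Rightarrow> (nat \<Rightarrow> 'a set) \<Rightarrow> bool" where
  "prime_chain R n P \<longleftrightarrow>
     (\<forall>i\<le>n. primeideal (P i) R) \<and> (\<forall>i<n. P i \<subset> P (Suc i))"

text \<open>The zero ring gets Krull dimension \<open>0\<close>, the supremum of the empty set.\<close>

definition krull_dim :: "('a, 'm) ring_scheme \<Rightarrow> enat" where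
  "krull_dim R = (SUP n \<in> {n. \<exists>P. prime_chain R n P}. enat n)"

definition prime_height :: "('a, 'm) ring_scheme \<Rightarrow> 'a set \<Rightarrow> enat" where
  "prime_height R Q = (SUP n \<in> {n. \<exists>P. prime_chain R n P \<and> P n = Q}. enat n)"

definition ideal_height :: "('a, 'm) ring_scheme \<Rightarrow> 'a set \<Rightarrow> enat" where
  "ideal_height R J = (INF Q \<in> {Q. primeideal Q R \<and> J \<subseteq> Q}. prime_height R Q)"

definition complete_intersection :: "('a, 'm) ring_scheme \<Rightarrow> 'a set \<Rightarrow> bool" where
  "complete_intersection R J \<longleftrightarrow>
     (\<exists>A. A \<subseteq> carrier R \<and> finite A \<and> enat (card A) = ideal_height R J \<and> J = genideal R A)"


section \<open>The polynomial ring\<close>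

text \<open>
  Monomials are identified with their exponent vectors. The finite type \<open>'v\<close> is the set of
  variables, so \<open>s\<close> is \<open>CARD('v)\<close>.
\<close>

type_synonym 'v expo = "'v \<Rightarrow>\<^sub>0 nat"
type_synonym ('v, 'k) mpoly = "('v \<Rightarrow>\<^sub>0 nat) \<Rightarrow>\<^sub>0 'k"

abbreviation mpoly_ring :: "('v::finite, 'k::field) mpoly ring" where
  "mpoly_ring \<equiv> ring_of_type_algebra"

abbreviation mpoly_ideal :: "('v::finite, 'k::field) mpoly set \<Rightarrow> bool" where
  "mpoly_ideal J \<equiv> ideal J mpoly_ring"

abbreviation ideal_gen :: "('v::finite, 'k::field) mpoly set \<Rightarrow> ('v, 'k) mpoly set" where
  "ideal_gen A \<equiv> genideal mpoly_ring A"

definition mono_poly :: "'v expo \<Rightarrow> ('v::finite, 'k::field) mpoly" where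
  "mono_poly a = Poly_Mapping.single a 1"

definition tdeg :: "'v::finite expo \<Rightarrow> nat" where
  "tdeg a = (\<Sum>v\<in>UNIV. Poly_Mapping.lookup a v)"

definition constants :: "('v::finite, 'k::field) mpoly set" where
  "constants = {Poly_Mapping.single 0 c | c. True}"

definition homogeneous_part :: "nat \<Rightarrow> ('v::finite, 'k::field) mpoly set" where
  "homogeneous_part d = {f. \<forall>a \<in> Poly_Mapping.keys f. tdeg a = d}"

definition hom_component :: "nat \<Rightarrow> ('v::finite, 'k::field) mpoly \<Rightarrow> ('v, 'k) mpoly" where
  "hom_component d f =
     (\<Sum>a \<in> {a \<in> Poly_Mapping.keys f. tdeg a = d}. Poly_Mapping.single a (Poly_Mapping.lookup f a))"

definition graded_ideal :: "('v::finite, 'k::field) mpoly set \<Rightarrow> bool" where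
  "graded_ideal J \<longleftrightarrow> mpoly_ideal J \<and> (\<forall>f\<in>J. \<forall>d. hom_component d f \<in> J)"


section \<open>Hilbert function and degree\<close>

text \<open>
  For a set \<open>V\<close> of polynomials closed under \<open>K\<close>-linear combinations, \<open>quot_dim J V\<close> is the
  \<open>K\<close>-dimension of the image of \<open>V\<close> in \<open>S/J\<close>, where \<open>K\<close> acts through its image in \<open>S/J\<close>.
  The kernel of \<open>V \<longrightarrow> S/J\<close> is \<open>V \<inter> J\<close>, so \<open>quot_dim J S\<^sub>d\<close> is the dimension of \<open>S\<^sub>d/J\<^sub>d\<close>.
\<close>

definition quot_dim :: "('v::finite, 'k::field) mpoly set \<Rightarrow> ('v, 'k) mpoly set \<Rightarrow> nat" where
  "quot_dim J V =
     ring.dim (mpoly_ring Quot J)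
       ((\<lambda>f. J +>\<^bsub>mpoly_ring\<^esub> f) ` constants) ((\<lambda>f. J +>\<^bsub>mpoly_ring\<^esub> f) ` V)"

definition hilbert_fun :: "('v::finite, 'k::field) mpoly set \<Rightarrow> nat \<Rightarrow> nat" where
  "hilbert_fun J d = quot_dim J (homogeneous_part d)"

text \<open>The degree of \<open>S/J\<close>, for a graded ideal \<open>J\<close>; the Krull dimension is then finite and the limit exists.\<close>

definition quot_degree :: "('v::finite, 'k::field) mpoly set \<Rightarrow> real" where
  "quot_degree J =
     (let k = the_enat (krull_dim (mpoly_ring Quot J)) in
      if k = 0 then real (quot_dim J UNIV)
      else fact (k - 1) * lim (\<lambda>d. real (hilbert_fun J d) / real d ^ (k - 1)))"


section \<open>Monomial orders, initial ideals, footprints\<close>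

text \<open>Monomial orders are given by their strict part.\<close>

definition monomial_order :: "('v::finite expo \<Rightarrow> 'v expo \<Rightarrow> bool) \<Rightarrow> bool" where
  "monomial_order prec \<longleftrightarrow>
     irreflp prec \<and> transp prec \<and> totalp prec \<and> wfp prec \<and>
     (\<forall>a b c. prec a b \<longrightarrow> prec (a + c) (b + c))"

definition graded_monomial_order :: "('v::finite expo \<Rightarrow> 'v expo \<Rightarrow> bool) \<Rightarrow> bool" where
  "graded_monomial_order prec \<longleftrightarrow>
     monomial_order prec \<and> (\<forall>a b. tdeg a < tdeg b \<longrightarrow> prec a b)"

definition lead_monom :: "('v expo \<Rightarrow> 'v expo \<Rightarrow> bool) \<Rightarrow> ('v::finite, 'k::field) mpoly \<Rightarrow> 'v expo" where
  "lead_monom prec f =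
     (THE a. a \<in> Poly_Mapping.keys f \<and> (\<forall>b \<in> Poly_Mapping.keys f. b \<noteq> a \<longrightarrow> prec b a))"

definition initial_ideal ::
  "('v expo \<Rightarrow> 'v expo \<Rightarrow> bool) \<Rightarrow> ('v::finite, 'k::field) mpoly set \<Rightarrow> ('v, 'k) mpoly set" where
  "initial_ideal prec I = ideal_gen {mono_poly (lead_monom prec f) | f. f \<in> I \<and> f \<noteq> 0}"

definition footprint ::
  "('v expo \<Rightarrow> 'v expo \<Rightarrow> bool) \<Rightarrow> ('v::finite, 'k::field) mpoly set \<Rightarrow> 'v expo set" where
  "footprint prec I = {a. mono_poly a \<notin> initial_ideal prec I}"

definition colon :: "('v::finite, 'k::field) mpoly set \<Rightarrow> ('v, 'k) mpoly \<Rightarrow> ('v, 'k) mpoly set" where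
  "colon J f = {g. g * f \<in> J}"

definition zero_divisor_mod :: "('v::finite, 'k::field) mpoly set \<Rightarrow> ('v, 'k) mpoly \<Rightarrow> bool" where
  "zero_divisor_mod J f \<longleftrightarrow> colon J f \<noteq> J"

definition zd_monoms ::
  "('v expo \<Rightarrow> 'v expo \<Rightarrow> bool) \<Rightarrow> ('v::finite, 'k::field) mpoly set \<Rightarrow> nat \<Rightarrow> 'v expo set" where
  "zd_monoms prec I d =
     {a \<in> footprint prec I. tdeg a = d \<and> zero_divisor_mod (initial_ideal prec I) (mono_poly a)}"

definition zd_standard_polys ::
  "('v expo \<Rightarrow> 'v expo \<Rightarrow> bool) \<Rightarrow> ('v::finite, 'k::field) mpoly set \<Rightarrow> nat \<Rightarrow> ('v, 'k) mpoly set" where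
  "zd_standard_polys prec I d =
     {f. f \<noteq> 0 \<and> Poly_Mapping.keys f \<subseteq> {a \<in> footprint prec I. tdeg a = d} \<and> zero_divisor_mod I f}"


section \<open>Footprint and minimum distance functions\<close>

definition footprint_fun ::
  "('v expo \<Rightarrow> 'v expo \<Rightarrow> bool) \<Rightarrow> ('v::finite, 'k::field) mpoly set \<Rightarrow> nat \<Rightarrow> real" where
  "footprint_fun prec I d =
     (if zd_monoms prec I d \<noteq> {}
      then quot_degree I -
        Max ((\<lambda>a. quot_degree (ideal_gen (insert (mono_poly a) (initial_ideal prec I)))) ` zd_monoms prec I d)
      else quot_degree I)"

text \<open>
  The set of polynomials below may be infinite, but a degree is a natural number bounded in terms
  of the ideal and of \<open>d\<close>, so the maximum is over a finite set of values.
\<close>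

definition min_dist_fun ::
  "('v expo \<Rightarrow> 'v expo \<Rightarrow> bool) \<Rightarrow> ('v::finite, 'k::field) mpoly set \<Rightarrow> nat \<Rightarrow> real" where
  "min_dist_fun prec I d =
     (if zd_standard_polys prec I d \<noteq> {}
      then quot_degree I -
        Max ((\<lambda>f. quot_degree (ideal_gen (insert f I))) ` zd_standard_polys prec I d)
      else quot_degree I)"

end

theory Submission
  imports Defs
begin

text \<open>
  Write \<open>L\<close> for the initial ideal of \<open>I\<close>. Since \<open>L\<close> has height \<open>s - 1\<close>, no \<open>s - 2\<close> variables meet all
  of its \<open>s - 1\<close> monomial generators; hence the generators have disjoint supports, and there are
  variables \<open>p\<close>, \<open>q\<close> such that all generators but one are powers of the variables other than \<open>p\<close>, \<open>q\<close>,
  the last one being \<open>p\<^sup>A q\<^sup>B\<close> with \<open>B \<ge> 1\<close> (and \<open>A = 0\<close> allowed). The standard monomials of \<open>L\<close> of large degree are then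
  partitioned into \<open>d\<^sub>2 \<cdots> d\<^sub>s\<close> rays \<open>u p\<^sup>n\<close> and \<open>u q\<^sup>n\<close>. For a graded ideal \<open>J\<close> containing \<open>I\<close>
  that contains no power of some variable, \<open>S/J\<close> has dimension one, and its degree is
  the number of rays disjoint from the initial ideal of \<open>J\<close>.

  For \<open>J = (L, t\<^sup>a)\<close> this number is \<open>\<Prod> d\<^sub>i - \<Prod> (d\<^sub>i - c\<^sub>i)\<close>, where \<open>c\<^sub>i\<close> is the
  exponent of \<open>a\<close> at the variable of the \<open>i\<close>-th generator, with truncation for the mixed one. So the
  footprint function is the minimum of \<open>\<Prod> (d\<^sub>i - c\<^sub>i)\<close> over the boxes \<open>c\<^sub>i < d\<^sub>i\<close> with
  \<open>\<Sum> c\<^sub>i \<le> d\<close>, which is attained by exhausting the smallest \<open>d\<^sub>i\<close> first.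
  The inequality with the minimum distance function holds because the initial ideal of \<open>(I, f)\<close>
  contains \<open>L\<close> and the leading monomial of \<open>f\<close>.
\<close>

section \<open>Ideals of commutative rings given by a type\<close>

text \<open>Heights and dimensions are controlled by counting. For a graded order, the number of
  standard monomials of degree at most \<open>d\<close> is the affine Hilbert function of an ideal,
  graded or not, and each strict inclusion of primes lowers its growth order by at least one. Hence
  an ideal contained in the one generated by \<open>m\<close> variables has height at most
  \<open>m\<close>, which is what rules out a small set of variables meeting all generators. The
  same count bounds Krull dimensions from above. The degree has a different definition in dimension
  zero, so adding a polynomial to the ideal must not lower the dimension. This is where
  zero-divisors enter: the ideal \<open>(I, f)\<close> annihilates some \<open>r\<close> modulo
  \<open>I\<close>, and \<open>r\<close> stays outside \<open>I\<close> after multiplication by any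
  power of one of the variables \<open>p\<close> and \<open>q\<close>. The monomials in question
  have degree exactly \<open>d\<close>, whereas the box only requires a sum of at most
  \<open>d\<close>. A surplus remains only when the box is full, and then it can be placed on
  \<open>p\<close> without changing the product.\<close>

abbreviation lookup where "lookup \<equiv> Poly_Mapping.lookup"
abbreviation keys where "keys \<equiv> Poly_Mapping.keys"

lemma type_ring_simps [simp]:
  "carrier (ring_of_type_algebra :: 'a::comm_ring_1 ring) = UNIV"
  "x \<otimes>\<^bsub>(ring_of_type_algebra :: 'a::comm_ring_1 ring)\<^esub> y = x * y"
  "x \<oplus>\<^bsub>(ring_of_type_algebra :: 'a::comm_ring_1 ring)\<^esub> y = x + y"
  "\<one>\<^bsub>(ring_of_type_algebra :: 'a::comm_ring_1 ring)\<^esub> = 1"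
  "\<zero>\<^bsub>(ring_of_type_algebra :: 'a::comm_ring_1 ring)\<^esub> = 0"
  by (simp_all add: ring_of_type_algebra_def)

lemma ideal_type_iff:
  fixes J :: "'a::comm_ring_1 set"
  shows "ideal J ring_of_type_algebra \<longleftrightarrow>
    0 \<in> J \<and> (\<forall>x\<in>J. \<forall>y\<in>J. x + y \<in> J) \<and> (\<forall>x\<in>J. \<forall>r. r * x \<in> J)" (is "?l \<longleftrightarrow> ?r")
proof
  assume ?l
  then interpret ideal J ring_of_type_algebra .
  show ?r
    using additive_subgroup.zero_closed[OF additive_subgroup_axioms]
      additive_subgroup.a_closed[OF additive_subgroup_axioms] I_l_closed
    unfolding type_ring_simps by (intro conjI ballI allI) simp_all
next
  assume r: ?r
  interpret ring "ring_of_type_algebra :: 'a ring" by (rule ring_from_type_algebra)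
  have minus: "\<ominus>\<^bsub>ring_of_type_algebra\<^esub> x = - x" for x :: 'a
    using minus_equality[of "- x" x] by simp
  show ?l
  proof (rule idealI)
    show "subgroup J (add_monoid ring_of_type_algebra)"
    proof (rule add.subgroupI)
      fix x assume "x \<in> J"
      then have "(- 1) * x \<in> J" using r by blast
      then show "\<ominus>\<^bsub>ring_of_type_algebra\<^esub> x \<in> J"
        using minus[of x] by simp
    qed (use r in auto)
  qed (use r in \<open>auto simp: mult.commute intro: ring_axioms\<close>)
qed

lemma primeideal_type_iff:
  fixes P :: "'a::comm_ring_1 set"
  shows "primeideal P ring_of_type_algebra \<longleftrightarrow>
    ideal P ring_of_type_algebra \<and> 1 \<notin> P \<and> (\<forall>a b. a * b \<in> P \<longrightarrow> a \<in> P \<or> b \<in> P)" (is "?l \<longleftrightarrow> ?r")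
proof
  assume ?l
  then interpret primeideal P ring_of_type_algebra .
  show ?r
    using ideal_axioms I_prime I_notcarr one_imp_carrier by auto
next
  assume ?r
  then show ?l
    by (intro primeidealI cring_from_type_algebra) auto
qed

lemma ideal_type_zero: "ideal J ring_of_type_algebra \<Longrightarrow> (0::'a::comm_ring_1) \<in> J"
  and ideal_type_add: "ideal J ring_of_type_algebra \<Longrightarrow> x \<in> J \<Longrightarrow> y \<in> J \<Longrightarrow> (x::'a) + y \<in> J"
  and ideal_type_mult: "ideal J ring_of_type_algebra \<Longrightarrow> x \<in> J \<Longrightarrow> r * x \<in> J"
  by (simp_all add: ideal_type_iff)

lemma ideal_type_mult': "ideal J ring_of_type_algebra \<Longrightarrow> (x::'a::comm_ring_1) \<in> J \<Longrightarrow> x * r \<in> J"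
  using ideal_type_mult[of J x r] by (simp add: mult.commute)

lemma ideal_type_uminus: "ideal J ring_of_type_algebra \<Longrightarrow> (x::'a::comm_ring_1) \<in> J \<Longrightarrow> - x \<in> J"
  using ideal_type_mult[of J x "- 1"] by simp

lemma ideal_type_diff:
  "ideal J ring_of_type_algebra \<Longrightarrow> (x::'a::comm_ring_1) \<in> J \<Longrightarrow> y \<in> J \<Longrightarrow> x - y \<in> J"
  using ideal_type_add[of J x "- y"] ideal_type_uminus[of J y] by simp

lemma ideal_type_sum:
  "ideal J ring_of_type_algebra \<Longrightarrow> (\<And>i. i \<in> A \<Longrightarrow> f i \<in> J) \<Longrightarrow> (\<Sum>i\<in>A. f i :: 'a::comm_ring_1) \<in> J"
  by (induction A rule: infinite_finite_induct) (auto intro: ideal_type_zero ideal_type_add)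

lemma genideal_type:
  fixes A :: "'a::comm_ring_1 set"
  shows "ideal (genideal ring_of_type_algebra A) ring_of_type_algebra"
    and "A \<subseteq> genideal ring_of_type_algebra A"
    and "ideal J ring_of_type_algebra \<Longrightarrow> A \<subseteq> J \<Longrightarrow> genideal ring_of_type_algebra A \<subseteq> J"
proof -
  interpret ring "ring_of_type_algebra :: 'a ring" by (rule ring_from_type_algebra)
  show "ideal (genideal ring_of_type_algebra A) ring_of_type_algebra"
    by (rule genideal_ideal) simp
  show "A \<subseteq> genideal ring_of_type_algebra A"
    by (rule genideal_self) simp
  show "ideal J ring_of_type_algebra \<Longrightarrow> A \<subseteq> J \<Longrightarrow> genideal ring_of_type_algebra A \<subseteq> J"
    by (rule genideal_minimal)
qed

section \<open>Monomials and monomial ideals\<close>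

definition mdvd :: "'v expo \<Rightarrow> 'v expo \<Rightarrow> bool" where
  "mdvd a b \<longleftrightarrow> (\<forall>v. lookup a v \<le> lookup b v)"

lemma mdvd_add_diff: "mdvd a b \<Longrightarrow> a + (b - a) = b"
  by (rule poly_mapping_eqI) (simp add: mdvd_def lookup_add lookup_minus)

lemma mdvd_add [simp]: "mdvd a (a + b)" "mdvd a (b + a)"
  by (simp_all add: mdvd_def lookup_add)

lemma mdvd_refl [simp]: "mdvd a a"
  by (simp add: mdvd_def)

lemma mdvd_trans: "mdvd a b \<Longrightarrow> mdvd b c \<Longrightarrow> mdvd a c"
  unfolding mdvd_def using order_trans by blast

lemma tdeg_add: "tdeg (a + b) = tdeg a + tdeg b"
  by (simp add: tdeg_def lookup_add sum.distrib)

lemma tdeg_zero [simp]: "tdeg 0 = 0"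
  by (simp add: tdeg_def)

lemma tdeg_eq_0_iff: "tdeg a = 0 \<longleftrightarrow> a = 0"
  by (auto simp: tdeg_def intro: poly_mapping_eqI)

lemma tdeg_single [simp]: "tdeg (Poly_Mapping.single v n) = n"
  by (simp add: tdeg_def lookup_single when_def)

lemma lookup_le_tdeg: "lookup a v \<le> tdeg a"
  unfolding tdeg_def by (rule member_le_sum) auto

lemma finite_tdeg_le: "finite {a :: 'v::finite expo. tdeg a \<le> d}"
proof (rule inj_on_finite)
  show "inj_on lookup {a :: 'v expo. tdeg a \<le> d}"
    by (auto intro!: inj_onI poly_mapping_eqI)
  show "lookup ` {a. tdeg a \<le> d} \<subseteq> (UNIV :: 'v set) \<rightarrow>\<^sub>E {..d}"
    using lookup_le_tdeg order_trans by fastforce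
  show "finite ((UNIV :: 'v set) \<rightarrow>\<^sub>E {..d})"
    by (rule finite_PiE) auto
qed

lemma finite_tdeg_eq: "finite {a :: 'v::finite expo. tdeg a = d}"
  by (rule finite_subset[OF _ finite_tdeg_le[of d]]) auto


lemma lookup_single_mult_add:
  fixes a b :: "'a::cancel_comm_monoid_add" and f :: "'a \<Rightarrow>\<^sub>0 'b::semiring_0"
  shows "lookup (Poly_Mapping.single a c * f) (a + b) = c * lookup f b"
proof -
  have "lookup (Poly_Mapping.single a c * f) (a + b)
      = Sum_any (\<lambda>l. if l = a then c * Sum_any (\<lambda>q. lookup f q when a + b = l + q) else 0)"
    unfolding lookup_mult by (intro Sum_any.cong) (auto simp: lookup_single when_def)
  also have "\<dots> = c * Sum_any (\<lambda>q. lookup f q when b = q)"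
    by simp
  finally show ?thesis
    by simp
qed

lemma keys_single_mult:
  fixes a :: "'a::cancel_comm_monoid_add" and c :: "'k::semiring_no_zero_divisors"
  assumes "c \<noteq> 0"
  shows "keys (Poly_Mapping.single a c * f) = (+) a ` keys f"
proof
  show "keys (Poly_Mapping.single a c * f) \<subseteq> (+) a ` keys f"
    using keys_mult[of "Poly_Mapping.single a c" f] assms by (auto split: if_splits)
  show "(+) a ` keys f \<subseteq> keys (Poly_Mapping.single a c * f)"
    using assms by (auto simp: in_keys_iff lookup_single_mult_add)
qed

lemma lookup_const_mult:
  fixes f :: "'a::cancel_comm_monoid_add \<Rightarrow>\<^sub>0 'b::semiring_0"
  shows "lookup (Poly_Mapping.single 0 c * f) b = c * lookup f b"
  using lookup_single_mult_add[of 0 c f b] by simp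

lemma poly_mapping_eq_sum_singles:
  fixes f :: "'a \<Rightarrow>\<^sub>0 'b::comm_monoid_add"
  assumes "finite A" "keys f \<subseteq> A"
  shows "f = (\<Sum>a\<in>A. Poly_Mapping.single a (lookup f a))"
proof (rule poly_mapping_eqI)
  fix k
  have "lookup (\<Sum>a\<in>A. Poly_Mapping.single a (lookup f a)) k = (\<Sum>a\<in>A. if k = a then lookup f a else 0)"
    by (auto simp: lookup_sum lookup_single when_def intro: sum.cong)
  also have "\<dots> = lookup f k"
    using assms by (auto simp: in_keys_iff)
  finally show "lookup f k = lookup (\<Sum>a\<in>A. Poly_Mapping.single a (lookup f a)) k" ..
qed

lemma single_eq_const_mult_mono:
  "Poly_Mapping.single a c = Poly_Mapping.single 0 c * (mono_poly a :: ('v::finite, 'k::field) mpoly)"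
  by (simp add: mono_poly_def mult_single)

lemma mono_poly_add: "(mono_poly (a + b) :: ('v::finite, 'k::field) mpoly) = mono_poly a * mono_poly b"
  by (simp add: mono_poly_def mult_single)

lemma keys_mono_poly [simp]: "keys (mono_poly a :: ('v::finite, 'k::field) mpoly) = {a}"
  by (simp add: mono_poly_def)

lemma mono_poly_nonzero [simp]: "(mono_poly a :: ('v::finite, 'k::field) mpoly) \<noteq> 0"
  using keys_mono_poly[of a] by (metis keys_zero insert_not_empty)

text \<open>The polynomials satisfying the right-hand side form an ideal containing the generators,
  and each of their terms is a multiple of a generator. From here on a monomial ideal is handled as
  an up-closed set of exponents.\<close>

lemma mem_mono_ideal_iff:
  fixes f :: "('v::finite, 'k::field) mpoly"
  shows "f \<in> ideal_gen (mono_poly ` A) \<longleftrightarrow> (\<forall>k\<in>keys f. \<exists>a\<in>A. mdvd a k)"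
proof
  let ?J = "{f :: ('v, 'k) mpoly. \<forall>k\<in>keys f. \<exists>a\<in>A. mdvd a k}"
  have "ideal ?J mpoly_ring"
    unfolding ideal_type_iff
  proof (intro conjI ballI allI)
    fix f g :: "('v, 'k) mpoly" assume "f \<in> ?J" "g \<in> ?J"
    then show "f + g \<in> ?J"
      using keys_add[of f g] by blast
  next
    fix f r :: "('v, 'k) mpoly" assume "f \<in> ?J"
    then show "r * f \<in> ?J"
      using keys_mult[of r f] mdvd_trans mdvd_add(2) by (smt (verit) mem_Collect_eq subset_eq)
  qed simp
  moreover have "mono_poly ` A \<subseteq> ?J"
  proof
    fix f :: "('v, 'k) mpoly" assume "f \<in> mono_poly ` A"
    then obtain a where "a \<in> A" "f = mono_poly a"
      by blast
    then show "f \<in> ?J"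
      by (auto intro: bexI[of _ a])
  qed
  ultimately have "ideal_gen (mono_poly ` A) \<subseteq> ?J"
    by (rule genideal_type(3))
  then show "f \<in> ideal_gen (mono_poly ` A) \<Longrightarrow> \<forall>k\<in>keys f. \<exists>a\<in>A. mdvd a k"
    by auto
next
  assume *: "\<forall>k\<in>keys f. \<exists>a\<in>A. mdvd a k"
  let ?G = "ideal_gen (mono_poly ` A) :: ('v, 'k) mpoly set"
  have id: "ideal ?G mpoly_ring"
    by (rule genideal_type)
  have "Poly_Mapping.single k (lookup f k) \<in> ?G" if k: "k \<in> keys f" for k
  proof -
    obtain a where a: "a \<in> A" "mdvd a k"
      using * k by blast
    have "mono_poly a \<in> ?G"
      by (rule subsetD[OF genideal_type(2) imageI]) (rule a)
    then have "Poly_Mapping.single (k - a) (lookup f k) * mono_poly a \<in> ?G"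
      by (rule ideal_type_mult[OF id])
    moreover have "k - a + a = k"
      using mdvd_add_diff[OF a(2)] by (simp add: add.commute)
    ultimately show ?thesis
      by (simp add: mono_poly_def mult_single)
  qed
  then have "(\<Sum>k\<in>keys f. Poly_Mapping.single k (lookup f k)) \<in> ?G"
    by (rule ideal_type_sum[OF id])
  then show "f \<in> ?G"
    using poly_mapping_eq_sum_singles[of "keys f" f] by simp
qed

lemma mono_mem_mono_ideal_iff:
  "(mono_poly k :: ('v::finite, 'k::field) mpoly) \<in> ideal_gen (mono_poly ` A) \<longleftrightarrow> (\<exists>a\<in>A. mdvd a k)"
  by (simp add: mem_mono_ideal_iff)

section \<open>Leading monomials and normal forms\<close>

locale graded_order =
  fixes prec :: "'v::finite expo \<Rightarrow> 'v expo \<Rightarrow> bool"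
  assumes graded_monomial_order: "graded_monomial_order prec"
begin

lemma prec_irrefl [simp]: "\<not> prec a a"
  and prec_trans: "prec a b \<Longrightarrow> prec b c \<Longrightarrow> prec a c"
  and prec_total: "a \<noteq> b \<Longrightarrow> prec a b \<or> prec b a"
  and prec_wf: "wfp prec"
  and prec_add: "prec a b \<Longrightarrow> prec (a + c) (b + c)"
  and prec_tdeg: "tdeg a < tdeg b \<Longrightarrow> prec a b"
  using graded_monomial_order
  unfolding graded_monomial_order_def monomial_order_def
  by (auto dest: irreflpD transpD totalpD)

lemma prec_add_left: "prec a b \<Longrightarrow> prec (c + a) (c + b)"
  using prec_add[of a b c] by (simp add: add.commute)

lemma prec_asym: "prec a b \<Longrightarrow> \<not> prec b a"
  using prec_trans[of a b a] prec_irrefl by blast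

lemma prec_imp_tdeg_le: "prec a b \<Longrightarrow> tdeg a \<le> tdeg b"
  using prec_asym[of a b] prec_tdeg[of b a] not_le_imp_less by blast

lemma ex_max_monom:
  assumes "finite A" "A \<noteq> {}"
  shows "\<exists>a\<in>A. \<forall>b\<in>A. b \<noteq> a \<longrightarrow> prec b a"
  using assms
proof (induction A rule: finite_ne_induct)
  case (insert x F)
  then obtain a where a: "a \<in> F" "\<forall>b\<in>F. b \<noteq> a \<longrightarrow> prec b a" by blast
  show ?case
  proof (cases "prec a x")
    case True
    have "prec b x" if "b \<in> F" for b
    proof (cases "b = a")
      case False
      then have "prec b a"
        using a(2) that by blast
      then show ?thesis
        using True by (rule prec_trans)
    qed (simp add: True)
    then show ?thesis by blast
  next
    case False
    then show ?thesis
      using a prec_total[of a x] by (intro bexI[of _ a]) auto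
  qed
qed simp

lemma lead_monom_eqI:
  assumes "a \<in> keys f" "\<And>b. b \<in> keys f \<Longrightarrow> b \<noteq> a \<Longrightarrow> prec b a"
  shows "lead_monom prec f = a"
  unfolding lead_monom_def
proof (rule the_equality)
  fix a' assume "a' \<in> keys f \<and> (\<forall>b\<in>keys f. b \<noteq> a' \<longrightarrow> prec b a')"
  then show "a' = a"
    using assms(1) assms(2)[of a'] prec_asym[of a a'] by metis
qed (use assms in simp)

lemma lead_monom:
  assumes "f \<noteq> 0"
  shows "lead_monom prec f \<in> keys f"
    and "b \<in> keys f \<Longrightarrow> b \<noteq> lead_monom prec f \<Longrightarrow> prec b (lead_monom prec f)"
proof -
  have "keys f \<noteq> {}"
    using assms by (metis ex_in_conv in_keys_iff lookup_zero poly_mapping_eqI)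
  then obtain a where a: "a \<in> keys f" "\<forall>b\<in>keys f. b \<noteq> a \<longrightarrow> prec b a"
    using ex_max_monom[of "keys f"] by auto
  then have "lead_monom prec f = a"
    by (intro lead_monom_eqI) auto
  then show "lead_monom prec f \<in> keys f"
    and "b \<in> keys f \<Longrightarrow> b \<noteq> lead_monom prec f \<Longrightarrow> prec b (lead_monom prec f)"
    using a by auto
qed

lemma lead_monom_mono_poly [simp]: "lead_monom prec (mono_poly a :: ('v, 'k::field) mpoly) = a"
  by (rule lead_monom_eqI) auto

text \<open>Among all pairs of exponents of \<open>f\<close> and \<open>g\<close> only the two
  leading ones reach this sum, so nothing can cancel there. This gives both the absence of zero
  divisors and the multiplicativity of leading monomials.\<close>

lemma lookup_mult_lead:
  fixes f g :: "('v, 'k::field) mpoly"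
  assumes "f \<noteq> 0" "g \<noteq> 0"
  shows "lookup (f * g) (lead_monom prec f + lead_monom prec g)
    = lookup f (lead_monom prec f) * lookup g (lead_monom prec g)"
proof -
  let ?a = "lead_monom prec f" and ?b = "lead_monom prec g"
  define f' where "f' = f - Poly_Mapping.single ?a (lookup f ?a)"
  have f: "f = Poly_Mapping.single ?a (lookup f ?a) + f'"
    by (simp add: f'_def)
  have kf': "prec k ?a" if "k \<in> keys f'" for k
  proof -
    have "k \<noteq> ?a" "k \<in> keys f"
      using that by (auto simp: f'_def in_keys_iff lookup_minus lookup_single when_def split: if_splits)
    then show ?thesis
      using lead_monom(2)[OF assms(1)] by blast
  qed
  have "?a + ?b \<notin> keys (f' * g)"
  proof
    assume "?a + ?b \<in> keys (f' * g)"
    then obtain k l where kl: "k \<in> keys f'" "l \<in> keys g" "?a + ?b = k + l"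
      using keys_mult by blast
    have "prec (k + l) (?a + l)"
      using kf'[OF kl(1)] by (rule prec_add)
    moreover have "l = ?b \<or> prec (?a + l) (?a + ?b)"
      using lead_monom(2)[OF assms(2) kl(2)] prec_add_left[of l ?b ?a] by blast
    ultimately have "prec (k + l) (?a + ?b)"
      using prec_trans[of "k + l" "?a + l" "?a + ?b"] by auto
    then show False
      by (simp add: kl(3))
  qed
  then have z: "lookup (f' * g) (?a + ?b) = 0"
    by (simp add: in_keys_iff)
  have "lookup (f * g) (?a + ?b)
      = lookup (Poly_Mapping.single ?a (lookup f ?a) * g) (?a + ?b) + lookup (f' * g) (?a + ?b)"
    by (subst (1) f) (simp add: distrib_right lookup_add)
  then show ?thesis
    by (simp add: z lookup_single_mult_add)
qed

lemma mult_nonzero: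
  fixes f g :: "('v, 'k::field) mpoly"
  assumes "f \<noteq> 0" "g \<noteq> 0"
  shows "f * g \<noteq> 0"
proof
  assume "f * g = 0"
  then have "lookup f (lead_monom prec f) * lookup g (lead_monom prec g) = 0"
    using lookup_mult_lead[OF assms] by simp
  then show False
    using lead_monom(1)[OF assms(1)] lead_monom(1)[OF assms(2)] by (simp add: in_keys_iff)
qed

lemma lead_monom_mult:
  fixes f g :: "('v, 'k::field) mpoly"
  assumes "f \<noteq> 0" "g \<noteq> 0"
  shows "lead_monom prec (f * g) = lead_monom prec f + lead_monom prec g"
proof (rule lead_monom_eqI)
  show "lead_monom prec f + lead_monom prec g \<in> keys (f * g)"
    using lookup_mult_lead[OF assms] lead_monom(1)[OF assms(1)] lead_monom(1)[OF assms(2)]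
    by (simp add: in_keys_iff)
next
  fix b assume "b \<in> keys (f * g)" and ne: "b \<noteq> lead_monom prec f + lead_monom prec g"
  then obtain k l where kl: "k \<in> keys f" "l \<in> keys g" "b = k + l"
    using keys_mult by blast
  have "k = lead_monom prec f \<or> prec (k + l) (lead_monom prec f + l)"
    using lead_monom(2)[OF assms(1) kl(1)] prec_add[of k "lead_monom prec f" l] by blast
  moreover have "l = lead_monom prec g \<or>
      prec (lead_monom prec f + l) (lead_monom prec f + lead_monom prec g)"
    using lead_monom(2)[OF assms(2) kl(2)]
      prec_add_left[of l "lead_monom prec g" "lead_monom prec f"] by blast
  ultimately show "prec b (lead_monom prec f + lead_monom prec g)"
    using ne kl(3)
      prec_trans[of "k + l" "lead_monom prec f + l" "lead_monom prec f + lead_monom prec g"]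
    by auto
qed


text \<open>For an ideal this set is closed under adding exponents (\<open>leads_add\<close>), so it
  is the whole exponent set of the initial ideal and not merely a set of generators.\<close>

definition leads :: "('v, 'k::field) mpoly set \<Rightarrow> 'v expo set" where
  "leads J = {lead_monom prec f | f. f \<in> J \<and> f \<noteq> 0}"

lemma leads_mono: "J \<subseteq> J' \<Longrightarrow> leads J \<subseteq> leads J'"
  by (auto simp: leads_def)

lemma leadsI: "f \<in> J \<Longrightarrow> f \<noteq> 0 \<Longrightarrow> lead_monom prec f \<in> leads J"
  by (auto simp: leads_def)

lemma mono_poly_mem_leads: "(mono_poly a :: ('v, 'k::field) mpoly) \<in> J \<Longrightarrow> a \<in> leads J"
  using leadsI[of "mono_poly a" J] by simp

lemma leads_add:
  fixes J :: "('v, 'k::field) mpoly set"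
  assumes "mpoly_ideal J" "a \<in> leads J"
  shows "a + c \<in> leads J"
proof -
  obtain f where f: "f \<in> J" "f \<noteq> 0" "a = lead_monom prec f"
    using assms(2) by (auto simp: leads_def)
  have "lead_monom prec (f * mono_poly c) \<in> leads J"
    by (rule leadsI[OF ideal_type_mult'[OF assms(1) f(1)] mult_nonzero[OF f(2) mono_poly_nonzero]])
  then show ?thesis
    by (simp only: lead_monom_mult[OF f(2) mono_poly_nonzero] f(3) lead_monom_mono_poly)
qed

lemma leads_mdvd:
  fixes J :: "('v, 'k::field) mpoly set"
  assumes "mpoly_ideal J" "a \<in> leads J" "mdvd a b"
  shows "b \<in> leads J"
  using leads_add[OF assms(1,2), of "b - a"] by (simp only: mdvd_add_diff[OF assms(3)])

lemma ex_leads_mdvd_iff: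
  fixes J :: "('v, 'k::field) mpoly set"
  assumes "mpoly_ideal J"
  shows "(\<exists>a\<in>leads J. mdvd a k) \<longleftrightarrow> k \<in> leads J"
  using leads_mdvd[OF assms, of _ k] by (auto intro: bexI[of _ k])

lemma initial_ideal_eq: "initial_ideal prec J = ideal_gen (mono_poly ` leads J)"
  unfolding initial_ideal_def leads_def by (rule arg_cong[of _ _ ideal_gen]) auto

lemma mem_initial_ideal_iff:
  fixes J :: "('v, 'k::field) mpoly set"
  assumes "mpoly_ideal J"
  shows "f \<in> initial_ideal prec J \<longleftrightarrow> keys f \<subseteq> leads J"
  by (auto simp: initial_ideal_eq mem_mono_ideal_iff ex_leads_mdvd_iff[OF assms])

lemma leads_mono_ideal:
  "leads (ideal_gen (mono_poly ` A) :: ('v, 'k::field) mpoly set) = {k. \<exists>a\<in>A. mdvd a k}"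
proof (intro equalityI subsetI CollectI)
  fix k assume "k \<in> leads (ideal_gen (mono_poly ` A) :: ('v, 'k) mpoly set)"
  then obtain f :: "('v, 'k) mpoly" where "f \<in> ideal_gen (mono_poly ` A)" "f \<noteq> 0" "k = lead_monom prec f"
    by (auto simp: leads_def)
  then show "\<exists>a\<in>A. mdvd a k"
    using lead_monom(1)[of f] mem_mono_ideal_iff[of f A] by simp
next
  fix k assume "k \<in> {k. \<exists>a\<in>A. mdvd a k}"
  then show "k \<in> leads (ideal_gen (mono_poly ` A) :: ('v, 'k) mpoly set)"
    by (intro mono_poly_mem_leads) (simp add: mono_mem_mono_ideal_iff)
qed

lemma footprint_eq:
  fixes J :: "('v, 'k::field) mpoly set"
  assumes "mpoly_ideal J"
  shows "footprint prec J = - leads J"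
  by (auto simp: footprint_def mem_initial_ideal_iff[OF assms])

lemma zero_not_in_leads:
  fixes J :: "('v, 'k::field) mpoly set"
  assumes "mpoly_ideal J" "1 \<notin> J"
  shows "0 \<notin> leads J"
proof
  assume "0 \<in> leads J"
  then obtain f where f: "f \<in> J" "f \<noteq> 0" "lead_monom prec f = 0"
    by (auto simp: leads_def)
  have "keys f \<subseteq> {0}"
  proof
    fix b assume "b \<in> keys f"
    then have "b = 0 \<or> prec b 0"
      using lead_monom(2)[OF f(2)] f(3) by metis
    then show "b \<in> {0}"
      using prec_imp_tdeg_le[of b 0] by (auto simp: tdeg_eq_0_iff)
  qed
  then have eq: "f = Poly_Mapping.single 0 (lookup f 0)"
    using poly_mapping_eq_sum_singles[of "{0}" f] by simp
  have "lookup f 0 \<noteq> 0"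
    using f lead_monom(1)[OF f(2)] by (simp add: in_keys_iff)
  then have "Poly_Mapping.single 0 (inverse (lookup f 0)) * f = 1"
    by (subst (2) eq) (simp add: mult_single)
  then show False
    using ideal_type_mult[OF assms(1) f(1)] assms(2) by metis
qed

text \<open>Division with remainder. The set \<open>M\<close> of admissible exponents lets one proof
  serve bounded degree, fixed degree and no restriction at all; \<open>red\<close> says that
  reducers can be chosen inside \<open>M\<close>. The induction runs over an upper bound
  \<open>m\<close> of the exponents, which need not occur in \<open>f\<close>.\<close>

lemma reduce_mod_ideal:
  fixes J :: "('v, 'k::field) mpoly set"
  assumes id: "mpoly_ideal J"
    and red: "\<And>a. a \<in> leads J \<Longrightarrow> a \<in> M \<Longrightarrow> \<exists>h\<in>J. h \<noteq> 0 \<and> lead_monom prec h = a \<and> keys h \<subseteq> M"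
    and "keys f \<subseteq> M"
  shows "\<exists>r. f - r \<in> J \<and> keys r \<subseteq> M - leads J"
proof -
  have *: "\<exists>r. f - r \<in> J \<and> keys r \<subseteq> M - leads J"
    if "keys f \<subseteq> M" "\<forall>k\<in>keys f. k = m \<or> prec k m" for m f
    using prec_wf that
  proof (induction m arbitrary: f rule: wfp_induct_rule)
    case (less m)
    show ?case
    proof (cases "m \<in> keys f")
      case mf: True
      \<comment> \<open>In both cases \<open>t\<close> has leading monomial \<open>m\<close>: it is
        an element of \<open>J\<close> that cancels the term at \<open>m\<close>, or, if
        \<open>m\<close> is standard, the monomial itself, which then moves to the
        remainder.\<close>
      define t where "t = (if m \<in> leads J then (SOME h. h \<in> J \<and> (h \<noteq> 0) \<and> lead_monom prec h = m \<and> keys h \<subseteq> M)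
        else mono_poly m)"
      have t: "t \<noteq> 0 \<and> lead_monom prec t = m \<and> keys t \<subseteq> M \<and> (m \<in> leads J \<longrightarrow> t \<in> J) \<and> (m \<notin> leads J \<longrightarrow> t = mono_poly m)"
      proof (cases "m \<in> leads J")
        case True
        then have "\<exists>h. h \<in> J \<and> (h \<noteq> 0) \<and> lead_monom prec h = m \<and> keys h \<subseteq> M"
          using red[of m] mf less.prems(1) by blast
        from someI_ex[OF this] show ?thesis
          using True by (simp add: t_def)
      next
        case False
        then show ?thesis
          using mf less.prems(1) by (auto simp: t_def)
      qed
      define c where "c = lookup f m / lookup t m"
      define p where "p = Poly_Mapping.single 0 c * t"
      define f' where "f' = f - p"
      have tm: "lookup t m \<noteq> 0"
        using t lead_monom(1)[of t] by (auto simp: in_keys_iff)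
      have lp: "lookup p k = c * lookup t k" for k
        by (simp add: p_def lookup_const_mult)
      have kf': "k \<in> M \<and> prec k m" if k: "k \<in> keys f'" for k
      proof -
        have "k \<noteq> m"
          using k tm by (auto simp: f'_def in_keys_iff lookup_minus lp c_def)
        moreover have kk: "k \<in> keys f \<or> k \<in> keys t"
          using k by (auto simp: f'_def in_keys_iff lookup_minus lp)
        moreover have "k \<in> keys t \<Longrightarrow> k \<noteq> m \<Longrightarrow> prec k m"
          using t lead_monom(2)[of t k] by blast
        ultimately show ?thesis
          using t less.prems by blast
      qed
      have "\<exists>r. f' - r \<in> J \<and> keys r \<subseteq> M - leads J"
      proof (cases "f' = 0")
        case True
        then show ?thesis
          using ideal_type_zero[OF id] by (intro exI[of _ 0]) simp
      next
        case False
        show ?thesis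
        proof (rule less.IH)
          show "prec (lead_monom prec f') m"
            using kf' lead_monom(1)[OF False] by blast
          show "keys f' \<subseteq> M"
            using kf' by blast
          show "\<forall>k\<in>keys f'. k = lead_monom prec f' \<or> prec k (lead_monom prec f')"
            using lead_monom(2)[OF False] by blast
        qed
      qed
      then obtain r where r: "f' - r \<in> J" "keys r \<subseteq> M - leads J"
        by blast
      show ?thesis
      proof (cases "m \<in> leads J")
        case True
        then have "p \<in> J"
          using t unfolding p_def by (intro ideal_type_mult[OF id]) simp
        then have "(f' - r) + p \<in> J"
          by (intro ideal_type_add[OF id r(1)])
        then show ?thesis
          using r(2) by (intro exI[of _ r]) (simp add: f'_def)
      next
        case False
        then have "p = Poly_Mapping.single m c"
          using t by (simp add: p_def mono_poly_def mult_single)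
        then have "keys (r + p) \<subseteq> M - leads J"
          using keys_add[of r p] r(2) False mf less.prems(1) by (auto split: if_splits)
        moreover have "f - (r + p) = f' - r"
          by (simp add: f'_def)
        ultimately show ?thesis
          using r(1) by metis
      qed
    next
      case mf: False
      show ?thesis
      proof (cases "f = 0")
        case True
        then show ?thesis
          using ideal_type_zero[OF id] by (intro exI[of _ 0]) simp
      next
        case False
        show ?thesis
        proof (rule less.IH)
          show "prec (lead_monom prec f) m"
            using less.prems(2) lead_monom(1)[OF False] mf by metis
          show "keys f \<subseteq> M"
            by (rule less.prems)
          show "\<forall>k\<in>keys f. k = lead_monom prec f \<or> prec k (lead_monom prec f)"
            using lead_monom(2)[OF False] by blast
        qed
      qed
    qed
  qed
  show ?thesis
  proof (cases "f = 0")
    case True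
    then show ?thesis
      using ideal_type_zero[OF id] by (intro exI[of _ 0]) simp
  next
    case False
    then show ?thesis
      using *[of f "lead_monom prec f"] lead_monom(2)[OF False] assms(3) by blast
  qed
qed

text \<open>A graded order keeps all terms of a reducer within the degree of its leading monomial.
  This makes normal forms compatible with counting up to a degree, even for ideals that are not
  graded.\<close>

lemma reduce_bounded:
  fixes J :: "('v, 'k::field) mpoly set"
  assumes id: "mpoly_ideal J" and "keys f \<subseteq> {a. tdeg a \<le> d}"
  shows "\<exists>r. f - r \<in> J \<and> keys r \<subseteq> {a. tdeg a \<le> d} - leads J"
proof (rule reduce_mod_ideal[OF id _ assms(2)])
  fix a assume a: "a \<in> leads J" "a \<in> {a. tdeg a \<le> d}"
  then obtain h where h: "h \<in> J" "h \<noteq> 0" "lead_monom prec h = a"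
    by (auto simp: leads_def)
  have "keys h \<subseteq> {a. tdeg a \<le> d}"
  proof
    fix k assume "k \<in> keys h"
    then have "k = a \<or> prec k a"
      using lead_monom(2)[OF h(2)] h(3) by metis
    then show "k \<in> {a. tdeg a \<le> d}"
      using prec_imp_tdeg_le[of k a] a(2) by auto
  qed
  then show "\<exists>h\<in>J. h \<noteq> 0 \<and> lead_monom prec h = a \<and> keys h \<subseteq> {a. tdeg a \<le> d}"
    using h by blast
qed

lemma reduce:
  fixes J :: "('v, 'k::field) mpoly set"
  assumes id: "mpoly_ideal J"
  shows "\<exists>r. f - r \<in> J \<and> keys r \<subseteq> - leads J"
proof -
  have "\<exists>r. f - r \<in> J \<and> keys r \<subseteq> UNIV - leads J"
    by (rule reduce_mod_ideal[OF id]) (auto simp: leads_def)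
  then show ?thesis
    by (simp add: Compl_eq_Diff_UNIV)
qed

text \<open>The leading monomial of a nonzero \<open>r\<close> in \<open>J\<close> belongs to
  \<open>leads J\<close>. This is the linear independence of standard monomials modulo
  \<open>J\<close>.\<close>

lemma not_in_ideal_if_standard:
  fixes J :: "('v, 'k::field) mpoly set"
  assumes "r \<in> J" "keys r \<subseteq> - leads J"
  shows "r = 0"
  using assms lead_monom(1)[of r] leadsI[of r J] by blast

end

lemma lookup_hom_component:
  "lookup (hom_component d f) a = (if tdeg a = d then lookup f a else 0)"
proof -
  have "lookup (hom_component d f) a
      = (\<Sum>b\<in>{b \<in> keys f. tdeg b = d}. if a = b then lookup f b else 0)"
    unfolding hom_component_def lookup_sum
    by (intro sum.cong) (auto simp: lookup_single when_def)
  also have "\<dots> = (if a \<in> {b \<in> keys f. tdeg b = d} then lookup f a else 0)"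
    by (rule sum.delta') simp
  finally show ?thesis
    by (auto simp: in_keys_iff)
qed

lemma keys_hom_component: "keys (hom_component d f) = {a \<in> keys f. tdeg a = d}"
  by (auto simp: in_keys_iff lookup_hom_component split: if_splits)

lemma hom_component_add: "hom_component d (f + g) = hom_component d f + hom_component d g"
  by (rule poly_mapping_eqI) (simp add: lookup_hom_component lookup_add)

lemma hom_component_sum: "hom_component d (\<Sum>i\<in>A. f i) = (\<Sum>i\<in>A. hom_component d (f i))"
  by (rule poly_mapping_eqI) (simp add: lookup_hom_component lookup_sum)

lemma sum_hom_components:
  assumes "\<And>a. a \<in> keys f \<Longrightarrow> tdeg a \<le> N"
  shows "(\<Sum>d\<le>N. hom_component d f) = f"
proof (rule poly_mapping_eqI)
  fix a
  have "lookup (\<Sum>d\<le>N. hom_component d f) a = (\<Sum>d\<le>N. if d = tdeg a then lookup f a else 0)"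
    by (auto simp: lookup_sum lookup_hom_component intro: sum.cong)
  also have "\<dots> = lookup f a"
    using assms by (auto simp: in_keys_iff)
  finally show "lookup (\<Sum>d\<le>N. hom_component d f) a = lookup f a" .
qed

text \<open>If the leading monomial of an element of \<open>J\<close> has degree \<open>d\<close>,
  the component of degree \<open>d\<close> keeps it and is again in \<open>J\<close>, so homogeneous
  reducers exist.\<close>

lemma (in graded_order) reduce_homogeneous:
  fixes J :: "('v, 'k::field) mpoly set"
  assumes gr: "graded_ideal J" and "f \<in> homogeneous_part d"
  shows "\<exists>r. f - r \<in> J \<and> keys r \<subseteq> {a. tdeg a = d} - leads J"
proof (rule reduce_mod_ideal)
  show "mpoly_ideal J"
    using gr by (simp add: graded_ideal_def)
  show "keys f \<subseteq> {a. tdeg a = d}"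
    using assms(2) by (auto simp: homogeneous_part_def)
  fix a assume a: "a \<in> leads J" "a \<in> {a. tdeg a = d}"
  then obtain h where h: "h \<in> J" "h \<noteq> 0" "lead_monom prec h = a"
    by (auto simp: leads_def)
  let ?h = "hom_component d h"
  have ah: "a \<in> keys ?h"
    using lead_monom(1)[OF h(2)] h(3) a(2) by (simp add: keys_hom_component)
  have "lead_monom prec ?h = a"
    by (rule lead_monom_eqI[OF ah]) (use lead_monom(2)[OF h(2)] h(3) in \<open>auto simp: keys_hom_component\<close>)
  moreover have "?h \<in> J"
    using gr h(1) by (simp add: graded_ideal_def)
  moreover have "keys ?h \<subseteq> {a. tdeg a = d}"
    by (auto simp: keys_hom_component)
  moreover have "?h \<noteq> 0"
    using ah by auto
  ultimately show "\<exists>h\<in>J. h \<noteq> 0 \<and> lead_monom prec h = a \<and> keys h \<subseteq> {a. tdeg a = d}"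
    by blast
qed

section \<open>The Hilbert function counts standard monomials\<close>

lemma subfield_constants: "subfield (constants :: ('v::finite, 'k::field) mpoly set) mpoly_ring"
proof -
  interpret cring "mpoly_ring :: ('v, 'k) mpoly ring" by (rule cring_from_type_algebra)
  have const: "Poly_Mapping.single 0 c \<in> constants" for c :: 'k
    by (auto simp: constants_def)
  have uminus: "\<ominus>\<^bsub>mpoly_ring\<^esub> f = - f" for f :: "('v, 'k) mpoly"
    using minus_equality[of "- f" f] by simp
  show ?thesis
  proof (rule subfieldI)
    show "subcring (constants :: ('v, 'k) mpoly set) mpoly_ring"
    proof (rule subcringI'[OF subringI])
      show "\<one>\<^bsub>mpoly_ring\<^esub> \<in> (constants :: ('v, 'k) mpoly set)"
        using const[of 1] by simp
      fix h :: "('v, 'k) mpoly" assume "h \<in> constants"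
      then show "\<ominus>\<^bsub>mpoly_ring\<^esub> h \<in> constants"
        using const by (auto simp: uminus constants_def simp flip: single_uminus)
    next
      fix h h' :: "('v, 'k) mpoly" assume "h \<in> constants" "h' \<in> constants"
      then show "h \<otimes>\<^bsub>mpoly_ring\<^esub> h' \<in> constants" "h \<oplus>\<^bsub>mpoly_ring\<^esub> h' \<in> constants"
        by (auto simp: constants_def mult_single simp flip: single_add)
    qed simp
    show "Units (mpoly_ring\<lparr>carrier := constants :: ('v, 'k) mpoly set\<rparr>) = constants - {\<zero>\<^bsub>mpoly_ring\<^esub>}"
    proof (intro equalityI subsetI)
      fix h :: "('v, 'k) mpoly"
      assume "h \<in> Units (mpoly_ring\<lparr>carrier := constants\<rparr>)"
      then show "h \<in> constants - {\<zero>\<^bsub>mpoly_ring\<^esub>}"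
        by (auto simp: Units_def)
    next
      fix h :: "('v, 'k) mpoly"
      assume h: "h \<in> constants - {\<zero>\<^bsub>mpoly_ring\<^esub>}"
      then obtain c where c: "h = Poly_Mapping.single 0 c"
        by (auto simp: constants_def)
      with h have "c \<noteq> 0"
        by auto
      with c have "Poly_Mapping.single 0 (inverse c) * h = 1" "h * Poly_Mapping.single 0 (inverse c) = 1"
        by (simp_all add: mult_single)
      then show "h \<in> Units (mpoly_ring\<lparr>carrier := constants\<rparr>)"
        using c const unfolding Units_def by auto
    qed
  qed
qed

text \<open>Properness keeps 1 and 0 apart in the quotient, so that the image of the constants is
  again a field over which dimensions can be taken.\<close>

locale proper_mpoly_ideal =
  fixes J :: "('v::finite, 'k::field) mpoly set"
  assumes ideal_J: "mpoly_ideal J" and one_notin: "1 \<notin> J"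
begin

abbreviation quot_proj :: "('v, 'k) mpoly \<Rightarrow> ('v, 'k) mpoly set" ("\<pi>") where
  "\<pi> f \<equiv> J +>\<^bsub>mpoly_ring\<^esub> f"

sublocale proj: ring_hom_ring mpoly_ring "mpoly_ring Quot J" \<pi>
  by (rule ideal.rcos_ring_hom_ring[OF ideal_J])

lemma proj_eq: "\<pi> f = (\<lambda>j. j + f) ` J"
  by (auto simp: a_r_coset_def')

lemma proj_eq_iff: "\<pi> f = \<pi> g \<longleftrightarrow> f - g \<in> J"
proof
  assume "\<pi> f = \<pi> g"
  moreover have "f \<in> \<pi> f"
    using ideal_type_zero[OF ideal_J] by (force simp: proj_eq)
  ultimately obtain j where "j \<in> J" "f = j + g"
    by (auto simp: proj_eq)
  then show "f - g \<in> J"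
    by simp
next
  have *: "\<pi> f \<subseteq> \<pi> g" if fg: "f - g \<in> J" for f g
  proof
    fix x assume "x \<in> \<pi> f"
    then obtain j where j: "j \<in> J" "x = j + f"
      by (auto simp: proj_eq)
    then have "j + (f - g) \<in> J"
      using ideal_type_add[OF ideal_J j(1) fg] by simp
    moreover have "x = (j + (f - g)) + g"
      using j by simp
    ultimately show "x \<in> \<pi> g"
      unfolding proj_eq by (rule rev_image_eqI)
  qed
  assume "f - g \<in> J"
  moreover from this have "g - f \<in> J"
    using ideal_type_uminus[OF ideal_J, of "f - g"] by simp
  ultimately show "\<pi> f = \<pi> g"
    using * by blast
qed

lemma proj_add: "\<pi> f \<oplus>\<^bsub>mpoly_ring Quot J\<^esub> \<pi> g = \<pi> (f + g)"
  using proj.hom_add[of f g] by simp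

lemma proj_mult: "\<pi> f \<otimes>\<^bsub>mpoly_ring Quot J\<^esub> \<pi> g = \<pi> (f * g)"
  using proj.hom_mult[of f g] by simp

lemma proj_zero: "\<zero>\<^bsub>mpoly_ring Quot J\<^esub> = \<pi> 0"
  using proj.hom_zero by simp

lemma proj_one: "\<one>\<^bsub>mpoly_ring Quot J\<^esub> = \<pi> 1"
  using proj.hom_one by simp

lemma subfield_proj: "subfield (\<pi> ` constants) (mpoly_ring Quot J)"
  by (rule proj.img_is_subfield[OF subfield_constants])
    (simp add: proj_zero proj_one proj_eq_iff one_notin)

lemma Span_proj_monomials:
  assumes "distinct as"
  shows "proj.S.Span (\<pi> ` constants) (map (\<lambda>a. \<pi> (mono_poly a)) as) = \<pi> ` {f. keys f \<subseteq> set as}"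
  using assms
proof (induction as)
  case Nil
  have "{f :: ('v, 'k) mpoly. keys f \<subseteq> set []} = {0}"
    using poly_mapping_eq_sum_singles[of "{}"] by auto
  then show ?case
    by (simp add: proj_zero)
next
  case (Cons a as)
  let ?K = "\<pi> ` constants"
  have "proj.S.line_extension ?K (\<pi> (mono_poly a)) (\<pi> ` {f. keys f \<subseteq> set as})
      = \<pi> ` {f. keys f \<subseteq> set (a # as)}"
  proof (intro equalityI subsetI)
    fix x assume "x \<in> proj.S.line_extension ?K (\<pi> (mono_poly a)) (\<pi> ` {f. keys f \<subseteq> set as})"
    then obtain k y where ky: "k \<in> ?K" "y \<in> \<pi> ` {f. keys f \<subseteq> set as}"
      "x = (k \<otimes>\<^bsub>mpoly_ring Quot J\<^esub> \<pi> (mono_poly a)) \<oplus>\<^bsub>mpoly_ring Quot J\<^esub> y"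
      unfolding proj.S.line_extension_mem_iff by (elim bexE)
    from ky(1) obtain c where c: "k = \<pi> (Poly_Mapping.single 0 c)"
      unfolding constants_def by blast
    from ky(2) obtain f where f: "y = \<pi> f" "keys f \<subseteq> set as"
      by blast
    from ky(3) c f have cf: "keys f \<subseteq> set as"
      "x = (\<pi> (Poly_Mapping.single 0 c) \<otimes>\<^bsub>mpoly_ring Quot J\<^esub> \<pi> (mono_poly a)) \<oplus>\<^bsub>mpoly_ring Quot J\<^esub> \<pi> f"
      by simp_all
    let ?g = "Poly_Mapping.single a c + f"
    have "x = \<pi> ?g"
      using cf(2) by (simp only: proj_mult proj_add single_eq_const_mult_mono[of a c])
    moreover have "keys ?g \<subseteq> set (a # as)"
      using cf(1) keys_add[of "Poly_Mapping.single a c" f] by (auto split: if_splits)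
    ultimately show "x \<in> \<pi> ` {f. keys f \<subseteq> set (a # as)}"
      by blast
  next
    fix x assume "x \<in> \<pi> ` {f. keys f \<subseteq> set (a # as)}"
    then obtain g where g: "keys g \<subseteq> set (a # as)" "x = \<pi> g"
      by blast
    define f where "f = g - Poly_Mapping.single a (lookup g a)"
    have gf: "g = Poly_Mapping.single 0 (lookup g a) * mono_poly a + f"
      by (simp add: f_def flip: single_eq_const_mult_mono)
    have "keys f \<subseteq> set as"
      using g(1) by (auto simp: f_def in_keys_iff lookup_minus lookup_single when_def split: if_splits)
    then have "\<pi> f \<in> \<pi> ` {f. keys f \<subseteq> set as}"
      by blast
    moreover have "\<pi> (Poly_Mapping.single 0 (lookup g a)) \<in> ?K"
      by (auto simp: constants_def)
    moreover have "x = (\<pi> (Poly_Mapping.single 0 (lookup g a)) \<otimes>\<^bsub>mpoly_ring Quot J\<^esub> \<pi> (mono_poly a)) \<oplus>\<^bsub>mpoly_ring Quot J\<^esub> \<pi> f"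
      unfolding g(2) proj_mult proj_add by (rule arg_cong[OF gf])
    ultimately show "x \<in> proj.S.line_extension ?K (\<pi> (mono_poly a)) (\<pi> ` {f. keys f \<subseteq> set as})"
      unfolding proj.S.line_extension_mem_iff by blast
  qed
  then show ?case
    using Cons by simp
qed

end

lemma (in graded_order) independent_standard_monomials:
  assumes "proper_mpoly_ideal (J :: ('v, 'k::field) mpoly set)"
    and "distinct as" "set as \<inter> leads J = {}"
  shows "ring.independent (mpoly_ring Quot J) ((\<lambda>f. J +>\<^bsub>mpoly_ring\<^esub> f) ` constants)
    (map (\<lambda>a. J +>\<^bsub>mpoly_ring\<^esub> mono_poly a) as)"
proof -
  interpret proper_mpoly_ideal J by fact
  show ?thesis
    using assms(2,3)
  proof (induction as)
    case Nil
    then show ?case by simp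
  next
    case (Cons a as)
    have "\<pi> (mono_poly a) \<notin> proj.S.Span (\<pi> ` constants) (map (\<lambda>a. \<pi> (mono_poly a)) as)"
    proof
      assume "\<pi> (mono_poly a) \<in> proj.S.Span (\<pi> ` constants) (map (\<lambda>a. \<pi> (mono_poly a)) as)"
      then obtain f where f: "keys f \<subseteq> set as" "\<pi> (mono_poly a) = \<pi> f"
        using Span_proj_monomials[of as] Cons.prems(1) by auto
      have "keys (mono_poly a - f) \<subseteq> insert a (set as)"
        using f(1) by (auto simp: in_keys_iff lookup_minus mono_poly_def lookup_single when_def split: if_splits)
      then have "mono_poly a - f = 0"
        using f(2) Cons.prems(2) by (intro not_in_ideal_if_standard) (auto simp: proj_eq_iff)
      then have "keys f = {a}"
        by (metis eq_iff_diff_eq_0 keys_mono_poly)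
      then show False
        using f(1) Cons.prems(1) by auto
    qed
    moreover have "\<pi> (mono_poly a) \<in> carrier (mpoly_ring Quot J)"
      using proj.hom_closed[of "mono_poly a"] by simp
    ultimately show ?case
      using Cons by (auto intro!: proj.S.independent.li_Cons)
  qed
qed

text \<open>Macaulay's basis theorem in degree \<open>d\<close>: the standard monomials span because
  homogeneous normal forms exist, and they are independent.\<close>

lemma (in graded_order) hilbert_fun_eq:
  fixes J :: "('v, 'k::field) mpoly set"
  assumes "graded_ideal J" "1 \<notin> J"
  shows "hilbert_fun J d = card ({a. tdeg a = d} - leads J)"
proof -
  have id: "mpoly_ideal J"
    using assms(1) by (simp add: graded_ideal_def)
  then interpret proper_mpoly_ideal J
    using assms(2) by (rule proper_mpoly_ideal.intro)
  let ?A = "{a. tdeg a = d} - leads J"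
  have "finite ?A"
    using finite_tdeg_eq by blast
  then obtain as where as: "set as = ?A" "distinct as"
    using finite_distinct_list by blast
  have ind: "proj.S.independent (\<pi> ` constants) (map (\<lambda>a. \<pi> (mono_poly a)) as)"
    by (rule independent_standard_monomials) (use as in \<open>auto intro: proper_mpoly_ideal_axioms\<close>)
  have "\<pi> ` {f. keys f \<subseteq> set as} = \<pi> ` homogeneous_part d"
  proof (intro equalityI subsetI)
    fix x assume "x \<in> \<pi> ` {f. keys f \<subseteq> set as}"
    then show "x \<in> \<pi> ` homogeneous_part d"
      using as(1) by (auto simp: homogeneous_part_def)
  next
    fix x assume "x \<in> \<pi> ` homogeneous_part d"
    then obtain f where f: "f \<in> homogeneous_part d" "x = \<pi> f"
      by blast
    obtain r where "f - r \<in> J" "keys r \<subseteq> ?A"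
      using reduce_homogeneous[OF assms(1) f(1)] by blast
    then show "x \<in> \<pi> ` {f. keys f \<subseteq> set as}"
      using f(2) as(1) by (intro image_eqI[of _ _ r]) (auto simp: proj_eq_iff)
  qed
  then have "proj.S.dimension (length as) (\<pi> ` constants) (\<pi> ` homogeneous_part d)"
    using proj.S.dimension_independent[OF ind] Span_proj_monomials[OF as(2)] by simp
  then have "proj.S.dim (\<pi> ` constants) (\<pi> ` homogeneous_part d) = length as"
    using proj.S.dimI[OF subfield_proj] by (simp add: over_def)
  then show ?thesis
    using as by (simp add: hilbert_fun_def quot_dim_def distinct_card flip: as(1))
qed

section \<open>Chains of prime ideals and growth of standard monomials\<close>

text \<open>There are fewer equations \<open>m\<close> than unknowns \<open>c a\<close>; this is
  Gaussian elimination, by induction on the set of equations.\<close>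

lemma homogeneous_linear_system:
  fixes w :: "'a \<Rightarrow> 'b \<Rightarrow> 'k::field"
  assumes "finite M" "finite A" "card M < card A"
  shows "\<exists>c. (\<exists>a\<in>A. c a \<noteq> 0) \<and> (\<forall>m\<in>M. (\<Sum>a\<in>A. c a * w a m) = 0)"
  using assms
proof (induction M arbitrary: A w rule: finite_induct)
  case empty
  then have "A \<noteq> {}" by auto
  then show ?case by (intro exI[of _ "\<lambda>_. 1"]) auto
next
  case (insert m M)
  show ?case
  proof (cases "\<forall>a\<in>A. w a m = 0")
    case True
    obtain c where "\<exists>a\<in>A. c a \<noteq> 0" "\<forall>m\<in>M. (\<Sum>a\<in>A. c a * w a m) = 0"
      using insert.IH[of A w] insert.prems insert.hyps by auto
    then show ?thesis
      using True by (intro exI[of _ c]) auto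
  next
    case False
    then obtain b where b: "b \<in> A" "w b m \<noteq> 0" by blast
    let ?B = "A - {b}"
    \<comment> \<open>Pivot on the unknown \<open>b\<close>: eliminating it by means of equation
      \<open>m\<close> leaves the coefficients \<open>w'\<close>, for which equation
      \<open>m\<close> is trivial. The value \<open>c' b\<close> below solves equation
      \<open>m\<close> for the pivot.\<close>
    define w' where "w' a l = w a l - w a m / w b m * w b l" for a l
    have "card M < card ?B"
      using insert.prems insert.hyps b(1) by simp
    then obtain c where c: "\<exists>a\<in>?B. c a \<noteq> 0" "\<forall>l\<in>M. (\<Sum>a\<in>?B. c a * w' a l) = 0"
      using insert.IH[of ?B w'] insert.prems(1) by auto
    define c' where "c' a = (if a = b then - (\<Sum>a\<in>?B. c a * (w a m / w b m)) else c a)" for a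
    have sum: "(\<Sum>a\<in>A. c' a * w a l) = (\<Sum>a\<in>?B. c a * w' a l)" for l
    proof -
      have "(\<Sum>a\<in>A. c' a * w a l) = c' b * w b l + (\<Sum>a\<in>?B. c' a * w a l)"
        using b(1) insert.prems(1) by (simp add: sum.remove)
      also have "(\<Sum>a\<in>?B. c' a * w a l) = (\<Sum>a\<in>?B. c a * w a l)"
        by (intro sum.cong) (auto simp: c'_def)
      also have "c' b * w b l = - (\<Sum>a\<in>?B. c a * (w a m / w b m) * w b l)"
        by (simp add: c'_def sum_distrib_right)
      also have "- (\<Sum>a\<in>?B. c a * (w a m / w b m) * w b l) + (\<Sum>a\<in>?B. c a * w a l)
          = (\<Sum>a\<in>?B. c a * w' a l)"
        by (simp add: w'_def algebra_simps sum_subtractf)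
      finally show ?thesis .
    qed
    have "(\<Sum>a\<in>?B. c a * w' a m) = 0"
      using b(2) by (simp add: w'_def)
    then have "\<forall>l\<in>insert m M. (\<Sum>a\<in>A. c' a * w a l) = 0"
      using sum c(2) by simp
    moreover have "\<exists>a\<in>A. c' a \<noteq> 0"
      using c(1) by (auto simp: c'_def)
    ultimately show ?thesis by blast
  qed
qed

section \<open>Growth of the affine Hilbert function along inclusions of primes\<close>

context graded_order begin

text \<open>The affine Hilbert function of \<open>S/J\<close>. All degrees up to \<open>d\<close>
  are counted, rather than degree \<open>d\<close> alone, because the primes in a chain need not be
  graded.\<close>

definition standard_count :: "('v, 'k::field) mpoly set \<Rightarrow> nat \<Rightarrow> nat" where
  "standard_count J d = card ({a. tdeg a \<le> d} - leads J)"

lemma finite_standard [simp]: "finite ({a. tdeg a \<le> d} - leads J)"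
  using finite_tdeg_le by blast

lemma standard_count_mono: "d \<le> d' \<Longrightarrow> standard_count J d \<le> standard_count J d'"
  unfolding standard_count_def by (rule card_mono) auto

lemma standard_count_antimono: "J \<subseteq> J' \<Longrightarrow> standard_count J' d \<le> standard_count J d"
  unfolding standard_count_def using leads_mono[of J J'] by (intro card_mono) auto

text \<open>
  Multiplication by some \<open>F \<in> Q - P\<close> of degree \<open>e\<close> is injective on \<open>S/P\<close> and maps into \<open>Q/P\<close>. If \<open>Q\<close>
  had too few leading monomials outside those of \<open>P\<close>, a linear system would produce a
  nonzero element of the kernel.
\<close>
lemma standard_count_prime_step:
  fixes P Q :: "('v, 'k::field) mpoly set"
  assumes P: "primeideal P mpoly_ring" and Q: "mpoly_ideal Q" and "P \<subset> Q"
  shows "\<exists>e. \<forall>d. standard_count Q (d + e) + standard_count P d \<le> standard_count P (d + e)"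
proof -
  have idP: "mpoly_ideal P" and prime: "\<And>a b. a * b \<in> P \<Longrightarrow> a \<in> P \<or> b \<in> P"
    using P by (auto simp: primeideal_type_iff)
  obtain F where F: "F \<in> Q" "F \<notin> P"
    using assms(3) by blast
  have "finite (tdeg ` keys F)"
    by simp
  then obtain e where e: "\<And>a. a \<in> keys F \<Longrightarrow> tdeg a \<le> e"
    by (metis finite_nat_set_iff_bounded_le imageI)
  show ?thesis
  proof (intro exI[of _ e] allI)
    fix d
    let ?A = "{a. tdeg a \<le> d} - leads P"
    let ?B = "{a. tdeg a \<le> d + e} - leads P"
    let ?M = "?B \<inter> leads Q"
    have "\<exists>w. mono_poly a * F - w \<in> P \<and> keys w \<subseteq> ?B" if a: "a \<in> ?A" for a
    proof (rule reduce_bounded[OF idP])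
      show "keys (mono_poly a * F) \<subseteq> {a. tdeg a \<le> d + e}"
        using keys_mult[of "mono_poly a" F] a e by (fastforce simp: tdeg_add)
    qed
    then obtain w where w: "\<And>a. a \<in> ?A \<Longrightarrow> mono_poly a * F - w a \<in> P"
      "\<And>a. a \<in> ?A \<Longrightarrow> keys (w a) \<subseteq> ?B"
      by metis
    have "\<not> card ?M < card ?A"
    proof
      assume "card ?M < card ?A"
      then obtain c where c: "\<exists>a\<in>?A. c a \<noteq> 0" "\<forall>m\<in>?M. (\<Sum>a\<in>?A. c a * lookup (w a) m) = 0"
        using homogeneous_linear_system[of ?M ?A "\<lambda>a. lookup (w a)"] by auto
      \<comment> \<open>\<open>u\<close> is the candidate for a kernel element and \<open>g\<close>
        is a normal form of \<open>u * F\<close> modulo \<open>P\<close>; the equations solved by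
        \<open>c\<close> say that \<open>g\<close> has no term at an exponent in
        \<open>?M\<close>.\<close>
      define u where "u = (\<Sum>a\<in>?A. Poly_Mapping.single a (c a))"
      define g where "g = (\<Sum>a\<in>?A. Poly_Mapping.single 0 (c a) * w a)"
      have lg: "lookup g m = (\<Sum>a\<in>?A. c a * lookup (w a) m)" for m
        by (simp add: g_def lookup_sum lookup_const_mult)
      have lu: "lookup u a = (if a \<in> ?A then c a else 0)" for a
      proof -
        have "lookup u a = (\<Sum>b\<in>?A. if b = a then c b else 0)"
          unfolding u_def lookup_sum by (intro sum.cong) (auto simp: lookup_single when_def)
        then show ?thesis by (simp add: sum.delta)
      qed
      have "u * F - g = (\<Sum>a\<in>?A. Poly_Mapping.single 0 (c a) * (mono_poly a * F - w a))"
        unfolding u_def g_def sum_distrib_right sum_subtractf[symmetric]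
      proof (rule sum.cong[OF refl])
        fix a
        show "Poly_Mapping.single a (c a) * F - Poly_Mapping.single 0 (c a) * w a
            = Poly_Mapping.single 0 (c a) * (mono_poly a * F - w a)"
          unfolding single_eq_const_mult_mono[of a "c a"] by (simp only: right_diff_distrib mult.assoc)
      qed
      also have "\<dots> \<in> P"
        by (rule ideal_type_sum[OF idP ideal_type_mult[OF idP w(1)]])
      finally have uF: "u * F - g \<in> P" .
      have "keys g \<subseteq> ?B"
      proof
        fix m assume "m \<in> keys g"
        then have "(\<Sum>a\<in>?A. c a * lookup (w a) m) \<noteq> 0"
          by (simp add: in_keys_iff lg)
        then obtain a where "a \<in> ?A" "c a * lookup (w a) m \<noteq> 0"
          by (meson sum.not_neutral_contains_not_neutral)
        then show "m \<in> ?B"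
          using w(2)[of a] by (auto simp: in_keys_iff)
      qed
      have "u * F \<in> Q"
        by (rule ideal_type_mult[OF Q F(1)])
      moreover have "u * F - g \<in> Q"
        using uF assms(3) by blast
      ultimately have "u * F - (u * F - g) \<in> Q"
        by (rule ideal_type_diff[OF Q])
      then have "g \<in> Q"
        by simp
      \<comment> \<open>As \<open>g\<close> lies in \<open>Q\<close> and is standard for
        \<open>P\<close>, its leading monomial would belong to \<open>?M\<close>, where all its
        coefficients vanish.\<close>
      have "g = 0"
      proof (rule ccontr)
        assume g: "g \<noteq> 0"
        have "lead_monom prec g \<in> ?M"
          using lead_monom(1)[OF g] \<open>keys g \<subseteq> ?B\<close> leadsI[OF \<open>g \<in> Q\<close> g] by blast
        then have "lookup g (lead_monom prec g) = 0"
          using c(2) lg by simp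
        then show False
          using lead_monom(1)[OF g] by (simp add: in_keys_iff)
      qed
      \<comment> \<open>Primality of \<open>P\<close> enters here: \<open>u * F\<close> is in
        \<open>P\<close> and \<open>F\<close> is not.\<close>
      then have "u \<in> P"
        using uF F(2) prime[of u F] by auto
      moreover have "keys u \<subseteq> - leads P"
        by (auto simp: in_keys_iff lu split: if_splits)
      ultimately have "u = 0"
        by (rule not_in_ideal_if_standard)
      then show False
        using c(1) lu by (metis lookup_zero)
    qed
    moreover have "card ?B = card ({a. tdeg a \<le> d + e} - leads Q) + card ?M"
    proof -
      have "?B = ({a. tdeg a \<le> d + e} - leads Q) \<union> ?M"
        using leads_mono[of P Q] assms(3) by auto
      moreover have "card (({a. tdeg a \<le> d + e} - leads Q) \<union> ?M)
          = card ({a. tdeg a \<le> d + e} - leads Q) + card ?M"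
        by (rule card_Un_disjoint) auto
      ultimately show ?thesis
        by simp
    qed
    ultimately show "standard_count Q (d + e) + standard_count P d \<le> standard_count P (d + e)"
      unfolding standard_count_def by linarith
  qed
qed

end

section \<open>Boxes of exponents and ideals generated by variables\<close>

lemma card_product_box:
  fixes S :: "'v::finite \<Rightarrow> nat set"
  assumes "\<And>v. finite (S v)"
  shows "card {a :: 'v expo. \<forall>v. lookup a v \<in> S v} = (\<Prod>v\<in>UNIV. card (S v))"
    and "finite {a :: 'v expo. \<forall>v. lookup a v \<in> S v}"
proof -
  have bij: "bij_betw lookup {a :: 'v expo. \<forall>v. lookup a v \<in> S v} (PiE UNIV S)"
    unfolding PiE_UNIV_domain
  proof (rule bij_betwI[where g = Abs_poly_mapping])
    show "Abs_poly_mapping \<in> Pi UNIV S \<rightarrow> {a. \<forall>v. lookup a v \<in> S v}"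
      by (auto simp: Pi_iff)
  qed (auto intro: poly_mapping_eqI)
  show "card {a :: 'v expo. \<forall>v. lookup a v \<in> S v} = (\<Prod>v\<in>UNIV. card (S v))"
    using bij_betw_same_card[OF bij] by (simp add: card_PiE)
  show "finite {a :: 'v expo. \<forall>v. lookup a v \<in> S v}"
    using bij_betw_finite[OF bij] finite_PiE[of UNIV S] assms by simp
qed

lemma card_box:
  fixes m :: "'v::finite \<Rightarrow> nat"
  shows "card {a :: 'v expo. \<forall>v. lookup a v < m v} = (\<Prod>v\<in>UNIV. m v)"
    and "finite {a :: 'v expo. \<forall>v. lookup a v < m v}"
  using card_product_box[of "\<lambda>v. {..<m v}"] by simp_all

definition coord_ideal :: "'v set \<Rightarrow> ('v::finite, 'k::field) mpoly set" where
  "coord_ideal C = ideal_gen (mono_poly ` {Poly_Mapping.single v 1 | v. v \<in> C})"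

lemma mem_coord_ideal_iff: "f \<in> coord_ideal C \<longleftrightarrow> (\<forall>k\<in>keys f. \<exists>v\<in>C. 0 < lookup k v)"
proof -
  have "mdvd (Poly_Mapping.single v 1) k \<longleftrightarrow> 0 < lookup k v" for v and k :: "'a expo"
    by (auto simp: mdvd_def lookup_single when_def)
  then show ?thesis
    unfolding coord_ideal_def mem_mono_ideal_iff by blast
qed

lemma ideal_coord_ideal: "mpoly_ideal (coord_ideal C)"
  unfolding coord_ideal_def by (rule genideal_type)

context graded_order begin

lemma leads_coord_ideal:
  "leads (coord_ideal C :: ('v, 'k::field) mpoly set) = {k. \<exists>v\<in>C. 0 < lookup k v}"
proof -
  have "mdvd (Poly_Mapping.single v 1) k \<longleftrightarrow> 0 < lookup k v" for v and k :: "'v expo"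
    by (auto simp: mdvd_def lookup_single when_def)
  then show ?thesis
    unfolding coord_ideal_def leads_mono_ideal by blast
qed

text \<open>Normal forms modulo this ideal are the polynomials in the variables outside
  \<open>C\<close>. They are closed under multiplication, and a product of nonzero ones is
  nonzero.\<close>

lemma prime_coord_ideal: "primeideal (coord_ideal C :: ('v, 'k::field) mpoly set) mpoly_ring"
  unfolding primeideal_type_iff
proof (intro conjI allI impI)
  let ?P = "coord_ideal C :: ('v, 'k) mpoly set"
  show id: "mpoly_ideal ?P"
    by (rule ideal_coord_ideal)
  show "1 \<notin> ?P"
    by (simp add: mem_coord_ideal_iff)
  fix a b :: "('v, 'k) mpoly" assume ab: "a * b \<in> ?P"
  obtain r where r: "a - r \<in> ?P" "keys r \<subseteq> - leads ?P"
    using reduce[OF id] by blast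
  obtain q where q: "b - q \<in> ?P" "keys q \<subseteq> - leads ?P"
    using reduce[OF id] by blast
  have "r * q = a * b - (a - r) * b - r * (b - q)"
    by (simp add: algebra_simps)
  also have "\<dots> \<in> ?P"
    by (intro ideal_type_diff[OF id] ab ideal_type_mult[OF id q(1)] ideal_type_mult'[OF id r(1)])
  finally have "r * q \<in> ?P" .
  moreover have "keys (r * q) \<subseteq> - leads ?P"
    using keys_mult[of r q] r(2) q(2) unfolding leads_coord_ideal by (fastforce simp: lookup_add)
  ultimately have "r * q = 0"
    by (rule not_in_ideal_if_standard)
  then have "r = 0 \<or> q = 0"
    using mult_nonzero by blast
  then show "a \<in> ?P \<or> b \<in> ?P"
    using r(1) q(1) by auto
qed

lemma standard_count_le: "standard_count J d \<le> (d + 1) ^ CARD('v)"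
proof -
  have "{a. tdeg a \<le> d} - leads J \<subseteq> {a :: 'v expo. \<forall>v. lookup a v < d + 1}"
    using lookup_le_tdeg order_trans by (fastforce simp: less_Suc_eq_le)
  then have "standard_count J d \<le> card {a :: 'v expo. \<forall>v. lookup a v < d + 1}"
    unfolding standard_count_def by (rule card_mono[OF card_box(2)])
  also have "\<dots> = (d + 1) ^ CARD('v)"
    by (simp only: card_box(1)) simp
  finally show ?thesis .
qed

text \<open>Exponents that vanish on \<open>C\<close> and are at most \<open>d\<close> elsewhere are
  standard and have degree at most \<open>CARD('v) * d\<close>. So the growth order is at least the
  number of variables outside \<open>C\<close>.\<close>

lemma standard_count_coord_ideal_ge:
  "(d + 1) ^ (CARD('v) - card C) \<le> standard_count (coord_ideal C :: ('v, 'k::field) mpoly set) (CARD('v) * d)"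
proof -
  let ?m = "\<lambda>v. if v \<in> C then 1 else d + 1"
  have "{a :: 'v expo. \<forall>v. lookup a v < ?m v} \<subseteq> {a. tdeg a \<le> CARD('v) * d} - leads (coord_ideal C :: ('v, 'k) mpoly set)"
  proof (intro subsetI DiffI CollectI notI)
    fix a :: "'v expo" assume a: "a \<in> {a. \<forall>v. lookup a v < ?m v}"
    then have "lookup a v \<le> d" for v
      by (auto dest!: spec[of _ v] split: if_splits)
    then show "tdeg a \<le> CARD('v) * d"
      unfolding tdeg_def using sum_bounded_above[of UNIV "lookup a" d] by simp
    assume "a \<in> leads (coord_ideal C :: ('v, 'k) mpoly set)"
    then obtain v where "v \<in> C" "0 < lookup a v"
      unfolding leads_coord_ideal by blast
    moreover have "lookup a v < ?m v"
      using a by blast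
    ultimately show False
      by simp
  qed
  then have "card {a :: 'v expo. \<forall>v. lookup a v < ?m v} \<le> standard_count (coord_ideal C :: ('v, 'k) mpoly set) (CARD('v) * d)"
    unfolding standard_count_def by (rule card_mono[OF finite_standard])
  moreover have "(\<Prod>v\<in>UNIV. ?m v) = (d + 1) ^ (CARD('v) - card C)"
  proof -
    have "(\<Prod>v\<in>UNIV. ?m v) = (\<Prod>v\<in>C. ?m v) * (\<Prod>v\<in>-C. ?m v)"
      by (metis Compl_disjoint Compl_eq_Diff_UNIV finite_class.finite_UNIV mult.commute prod.subset_diff subset_UNIV)
    also have "\<dots> = (d + 1) ^ card (- C)"
      by simp
    finally show ?thesis
      by (simp add: Compl_eq_Diff_UNIV card_Diff_subset)
  qed
  ultimately show ?thesis
    by (simp only: card_box(1))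
qed

section \<open>Bounding the length of prime chains\<close>

lemma standard_count_step_iterate:
  fixes P Q :: "('v, 'k::field) mpoly set"
  assumes "primeideal P mpoly_ring" "mpoly_ideal Q" "P \<subset> Q"
  shows "\<exists>e. \<forall>d m. m * standard_count Q d \<le> standard_count P (d + m * e)"
proof -
  obtain e where e: "\<And>d. standard_count Q (d + e) + standard_count P d \<le> standard_count P (d + e)"
    using standard_count_prime_step[OF assms] by blast
  have "m * standard_count Q d \<le> standard_count P (d + m * e)" for m d
  proof (induction m)
    case (Suc m)
    have "standard_count Q d \<le> standard_count Q (d + m * e + e)"
      by (rule standard_count_mono) simp
    then have "Suc m * standard_count Q d \<le> standard_count Q (d + m * e + e) + standard_count P (d + m * e)"
      using Suc by simp
    also have "\<dots> \<le> standard_count P (d + m * e + e)"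
      by (rule e)
    finally show ?case
      by (simp add: algebra_simps)
  qed simp
  then show ?thesis
    by blast
qed

text \<open>With \<open>m = d + 1\<close> the iterated step bounds \<open>d + 1\<close> times the
  count of \<open>Q\<close> by a count of \<open>P\<close> at a degree linear in \<open>d\<close>.
  Dividing by \<open>d + 1\<close> lowers the exponent by one.\<close>

lemma standard_count_growth_drops:
  fixes P Q :: "('v, 'k::field) mpoly set"
  assumes "primeideal P mpoly_ring" "mpoly_ideal Q" "P \<subset> Q"
    and C: "\<And>d. standard_count P d \<le> C * (d + 1) ^ Suc k"
  shows "\<exists>C'. \<forall>d. standard_count Q d \<le> C' * (d + 1) ^ k"
proof -
  obtain e where e: "\<And>d m. m * standard_count Q d \<le> standard_count P (d + m * e)"
    using standard_count_step_iterate[OF assms(1-3)] by blast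
  have "standard_count Q d \<le> C * (1 + e) ^ Suc k * (d + 1) ^ k" for d
  proof -
    have "(d + 1) * standard_count Q d \<le> C * (d + (d + 1) * e + 1) ^ Suc k"
      using e[of "d + 1" d] C[of "d + (d + 1) * e"] by linarith
    also have "d + (d + 1) * e + 1 = (1 + e) * (d + 1)"
      by (simp add: algebra_simps)
    also have "C * \<dots> ^ Suc k = (d + 1) * (C * (1 + e) ^ Suc k * (d + 1) ^ k)"
      by (simp only: power_mult_distrib power_Suc mult_ac)
    finally show ?thesis
      by (simp add: mult_le_cancel1 del: mult_Suc)
  qed
  then show ?thesis
    by blast
qed

text \<open>The monomial 1 is standard for the proper ideal \<open>Q\<close>, so arbitrary multiples
  of a positive number occur below the count of \<open>P\<close>. Hence no proper ideal lies
  strictly above a prime whose count is bounded.\<close>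

lemma standard_count_unbounded:
  fixes P Q :: "('v, 'k::field) mpoly set"
  assumes "primeideal P mpoly_ring" "mpoly_ideal Q" "1 \<notin> Q" "P \<subset> Q"
  shows "\<exists>d. C < standard_count P d"
proof -
  obtain e where e: "\<And>d m. m * standard_count Q d \<le> standard_count P (d + m * e)"
    using standard_count_step_iterate[OF assms(1,2,4)] by blast
  have "0 \<in> {a. tdeg a \<le> 0} - leads Q"
    using zero_not_in_leads[OF assms(2,3)] by simp
  then have "standard_count Q 0 > 0"
    unfolding standard_count_def by (metis card_gt_0_iff empty_iff finite_standard)
  then have "C < Suc C * standard_count Q 0"
    by (metis Suc_le_lessD le_square mult_le_mono2 nat_mult_1_right less_le_trans lessI Suc_leI One_nat_def)
  then show ?thesis
    using e[of "Suc C" 0] by (meson less_le_trans)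
qed

text \<open>Each step of the chain uses up one unit of the exponent \<open>k\<close>. When none is
  left the count is bounded and no further step is possible.\<close>

lemma prime_chain_growth:
  fixes P :: "nat \<Rightarrow> ('v, 'k::field) mpoly set"
  assumes "prime_chain mpoly_ring n P" "\<And>d. standard_count (P 0) d \<le> C * (d + 1) ^ k"
  shows "n \<le> k \<and> (\<exists>C'. \<forall>d. standard_count (P n) d \<le> C' * (d + 1) ^ (k - n))"
  using assms(1)
proof (induction n)
  case 0
  then show ?case
    using assms(2) by auto
next
  case (Suc n)
  have pr: "primeideal (P n) mpoly_ring" "primeideal (P (Suc n)) mpoly_ring" "P n \<subset> P (Suc n)"
    using Suc.prems by (auto simp: prime_chain_def)
  then have Q: "mpoly_ideal (P (Suc n))" "1 \<notin> P (Suc n)"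
    by (simp_all add: primeideal_type_iff)
  have "prime_chain mpoly_ring n P"
    using Suc.prems by (auto simp: prime_chain_def)
  then obtain C' where le: "n \<le> k" and C': "\<And>d. standard_count (P n) d \<le> C' * (d + 1) ^ (k - n)"
    using Suc.IH by blast
  have "n \<noteq> k"
  proof
    assume "n = k"
    then have "standard_count (P n) d \<le> C'" for d
      using C'[of d] by simp
    then show False
      using standard_count_unbounded[OF pr(1) Q pr(3), of C'] by (meson not_le)
  qed
  then have "Suc n \<le> k" "k - n = Suc (k - Suc n)"
    using le by simp_all
  then show ?case
    using standard_count_growth_drops[OF pr(1) Q(1) pr(3), of C' "k - Suc n"] C' by simp
qed

text \<open>A chain starts with growth order at most \<open>CARD('v)\<close>, and the ideal at its
  end still has growth order at least \<open>CARD('v) - card C\<close>, so it has used up at most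
  \<open>card C\<close> units.\<close>

lemma prime_height_coord_ideal_le:
  "prime_height mpoly_ring (coord_ideal C :: ('v, 'k::field) mpoly set) \<le> enat (card C)"
  unfolding prime_height_def
proof (rule SUP_least)
  fix n assume "n \<in> {n. \<exists>P. prime_chain mpoly_ring n P \<and> P n = (coord_ideal C :: ('v, 'k) mpoly set)}"
  then obtain P where P: "prime_chain mpoly_ring n P" "P n = (coord_ideal C :: ('v, 'k) mpoly set)"
    by blast
  let ?s = "CARD('v)"
  have "standard_count (P 0) d \<le> 1 * (d + 1) ^ ?s" for d
    using standard_count_le by simp
  from prime_chain_growth[OF P(1) this]
  obtain C' where n: "n \<le> ?s" and C': "\<And>d. standard_count (P n) d \<le> C' * (d + 1) ^ (?s - n)"
    by blast
  have "n \<le> card C"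
  proof (rule ccontr)
    assume "\<not> n \<le> card C"
    then have lt: "?s - card C = Suc (?s - n + (n - card C - 1))"
      using n by simp
    \<comment> \<open>The contradiction arises at degree \<open>?s * D\<close>: \<open>D\<close> is
      chosen so that the upper bound becomes \<open>(D + 1) ^ (?s - n) * D\<close>, while the lower
      bound has a further factor \<open>D + 1\<close> in place of \<open>D\<close>.\<close>
    define D where "D = C' * ?s ^ (?s - n)"
    have "D + 1 \<le> D"
    proof -
      let ?x = "D + 1"
      have "?x ^ (?s - n) * ?x \<le> ?x ^ (?s - card C)"
        using power_increasing[of "Suc (?s - n)" "?s - card C" ?x] lt by (simp add: mult.commute)
      also have "\<dots> \<le> standard_count (P n) (?s * D)"
        using standard_count_coord_ideal_ge[of D C] P(2) by simp
      also have "\<dots> \<le> C' * (?s * D + 1) ^ (?s - n)"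
        by (rule C')
      also have "\<dots> \<le> C' * (?s * ?x) ^ (?s - n)"
      proof (intro mult_left_mono power_mono)
        have "?s \<ge> 1" by (simp add: Suc_leI)
        then show "?s * D + 1 \<le> ?s * ?x" by simp
      qed simp_all
      also have "\<dots> = ?x ^ (?s - n) * D"
        by (simp only: power_mult_distrib D_def) (simp add: mult_ac)
      finally show ?thesis
        by (simp only: mult_le_cancel1) simp
    qed
    then show False by simp
  qed
  then show "enat n \<le> enat (card C)"
    by simp
qed

lemma ideal_height_le_card:
  assumes "J \<subseteq> (coord_ideal C :: ('v, 'k::field) mpoly set)"
  shows "ideal_height mpoly_ring J \<le> enat (card C)"
proof -
  have "ideal_height mpoly_ring J \<le> prime_height mpoly_ring (coord_ideal C :: ('v, 'k) mpoly set)"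
    unfolding ideal_height_def by (rule INF_lower) (simp add: assms prime_coord_ideal)
  then show ?thesis
    using prime_height_coord_ideal_le order_trans by blast
qed

end

section \<open>Krull dimension of quotients\<close>

context proper_mpoly_ideal begin

lemma cring_quot: "cring (mpoly_ring Quot J)"
  by (rule ideal.quotient_is_cring[OF ideal_J cring_from_type_algebra])

lemma carrier_quot: "carrier (mpoly_ring Quot J) = range \<pi>"
  by (auto simp: FactRing_def A_RCOSETS_def')

lemma prime_chain_vimage:
  assumes "prime_chain (mpoly_ring Quot J) n P"
  shows "prime_chain mpoly_ring n (\<lambda>i. {f. \<pi> f \<in> P i})" and "i \<le> n \<Longrightarrow> J \<subseteq> {f. \<pi> f \<in> P i}"
proof -
  have pr: "primeideal (P i) (mpoly_ring Quot J)" if "i \<le> n" for i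
    using assms that by (simp add: prime_chain_def)
  have sub: "P i \<subseteq> range \<pi>" if "i \<le> n" for i
  proof -
    interpret primeideal "P i" "mpoly_ring Quot J"
      using pr[OF that] .
    show ?thesis
      using a_subset by (simp add: carrier_quot)
  qed
  show "prime_chain mpoly_ring n (\<lambda>i. {f. \<pi> f \<in> P i})"
    unfolding prime_chain_def
  proof (intro conjI allI impI)
    fix i assume "i \<le> n"
    from proj.primeideal_vimage[OF cring_from_type_algebra pr[OF this]]
    show "primeideal {f. \<pi> f \<in> P i} mpoly_ring"
      by simp
  next
    fix i assume i: "i < n"
    then have "P i \<subset> P (Suc i)"
      using assms by (simp add: prime_chain_def)
    then obtain x where x: "x \<in> P (Suc i)" "x \<notin> P i" "P i \<subseteq> P (Suc i)"
      by blast
    have "x \<in> range \<pi>"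
      using sub[of "Suc i"] i x(1) by auto
    then obtain f where "x = \<pi> f"
      by (rule rangeE)
    then show "{f. \<pi> f \<in> P i} \<subset> {f. \<pi> f \<in> P (Suc i)}"
      using x by blast
  qed
  show "J \<subseteq> {f. \<pi> f \<in> P i}" if "i \<le> n"
  proof
    fix f assume "f \<in> J"
    then have "\<pi> f = \<pi> 0"
      by (simp add: proj_eq_iff)
    interpret primeideal "P i" "mpoly_ring Quot J"
      using pr[OF that] .
    show "f \<in> {f. \<pi> f \<in> P i}"
      using \<open>\<pi> f = \<pi> 0\<close> additive_subgroup.zero_closed[OF additive_subgroup_axioms] proj_zero by simp
  qed
qed

lemma proj_mem_image_iff:
  assumes "mpoly_ideal P" "J \<subseteq> P"
  shows "\<pi> f \<in> \<pi> ` P \<longleftrightarrow> f \<in> P"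
proof
  assume "\<pi> f \<in> \<pi> ` P"
  then obtain p where p: "p \<in> P" "f - p \<in> J"
    by (auto simp: proj_eq_iff)
  then have "(f - p) + p \<in> P"
    using assms(2) by (intro ideal_type_add[OF assms(1)]) auto
  then show "f \<in> P"
    by simp
qed simp

lemma primeideal_image:
  assumes P: "primeideal P mpoly_ring" and "J \<subseteq> P"
  shows "primeideal (\<pi> ` P) (mpoly_ring Quot J)"
proof -
  have id: "mpoly_ideal P" and one: "1 \<notin> P" and pr: "\<And>a b. a * b \<in> P \<Longrightarrow> a \<in> P \<or> b \<in> P"
    using P by (auto simp: primeideal_type_iff)
  note mem = proj_mem_image_iff[OF id assms(2)]
  show ?thesis
  proof (rule primeidealI)
    show "ideal (\<pi> ` P) (mpoly_ring Quot J)"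
      by (rule proj.R.ring_ideal_imp_quot_ideal[OF ideal_J id])
    show "cring (mpoly_ring Quot J)"
      by (rule cring_quot)
    show "carrier (mpoly_ring Quot J) \<noteq> \<pi> ` P"
      using mem[of 1] one by (metis carrier_quot rangeI)
    fix x y assume "x \<in> carrier (mpoly_ring Quot J)" "y \<in> carrier (mpoly_ring Quot J)"
    then obtain a b where ab: "x = \<pi> a" "y = \<pi> b"
      unfolding carrier_quot by blast
    assume "x \<otimes>\<^bsub>mpoly_ring Quot J\<^esub> y \<in> \<pi> ` P"
    then have "a * b \<in> P"
      unfolding ab proj_mult mem .
    then show "x \<in> \<pi> ` P \<or> y \<in> \<pi> ` P"
      unfolding ab mem by (rule pr)
  qed
qed

end

text \<open>The preimages of the primes in a chain contain \<open>J\<close>, so the first of them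
  grows no faster than \<open>J\<close>.\<close>

lemma (in graded_order) krull_dim_quot_le:
  assumes "proper_mpoly_ideal (J :: ('v, 'k::field) mpoly set)" "\<And>d. standard_count J d \<le> C * (d + 1) ^ k"
  shows "krull_dim (mpoly_ring Quot J) \<le> enat k"
  unfolding krull_dim_def
proof (rule SUP_least)
  interpret proper_mpoly_ideal J by fact
  fix n assume "n \<in> {n. \<exists>P. prime_chain (mpoly_ring Quot J) n P}"
  then obtain P where "prime_chain (mpoly_ring Quot J) n P"
    by blast
  note P = prime_chain_vimage[OF this]
  have "standard_count {f. \<pi> f \<in> P 0} d \<le> C * (d + 1) ^ k" for d
    using standard_count_antimono[OF P(2)[of 0], of d] assms(2)[of d] by simp
  from prime_chain_growth[OF P(1) this] show "enat n \<le> enat k"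
    by simp
qed

text \<open>Zorn's lemma gives an ideal that is maximal among those containing \<open>J\<close> and
  avoiding the multiplicative set \<open>M\<close>; any such ideal is prime.\<close>

lemma ex_prime_avoiding:
  fixes J :: "'a::comm_ring_1 set"
  assumes J: "ideal J ring_of_type_algebra" and disj: "J \<inter> M = {}"
    and M1: "1 \<in> M" and Mmult: "\<And>x y. x \<in> M \<Longrightarrow> y \<in> M \<Longrightarrow> x * y \<in> M"
  shows "\<exists>P. primeideal P ring_of_type_algebra \<and> J \<subseteq> P \<and> P \<inter> M = {}"
proof -
  let ?A = "{I. ideal I ring_of_type_algebra \<and> J \<subseteq> I \<and> I \<inter> M = {}}"
  have "\<exists>P\<in>?A. \<forall>I\<in>?A. P \<subseteq> I \<longrightarrow> I = P"
  proof (rule subset_Zorn_nonempty)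
    show "?A \<noteq> {}"
      using J disj by blast
    fix \<C> assume ne: "\<C> \<noteq> {}" and ch: "subset.chain ?A \<C>"
    then have \<C>: "\<And>I. I \<in> \<C> \<Longrightarrow> ideal I ring_of_type_algebra \<and> J \<subseteq> I \<and> I \<inter> M = {}"
      by (auto simp: subset_chain_def)
    have "ideal (\<Union>\<C>) ring_of_type_algebra"
      unfolding ideal_type_iff
    proof (intro conjI ballI allI)
      show "0 \<in> \<Union>\<C>"
        using ne \<C> ideal_type_zero by blast
      fix x assume "x \<in> \<Union>\<C>"
      then obtain I where I: "I \<in> \<C>" "x \<in> I" by blast
      show "r * x \<in> \<Union>\<C>" for r
        using I \<C>[OF I(1)] ideal_type_mult[of I x r] by blast
      fix y assume "y \<in> \<Union>\<C>"
      then obtain I' where I': "I' \<in> \<C>" "y \<in> I'" by blast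
      have "I \<subseteq> I' \<or> I' \<subseteq> I"
        using ch I(1) I'(1) by (auto simp: subset_chain_def)
      then obtain I'' where "I'' \<in> \<C>" "x \<in> I''" "y \<in> I''"
        using I I' by blast
      then show "x + y \<in> \<Union>\<C>"
        using \<C>[of I''] ideal_type_add[of I'' x y] by blast
    qed
    then show "\<Union>\<C> \<in> ?A"
      using \<C> ne by blast
  qed
  then obtain P where PA: "P \<in> ?A" and maxA: "\<forall>I\<in>?A. P \<subseteq> I \<longrightarrow> I = P"
    by (elim bexE)
  from PA have P: "ideal P ring_of_type_algebra" "J \<subseteq> P" "P \<inter> M = {}"
    by simp_all
  have max: "I = P" if "ideal I ring_of_type_algebra" "J \<subseteq> I" "I \<inter> M = {}" "P \<subseteq> I" for I
    using maxA that by simp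
  \<comment> \<open>By maximality the ideal generated by \<open>P\<close> and an element
    \<open>a\<close> outside \<open>P\<close> meets \<open>M\<close>. For two such elements the
    product of the resulting members of \<open>M\<close> would lie in \<open>P\<close> if the
    product of the elements did.\<close>
  have meets: "\<exists>p r. p \<in> P \<and> p + r * a \<in> M" if a: "a \<notin> P" for a
  proof (rule ccontr)
    assume contr: "\<not> ?thesis"
    define I where "I = {p + r * a | p r. p \<in> P}"
    have "ideal I ring_of_type_algebra"
      unfolding ideal_type_iff
    proof (intro conjI ballI allI)
      have "0 = 0 + 0 * a" by simp
      then show "0 \<in> I"
        using ideal_type_zero[OF P(1)] unfolding I_def by blast
      fix x assume "x \<in> I"
      then obtain p r where x: "x = p + r * a" "p \<in> P"
        unfolding I_def by blast
      have "t * x = t * p + (t * r) * a" for t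
        by (simp add: x algebra_simps)
      then show "t * x \<in> I" for t
        using ideal_type_mult[OF P(1) x(2)] unfolding I_def by blast
      fix y assume "y \<in> I"
      then obtain q t where y: "y = q + t * a" "q \<in> P"
        unfolding I_def by blast
      have "x + y = (p + q) + (r + t) * a"
        by (simp add: x y algebra_simps)
      then show "x + y \<in> I"
        using ideal_type_add[OF P(1) x(2) y(2)] unfolding I_def by blast
    qed
    moreover have "P \<subseteq> I"
    proof
      fix p assume "p \<in> P"
      moreover have "p = p + 0 * a" by simp
      ultimately show "p \<in> I" unfolding I_def by blast
    qed
    moreover have "I \<inter> M = {}"
      using contr unfolding I_def by blast
    ultimately have "I = P"
      using P(2) by (intro max) auto
    moreover have "a \<in> I"
    proof -
      have "a = 0 + 1 * a" by simp
      then show ?thesis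
        using ideal_type_zero[OF P(1)] unfolding I_def by blast
    qed
    ultimately show False
      using a by blast
  qed
  have "primeideal P ring_of_type_algebra"
    unfolding primeideal_type_iff
  proof (intro conjI allI impI P(1))
    show "1 \<notin> P"
      using P(3) M1 by blast
    fix a b assume ab: "a * b \<in> P"
    show "a \<in> P \<or> b \<in> P"
    proof (rule ccontr)
      assume "\<not> ?thesis"
      then obtain p r q t where pr: "p \<in> P" "p + r * a \<in> M" "q \<in> P" "q + t * b \<in> M"
        using meets[of a] meets[of b] by blast
      have "(p + r * a) * (q + t * b) = (q + t * b) * p + (r * a) * q + (r * t) * (a * b)"
        by (simp add: algebra_simps)
      also have "\<dots> \<in> P"
        by (intro ideal_type_add[OF P(1)] ideal_type_mult[OF P(1)] pr ab)
      finally show False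
        using Mmult[OF pr(2,4)] P(3) by blast
    qed
  qed
  then show ?thesis
    using P by blast
qed

lemma mono_poly_0 [simp]: "(mono_poly 0 :: ('v::finite, 'k::field) mpoly) = 1"
  by (simp add: mono_poly_def)

lemma (in graded_order) krull_dim_quot_ge_1:
  assumes gr: "graded_ideal (J :: ('v, 'k::field) mpoly set)"
    and notin: "\<And>n. mono_poly (Poly_Mapping.single v n) \<notin> J"
  shows "1 \<le> krull_dim (mpoly_ring Quot J)"
proof -
  let ?m = "coord_ideal UNIV :: ('v, 'k) mpoly set"
  let ?t = "\<lambda>n. mono_poly (Poly_Mapping.single v n) :: ('v, 'k) mpoly"
  have id: "mpoly_ideal J"
    using gr by (simp add: graded_ideal_def)
  interpret proper_mpoly_ideal J
    using id notin[of 0] by (intro proper_mpoly_ideal.intro) simp_all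
  have pm: "primeideal ?m mpoly_ring"
    by (rule prime_coord_ideal)
  then have m: "1 \<notin> ?m" "\<And>a b. a * b \<in> ?m \<Longrightarrow> a \<in> ?m \<or> b \<in> ?m" and idm: "mpoly_ideal ?m"
    by (auto simp: primeideal_type_iff)
  \<comment> \<open>A prime that avoids \<open>M\<close> lies in the ideal \<open>?m\<close> of all variables and omits \<open>?t 1\<close>.\<close>
  define M where "M = {?t n * u | n u. u \<notin> ?m}"
  have M_m: "f \<in> M" if "f \<notin> ?m" for f
  proof -
    have "f = ?t 0 * f"
      by simp
    then show ?thesis
      using that unfolding M_def by blast
  qed
  have tM: "?t 1 \<in> M"
  proof -
    have "?t 1 = ?t 1 * 1"
      by simp
    then show ?thesis
      using m(1) unfolding M_def by blast
  qed
  have "J \<inter> M = {}"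
  proof (rule ccontr)
    assume "J \<inter> M \<noteq> {}"
    then obtain n u where u: "?t n * u \<in> J" "u \<notin> ?m"
      unfolding M_def by blast
    obtain k where "k \<in> keys u" "\<forall>w. lookup k w = 0"
      using u(2) unfolding mem_coord_ideal_iff by auto
    moreover from this have "k = 0"
      by (intro poly_mapping_eqI) simp
    ultimately have u0: "lookup u 0 \<noteq> 0"
      by (simp add: in_keys_iff)
    \<comment> \<open>\<open>u\<close> has a nonzero constant term, so this component is a nonzero
      multiple of \<open>?t n\<close>. Gradedness puts it into \<open>J\<close>, against the
      assumption on the powers of \<open>v\<close>.\<close>
    have "hom_component n (?t n * u) = Poly_Mapping.single (Poly_Mapping.single v n) (lookup u 0)"
    proof (rule poly_mapping_eqI)
      fix a :: "'v expo"
      show "lookup (hom_component n (?t n * u)) a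
        = lookup (Poly_Mapping.single (Poly_Mapping.single v n) (lookup u 0)) a"
      proof (cases "a \<in> keys (?t n * u) \<and> tdeg a = n")
        case True
        then obtain k where "a = Poly_Mapping.single v n + k"
          by (auto simp: mono_poly_def keys_single_mult)
        moreover from this True have "k = 0"
          by (auto simp: tdeg_add tdeg_eq_0_iff)
        ultimately have "a = Poly_Mapping.single v n"
          by simp
        then show ?thesis
          using lookup_single_mult_add[of "Poly_Mapping.single v n" 1 u 0]
          by (simp add: lookup_hom_component mono_poly_def)
      next
        case False
        have "a \<noteq> Poly_Mapping.single v n"
        proof
          assume "a = Poly_Mapping.single v n"
          then have "a \<in> keys (?t n * u) \<and> tdeg a = n"
            using lookup_single_mult_add[of "Poly_Mapping.single v n" 1 u 0] u0
            by (simp add: in_keys_iff mono_poly_def)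
          then show False
            using False by blast
        qed
        then show ?thesis
          using False by (auto simp: lookup_hom_component lookup_single when_def in_keys_iff)
      qed
    qed
    then have "Poly_Mapping.single (Poly_Mapping.single v n) (lookup u 0) \<in> J"
      using gr u(1) unfolding graded_ideal_def by metis
    then have "Poly_Mapping.single 0 (inverse (lookup u 0)) * Poly_Mapping.single (Poly_Mapping.single v n) (lookup u 0) \<in> J"
      by (rule ideal_type_mult[OF id])
    then show False
      using notin[of n] u0 by (simp add: mult_single mono_poly_def)
  qed
  moreover have "1 \<in> M"
    by (rule M_m[OF m(1)])
  moreover have "x * y \<in> M" if xy: "x \<in> M" "y \<in> M" for x y
  proof -
    obtain n u n' u' where "x = ?t n * u" "u \<notin> ?m" "y = ?t n' * u'" "u' \<notin> ?m"
      using xy unfolding M_def by blast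
    moreover from this have "u * u' \<notin> ?m"
      using m(2) by blast
    moreover have "?t n * u * (?t n' * u') = ?t (n + n') * (u * u')"
      by (simp add: single_add mono_poly_add mult_ac)
    ultimately show ?thesis
      unfolding M_def by blast
  qed
  ultimately obtain P where P: "primeideal P mpoly_ring" "J \<subseteq> P" "P \<inter> M = {}"
    using ex_prime_avoiding[OF id, of M] by blast
  have idP: "mpoly_ideal P"
    using P(1) by (simp add: primeideal_type_iff)
  have Pm: "P \<subseteq> ?m"
    using P(3) M_m by blast
  have t1: "?t 1 \<in> ?m" "?t 1 \<notin> P"
    using tM P(3) by (auto simp: mem_coord_ideal_iff lookup_single intro: exI[of _ v])
  define c where "c i = (if i = (0::nat) then \<pi> ` P else \<pi> ` ?m)" for i
  have "prime_chain (mpoly_ring Quot J) 1 c"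
    unfolding prime_chain_def
  proof (intro conjI allI impI)
    fix i :: nat
    show "primeideal (c i) (mpoly_ring Quot J)"
      using primeideal_image[OF P(1,2)] primeideal_image[OF pm] P(2) Pm by (auto simp: c_def)
    assume "i < 1"
    moreover have "\<pi> (?t 1) \<in> \<pi> ` ?m" "\<pi> (?t 1) \<notin> \<pi> ` P"
      using t1 proj_mem_image_iff[OF idP P(2)] by blast+
    ultimately show "c i \<subset> c (Suc i)"
      using Pm by (auto simp: c_def)
  qed
  then show ?thesis
    unfolding krull_dim_def one_enat_def by (intro SUP_upper) blast
qed

section \<open>Graded ideals\<close>

lemma hom_component_homogeneous:
  assumes "f \<in> homogeneous_part e"
  shows "hom_component d f = (if d = e then f else 0)"
  using assms by (intro poly_mapping_eqI) (auto simp: lookup_hom_component homogeneous_part_def in_keys_iff)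

lemma homogeneous_mult:
  "f \<in> homogeneous_part d \<Longrightarrow> g \<in> homogeneous_part e \<Longrightarrow> f * g \<in> homogeneous_part (d + e)"
  using keys_mult[of f g] by (fastforce simp: homogeneous_part_def tdeg_add)

lemma hom_component_in_homogeneous_part: "hom_component d f \<in> homogeneous_part d"
  by (simp add: homogeneous_part_def keys_hom_component)

lemma ex_sum_hom_components: "\<exists>N. f = (\<Sum>d\<le>N. hom_component d f)"
proof -
  have "finite (tdeg ` keys f)"
    by simp
  then obtain N where "\<And>a. a \<in> keys f \<Longrightarrow> tdeg a \<le> N"
    by (metis finite_nat_set_iff_bounded_le imageI)
  then show ?thesis
    using sum_hom_components[of f N] by metis
qed

text \<open>The polynomials all of whose components lie in the generated ideal form an ideal
  themselves, so it suffices to test generators.\<close>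

lemma graded_ideal_gen:
  fixes M :: "('v::finite, 'k::field) mpoly set"
  assumes "\<And>g d. g \<in> M \<Longrightarrow> hom_component d g \<in> ideal_gen M"
  shows "graded_ideal (ideal_gen M)"
proof -
  let ?G = "ideal_gen M"
  let ?H = "{h. \<forall>d. hom_component d h \<in> ?G}"
  have id: "mpoly_ideal ?G"
    by (rule genideal_type)
  have "mpoly_ideal ?H"
    unfolding ideal_type_iff
  proof (intro conjI ballI allI)
    have "hom_component d 0 = (0 :: ('v, 'k) mpoly)" for d
      by (intro poly_mapping_eqI) (simp add: lookup_hom_component)
    then show "0 \<in> ?H"
      using ideal_type_zero[OF id] by simp
    fix h assume h: "h \<in> ?H"
    show "h + h' \<in> ?H" if "h' \<in> ?H" for h'
      using h that ideal_type_add[OF id] by (simp add: hom_component_add)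
    show "r * h \<in> ?H" for r
    proof (intro CollectI allI)
      fix d
      obtain N where N: "r = (\<Sum>i\<le>N. hom_component i r)"
        using ex_sum_hom_components by blast
      obtain N' where N': "h = (\<Sum>j\<le>N'. hom_component j h)"
        using ex_sum_hom_components by blast
      have "hom_component d (r * h)
          = hom_component d ((\<Sum>i\<le>N. hom_component i r) * (\<Sum>j\<le>N'. hom_component j h))"
        using N N' by simp
      also have "\<dots> = (\<Sum>i\<le>N. \<Sum>j\<le>N'. hom_component d (hom_component i r * hom_component j h))"
        by (simp only: sum_product hom_component_sum)
      also have "\<dots> \<in> ?G"
      proof (intro ideal_type_sum[OF id])
        fix i j
        have "hom_component i r * hom_component j h \<in> ?G"
          using h by (intro ideal_type_mult[OF id]) simp
        then show "hom_component d (hom_component i r * hom_component j h) \<in> ?G"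
          using ideal_type_zero[OF id]
          by (simp add: hom_component_homogeneous[OF homogeneous_mult[OF
              hom_component_in_homogeneous_part hom_component_in_homogeneous_part]])
      qed
      finally show "hom_component d (r * h) \<in> ?G" .
    qed
  qed
  moreover have "M \<subseteq> ?H"
    using assms by blast
  ultimately have "?G \<subseteq> ?H"
    by (rule genideal_type(3))
  then show ?thesis
    using id by (auto simp: graded_ideal_def)
qed

lemma graded_ideal_insert:
  assumes "graded_ideal (I :: ('v::finite, 'k::field) mpoly set)" "f \<in> homogeneous_part e"
  shows "graded_ideal (ideal_gen (insert f I))"
proof (rule graded_ideal_gen)
  fix g d assume g: "g \<in> insert f I"
  have sub: "insert f I \<subseteq> ideal_gen (insert f I)"
    by (rule genideal_type)
  show "hom_component d g \<in> ideal_gen (insert f I)"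
  proof (cases "g = f")
    case True
    then show ?thesis
      using sub ideal_type_zero[OF genideal_type(1)[of "insert f I"]]
      by (auto simp: hom_component_homogeneous[OF assms(2)])
  next
    case False
    then have "hom_component d g \<in> I"
      using g assms(1) by (simp add: graded_ideal_def)
    then show ?thesis
      using sub by blast
  qed
qed

lemma graded_mono_ideal: "graded_ideal (ideal_gen (mono_poly ` A) :: ('v::finite, 'k::field) mpoly set)"
proof (rule graded_ideal_gen)
  fix g :: "('v, 'k) mpoly" and d
  assume "g \<in> mono_poly ` A"
  then obtain a where a: "a \<in> A" "g = mono_poly a" by blast
  have "mono_poly a \<in> homogeneous_part (tdeg a)"
    by (simp add: homogeneous_part_def)
  then have "hom_component d g = (if d = tdeg a then mono_poly a else 0)"
    unfolding a(2) by (rule hom_component_homogeneous)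
  moreover have "mono_poly a \<in> (ideal_gen (mono_poly ` A) :: ('v, 'k) mpoly set)"
    by (rule subsetD[OF genideal_type(2) imageI]) (rule a)
  ultimately show "hom_component d g \<in> ideal_gen (mono_poly ` A)"
    using ideal_type_zero[OF genideal_type(1)[of "mono_poly ` A :: ('v, 'k) mpoly set"]] by simp
qed

lemma ideal_gen_insert_ideal_gen:
  "ideal_gen (insert f (ideal_gen M)) = ideal_gen (insert f (M :: ('v::finite, 'k::field) mpoly set))"
proof (intro equalityI genideal_type(3) genideal_type(1))
  have sub: "insert f M \<subseteq> ideal_gen (insert f M)"
    by (rule genideal_type)
  then have "ideal_gen M \<subseteq> ideal_gen (insert f M)"
    by (intro genideal_type(3) genideal_type(1)) auto
  then show "insert f (ideal_gen M) \<subseteq> ideal_gen (insert f M)"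
    using sub by blast
  have "insert f (ideal_gen M) \<subseteq> ideal_gen (insert f (ideal_gen M))"
    by (rule genideal_type)
  then show "insert f M \<subseteq> ideal_gen (insert f (ideal_gen M))"
    using genideal_type(2)[of M] by blast
qed

text \<open>Linear growth bounds the Krull dimension by one, and the absence of all powers of
  \<open>v\<close> forces it to be at least one. In dimension one the factorial and the power of
  \<open>d\<close> are 1, so the degree is the limit of the Hilbert function itself.\<close>

lemma (in graded_order) quot_degree_eqI:
  fixes J :: "('v, 'k::field) mpoly set"
  assumes gr: "graded_ideal J"
    and notin: "\<And>n. mono_poly (Poly_Mapping.single v n) \<notin> J"
    and lin: "\<And>d. standard_count J d \<le> C * (d + 1)"
    and ev: "\<And>e. N \<le> e \<Longrightarrow> card ({a. tdeg a = e} - leads J) = c"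
  shows "quot_degree J = real c"
proof -
  have one: "1 \<notin> J"
    using notin[of 0] by simp
  have "proper_mpoly_ideal J"
    using gr one by (intro proper_mpoly_ideal.intro) (simp_all add: graded_ideal_def)
  then have "krull_dim (mpoly_ring Quot J) \<le> enat 1"
    using lin by (intro krull_dim_quot_le[of J C 1]) simp_all
  then have "krull_dim (mpoly_ring Quot J) = 1"
    using krull_dim_quot_ge_1[OF gr notin] by (simp add: one_enat_def)
  moreover have "(\<lambda>d. real (hilbert_fun J d)) \<longlonglongrightarrow> real c"
  proof (rule tendsto_eventually)
    show "\<forall>\<^sub>F d in sequentially. real (hilbert_fun J d) = real c"
      unfolding eventually_sequentially using ev by (intro exI[of _ N]) (simp add: hilbert_fun_eq[OF gr one])
  qed
  ultimately show ?thesis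
    by (simp add: quot_degree_def limI one_enat_def)
qed

section \<open>Rays of standard monomials\<close>

text \<open>
  The set \<open>corner\<close> below consists of the exponents of the monomials in the ideal generated by
  \<open>p\<^sup>A q\<^sup>B\<close> and the \<open>D v\<close>-th powers of the variables \<open>v\<close> other than \<open>p\<close> and \<open>q\<close>. The case \<open>A = 0\<close> covers
  ideals generated by powers of all variables but \<open>p\<close>. The values \<open>D p\<close> and \<open>D q\<close> play no role.
\<close>
locale monomial_rays = graded_order prec
  for prec :: "'v::finite expo \<Rightarrow> 'v expo \<Rightarrow> bool" +
  fixes p q :: 'v and A B :: nat and D :: "'v \<Rightarrow> nat"
  assumes p_neq_q: "p \<noteq> q" and B_pos: "0 < B" and D_pos: "v \<noteq> p \<Longrightarrow> v \<noteq> q \<Longrightarrow> 0 < D v"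
begin

definition corner :: "'v expo set" where
  "corner = {a. (A \<le> lookup a p \<and> B \<le> lookup a q) \<or> (\<exists>v. v \<noteq> p \<and> v \<noteq> q \<and> D v \<le> lookup a v)}"

text \<open>Starting points of the rays in direction \<open>p\<close>; the bound 1 makes the
  exponent of \<open>p\<close> vanish. Those for direction \<open>q\<close> have an exponent of
  \<open>p\<close> below \<open>A\<close>, so there are none when \<open>A = 0\<close>.\<close>

definition base_p :: "'v expo set" where
  "base_p = {u. \<forall>v. lookup u v < (if v = p then 1 else if v = q then B else D v)}"

definition base_q :: "'v expo set" where
  "base_q = {u. \<forall>v. lookup u v < (if v = q then 1 else if v = p then A else D v)}"

definition rays :: "('v expo \<times> 'v) set" where
  "rays = base_p \<times> {p} \<union> base_q \<times> {q}"

definition ray :: "'v expo \<times> 'v \<Rightarrow> nat \<Rightarrow> 'v expo" where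
  "ray x n = fst x + Poly_Mapping.single (snd x) n"

lemma finite_rays [simp]: "finite rays"
  unfolding rays_def base_p_def base_q_def
  by (intro finite_UnI finite_cartesian_product card_box(2)) simp_all

lemma mem_base_p: "u \<in> base_p \<longleftrightarrow> lookup u p = 0 \<and> lookup u q < B \<and> (\<forall>v. v \<noteq> p \<longrightarrow> v \<noteq> q \<longrightarrow> lookup u v < D v)"
  using p_neq_q by (auto simp: base_p_def)

lemma mem_base_q: "u \<in> base_q \<longleftrightarrow> lookup u q = 0 \<and> lookup u p < A \<and> (\<forall>v. v \<noteq> p \<longrightarrow> v \<noteq> q \<longrightarrow> lookup u v < D v)"
  using p_neq_q by (auto simp: base_q_def)

lemma lookup_ray: "lookup (ray (u, v) n) w = lookup u w + (if w = v then n else 0)"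
  by (auto simp: ray_def lookup_add lookup_single when_def)

lemma ray_not_in_corner: "x \<in> rays \<Longrightarrow> ray x n \<notin> corner"
  using p_neq_q by (cases x) (auto simp: rays_def corner_def lookup_ray mem_base_p mem_base_q)

lemma tdeg_ray: "tdeg (ray x n) = tdeg (fst x) + n"
  by (simp add: ray_def tdeg_add)

lemma ray_add: "ray x (m + n) = ray x m + Poly_Mapping.single (snd x) n"
  by (simp add: ray_def single_add add.assoc)

text \<open>Outside \<open>corner\<close> the exponent of \<open>q\<close> is below \<open>B\<close>
  or that of \<open>p\<close> is below \<open>A\<close>. The ray runs in direction \<open>p\<close>
  in the first case and in direction \<open>q\<close> otherwise; its base is \<open>a\<close> with
  the entry in that direction erased.\<close>

lemma standard_eq_ray:
  assumes "a \<notin> corner"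
  shows "\<exists>x\<in>rays. a = ray x (tdeg a - tdeg (fst x)) \<and> tdeg (fst x) \<le> tdeg a \<and>
    (snd x = p \<longleftrightarrow> lookup a q < B)"
proof -
  have ex: "\<exists>u. a = ray (u, v) (lookup a v) \<and> lookup u = (lookup a)(v := 0)" for v
  proof (intro exI conjI)
    show "lookup (Poly_Mapping.update v 0 a) = (lookup a)(v := 0)"
      by (auto simp: lookup_update)
    show "a = ray (Poly_Mapping.update v 0 a, v) (lookup a v)"
      by (intro poly_mapping_eqI) (simp add: lookup_ray lookup_update)
  qed
  define v where "v = (if lookup a q < B then p else q)"
  obtain u where u: "a = ray (u, v) (lookup a v)" "lookup u = (lookup a)(v := 0)"
    using ex by blast
  have td: "tdeg a = tdeg u + lookup a v"
    using arg_cong[OF u(1), of tdeg] by (simp add: tdeg_ray)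
  then have eq: "lookup a v = tdeg a - tdeg u"
    by simp
  show ?thesis
  proof (intro bexI[of _ "(u, v)"] conjI)
    show "(u, v) \<in> rays"
      using assms p_neq_q
      by (auto simp: rays_def v_def corner_def mem_base_p mem_base_q u(2) not_le split: if_splits)
    show "a = ray (u, v) (tdeg a - tdeg (fst (u, v)))"
      unfolding fst_conv eq[symmetric] by (rule u(1))
    show "tdeg (fst (u, v)) \<le> tdeg a"
      unfolding fst_conv td by simp
    show "snd (u, v) = p \<longleftrightarrow> lookup a q < B"
      using p_neq_q by (simp add: v_def)
  qed
qed

text \<open>From this degree on the exponent of \<open>q\<close> is at least \<open>B\<close> on a
  ray in direction \<open>q\<close>, whereas it is always below \<open>B\<close> in direction
  \<open>p\<close>. In low degrees the two families can share monomials.\<close>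

definition bound :: nat where
  "bound = A + B + (\<Sum>v\<in>UNIV - {p, q}. D v)"

lemma tdeg_eq_pq: "tdeg a = lookup a p + (lookup a q + (\<Sum>v\<in>UNIV - {p, q}. lookup a v))"
proof -
  have "tdeg a = lookup a p + (\<Sum>v\<in>UNIV - {p}. lookup a v)"
    unfolding tdeg_def by (rule sum.remove) auto
  also have "(\<Sum>v\<in>UNIV - {p}. lookup a v) = lookup a q + (\<Sum>v\<in>UNIV - {p} - {q}. lookup a v)"
    by (rule sum.remove) (use p_neq_q in auto)
  also have "UNIV - {p} - {q} = UNIV - {p, q}"
    by auto
  finally show ?thesis .
qed

lemma tdeg_ray_base:
  assumes "x \<in> rays"
  shows "tdeg (fst x) + (if snd x = q then B else 0) \<le> bound"
proof -
  obtain u v where x: "x = (u, v)"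
    by (cases x)
  have "lookup u w \<le> D w" if "w \<in> UNIV - {p, q}" for w
    using assms that by (auto simp: x rays_def mem_base_p mem_base_q intro: less_imp_le)
  then have "(\<Sum>w\<in>UNIV - {p, q}. lookup u w) \<le> (\<Sum>w\<in>UNIV - {p, q}. D w)"
    by (rule sum_mono)
  moreover have "v = p \<and> lookup u p = 0 \<and> lookup u q < B \<or> v = q \<and> lookup u q = 0 \<and> lookup u p < A"
    using assms by (auto simp: x rays_def mem_base_p mem_base_q)
  ultimately show ?thesis
    using p_neq_q unfolding bound_def x fst_conv snd_conv tdeg_eq_pq[of u] by auto
qed

lemma standard_bij:
  assumes "bound \<le> e"
  shows "bij_betw (\<lambda>x. ray x (e - tdeg (fst x))) rays ({a. tdeg a = e} - corner)"
proof (rule bij_betw_imageI)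
  let ?r = "\<lambda>x. ray x (e - tdeg (fst x))"
  have le: "tdeg (fst x) \<le> e" if "x \<in> rays" for x
    using tdeg_ray_base[OF that] assms by (simp split: if_splits)
  have td: "tdeg (?r x) = e" if "x \<in> rays" for x
    using le[OF that] by (simp add: tdeg_ray)
  \<comment> \<open>The exponent of \<open>q\<close> recovers the direction. All entries of the base
    are then recovered too, the one in that direction being zero.\<close>
  have dir: "snd x = p \<longleftrightarrow> lookup (?r x) q < B" if x: "x \<in> rays" for x
  proof (cases x)
    case (Pair u v)
    show ?thesis
    proof (cases "v = p")
      case True
      then show ?thesis
        using x p_neq_q by (auto simp: Pair rays_def lookup_ray mem_base_p)
    next
      case False
      then have "v = q"
        using x by (auto simp: rays_def Pair)
      then have "tdeg u + B \<le> e"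
        using tdeg_ray_base[OF x] assms by (simp add: Pair)
      then have "B \<le> e - tdeg u"
        by linarith
      then show ?thesis
        using \<open>v = q\<close> False by (simp add: Pair lookup_ray)
    qed
  qed
  show "inj_on ?r rays"
  proof (rule inj_onI)
    fix x y assume x: "x \<in> rays" and y: "y \<in> rays" and eq: "?r x = ?r y"
    have v: "snd x = snd y"
      using dir[OF x] dir[OF y] eq x y by (auto simp: rays_def)
    have "lookup (fst x) w = lookup (fst y) w" for w
    proof (cases "w = snd x")
      case True
      then show ?thesis
        using x y v p_neq_q by (auto simp: rays_def mem_base_p mem_base_q)
    next
      case False
      have "lookup (?r x) w = lookup (?r y) w"
        by (simp only: eq)
      then show ?thesis
        using False v by (cases x, cases y) (simp add: lookup_ray)
    qed
    then show "x = y"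
      using v by (intro prod_eqI poly_mapping_eqI) simp_all
  qed
  show "?r ` rays = {a. tdeg a = e} - corner"
  proof (intro equalityI subsetI)
    fix a assume "a \<in> ?r ` rays"
    then show "a \<in> {a. tdeg a = e} - corner"
      using td ray_not_in_corner by auto
  next
    fix a assume "a \<in> {a. tdeg a = e} - corner"
    then show "a \<in> ?r ` rays"
      using standard_eq_ray[of a] by auto
  qed
qed

definition ray_count :: "'v expo set \<Rightarrow> nat" where
  "ray_count U = card {x \<in> rays. \<forall>n. ray x n \<notin> U}"

text \<open>A ray that meets the up-closed set \<open>U\<close> stays in it from then on. There are
  finitely many rays, so a common number \<open>m\<close> of steps suffices for all those that ever
  enter \<open>U\<close>.\<close>

lemma card_standard_eventually:
  assumes "corner \<subseteq> U" and up: "\<And>a b. a \<in> U \<Longrightarrow> a + b \<in> U"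
  shows "\<exists>N. \<forall>e\<ge>N. card ({a. tdeg a = e} - U) = ray_count U"
proof -
  have "\<exists>m. \<forall>x\<in>rays. (\<exists>n. ray x n \<in> U) \<longrightarrow> (\<exists>n\<le>m. ray x n \<in> U)"
  proof -
    define h where "h x = (SOME n. ray x n \<in> U)" for x
    have h: "ray x (h x) \<in> U" if "\<exists>n. ray x n \<in> U" for x
      using that unfolding h_def by (rule someI_ex)
    have "finite (h ` rays)"
      by simp
    then obtain m where "\<And>x. x \<in> rays \<Longrightarrow> h x \<le> m"
      by (metis finite_nat_set_iff_bounded_le imageI)
    then show ?thesis
      using h by metis
  qed
  then obtain m where m: "\<And>x. x \<in> rays \<Longrightarrow> (\<exists>n. ray x n \<in> U) \<Longrightarrow> \<exists>n\<le>m. ray x n \<in> U"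
    by blast
  show ?thesis
  proof (intro exI[of _ "bound + m"] allI impI)
    fix e assume e: "bound + m \<le> e"
    let ?r = "\<lambda>x. ray x (e - tdeg (fst x))"
    have bij: "bij_betw ?r rays ({a. tdeg a = e} - corner)"
      using e by (intro standard_bij) simp
    have iff: "?r x \<notin> U \<longleftrightarrow> (\<forall>n. ray x n \<notin> U)" if x: "x \<in> rays" for x
    proof
      assume "?r x \<notin> U"
      show "\<forall>n. ray x n \<notin> U"
      proof (rule ccontr)
        assume "\<not> (\<forall>n. ray x n \<notin> U)"
        then obtain n where n: "n \<le> m" "ray x n \<in> U"
          using m[OF x] by blast
        then have "n \<le> e - tdeg (fst x)"
          using tdeg_ray_base[OF x] e by (simp split: if_splits)
        then obtain k where k: "e - tdeg (fst x) = n + k"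
          using le_Suc_ex by blast
        have "?r x \<in> U"
          unfolding k ray_add by (rule up[OF n(2)])
        then show False
          using \<open>?r x \<notin> U\<close> by simp
      qed
    qed simp
    have "bij_betw ?r {x \<in> rays. \<forall>n. ray x n \<notin> U} ({a. tdeg a = e} - U)"
    proof (rule bij_betw_subset[OF bij])
      have img: "?r ` rays = {a. tdeg a = e} - corner"
        using bij by (rule bij_betw_imp_surj_on)
      show "?r ` {x \<in> rays. \<forall>n. ray x n \<notin> U} = {a. tdeg a = e} - U"
      proof (intro equalityI subsetI)
        fix a assume "a \<in> ?r ` {x \<in> rays. \<forall>n. ray x n \<notin> U}"
        then show "a \<in> {a. tdeg a = e} - U"
          using img by auto
      next
        fix a assume a: "a \<in> {a. tdeg a = e} - U"
        then have "a \<in> ?r ` rays"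
          unfolding img using assms(1) by blast
        then obtain x where x: "x \<in> rays" "a = ?r x"
          by blast
        then have "\<forall>n. ray x n \<notin> U"
          using iff[OF x(1)] a by simp
        then show "a \<in> ?r ` {x \<in> rays. \<forall>n. ray x n \<notin> U}"
          using x by blast
      qed
    qed auto
    then show "card ({a. tdeg a = e} - U) = ray_count U"
      unfolding ray_count_def by (rule bij_betw_same_card[symmetric])
  qed
qed

lemma standard_count_le_linear:
  fixes J :: "('v, 'k::field) mpoly set"
  assumes "corner \<subseteq> leads J"
  shows "standard_count J d \<le> card rays * (d + 1)"
proof -
  have "{a. tdeg a \<le> d} - leads J \<subseteq> (\<lambda>(x, n). ray x n) ` (rays \<times> {..d})"
  proof
    fix a assume a: "a \<in> {a. tdeg a \<le> d} - leads J"
    then obtain x where x: "x \<in> rays" "a = ray x (tdeg a - tdeg (fst x))"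
      using standard_eq_ray[of a] assms by blast
    moreover have "tdeg a \<le> d"
      using a by simp
    then have "tdeg a - tdeg (fst x) \<le> d"
      by linarith
    ultimately show "a \<in> (\<lambda>(x, n). ray x n) ` (rays \<times> {..d})"
      by (intro image_eqI[of _ _ "(x, tdeg a - tdeg (fst x))"]) simp_all
  qed
  then have "standard_count J d \<le> card ((\<lambda>(x, n). ray x n) ` (rays \<times> {..d}))"
    unfolding standard_count_def by (intro card_mono) simp_all
  also have "\<dots> \<le> card (rays \<times> {..d})"
    by (rule card_image_le) simp
  finally show ?thesis
    by (simp add: card_cartesian_product)
qed

lemma quot_degree_eq_ray_count:
  fixes J :: "('v, 'k::field) mpoly set"
  assumes gr: "graded_ideal J" and cor: "corner \<subseteq> leads J"
    and notin: "\<And>n. mono_poly (Poly_Mapping.single v n) \<notin> J"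
  shows "quot_degree J = real (ray_count (leads J))"
proof -
  have id: "mpoly_ideal J"
    using gr by (simp add: graded_ideal_def)
  obtain N where "\<And>e. N \<le> e \<Longrightarrow> card ({a. tdeg a = e} - leads J) = ray_count (leads J)"
    using card_standard_eventually[OF cor leads_add[OF id]] by blast
  then show ?thesis
    using quot_degree_eqI[OF gr notin standard_count_le_linear[OF cor]] by blast
qed

text \<open>The exponent of \<open>p\<close> is unrestricted while that of \<open>q\<close> is below
  \<open>B\<close>; otherwise the exponent of \<open>p\<close> is below \<open>A\<close> and that of
  \<open>q\<close> is unrestricted.\<close>

lemma ex_escape:
  assumes "u \<notin> corner"
  shows "\<exists>v. \<forall>n. Poly_Mapping.single v n + u \<notin> corner"
proof (cases "lookup u q < B")
  case True
  then show ?thesis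
    using assms p_neq_q
    by (intro exI[of _ p]) (auto simp: corner_def lookup_add lookup_single when_def)
next
  case False
  then show ?thesis
    using assms p_neq_q
    by (intro exI[of _ q]) (auto simp: corner_def lookup_add lookup_single when_def)
qed

text \<open>A polynomial outside \<open>I\<close> that multiplies \<open>f\<close> into
  \<open>I\<close> may be replaced by its normal form modulo \<open>I\<close>.\<close>

lemma zero_divisor_reduced:
  fixes I :: "('v, 'k::field) mpoly set"
  assumes id: "mpoly_ideal I" and "zero_divisor_mod I f"
  shows "\<exists>r. r \<noteq> 0 \<and> lead_monom prec r \<notin> leads I \<and> r * f \<in> I"
proof -
  have "I \<subseteq> colon I f"
    using ideal_type_mult'[OF id] by (auto simp: colon_def)
  then obtain g where g: "g * f \<in> I" "g \<notin> I"
    using assms(2) by (auto simp: zero_divisor_mod_def colon_def)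
  obtain r where r: "g - r \<in> I" "keys r \<subseteq> - leads I"
    using reduce[OF id] by blast
  have r0: "r \<noteq> 0"
    using g(2) r(1) by auto
  have "g * f - (g - r) * f \<in> I"
    by (intro ideal_type_diff[OF id] ideal_type_mult'[OF id] g r)
  then have "r * f \<in> I"
    by (simp add: algebra_simps)
  then show ?thesis
    using r0 r(2) lead_monom(1)[OF r0] by blast
qed

text \<open>The ideal \<open>(I, f)\<close> multiplies \<open>r\<close> into \<open>I\<close>. Some
  variable \<open>v\<close> has all products \<open>v^n r\<close> with leading monomial outside
  \<open>corner\<close>, so no power of \<open>v\<close> lies in \<open>(I, f)\<close> and the
  dimension remains one.\<close>

lemma quot_degree_insert:
  fixes I :: "('v, 'k::field) mpoly set"
  assumes gr: "graded_ideal I" and lI: "leads I = corner"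
    and f: "f \<in> homogeneous_part d" and zd: "zero_divisor_mod I f"
  shows "quot_degree (ideal_gen (insert f I)) = real (ray_count (leads (ideal_gen (insert f I))))"
proof -
  have id: "mpoly_ideal I"
    using gr by (simp add: graded_ideal_def)
  let ?J = "ideal_gen (insert f I)"
  have sub: "insert f I \<subseteq> ?J"
    by (rule genideal_type)
  obtain r where r: "r \<noteq> 0" "lead_monom prec r \<notin> corner" "r * f \<in> I"
    using zero_divisor_reduced[OF id zd] lI by blast
  obtain v where v: "\<And>n. Poly_Mapping.single v n + lead_monom prec r \<notin> corner"
    using ex_escape[OF r(2)] by blast
  have "mpoly_ideal (colon I r)"
    unfolding ideal_type_iff colon_def
    using ideal_type_zero[OF id] ideal_type_add[OF id] ideal_type_mult[OF id]
    by (simp add: distrib_right mult.assoc)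
  moreover have "insert f I \<subseteq> colon I r"
    using r(3) ideal_type_mult'[OF id] by (auto simp: colon_def mult.commute)
  ultimately have colon: "?J \<subseteq> colon I r"
    by (rule genideal_type(3))
  have "mono_poly (Poly_Mapping.single v n) \<notin> ?J" for n
  proof
    assume "mono_poly (Poly_Mapping.single v n) \<in> ?J"
    then have "mono_poly (Poly_Mapping.single v n) * r \<in> I"
      using colon by (auto simp: colon_def)
    then have "lead_monom prec (mono_poly (Poly_Mapping.single v n) * r) \<in> corner"
      unfolding lI[symmetric] by (rule leadsI[OF _ mult_nonzero[OF mono_poly_nonzero r(1)]])
    then show False
      using v by (simp add: lead_monom_mult[OF mono_poly_nonzero r(1)])
  qed
  moreover have "corner \<subseteq> leads ?J"
    unfolding lI[symmetric] by (rule leads_mono) (use sub in blast)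
  ultimately show ?thesis
    by (intro quot_degree_eq_ray_count graded_ideal_insert[OF gr f])
qed

text \<open>If \<open>r * f\<close> is in \<open>I\<close> and \<open>r\<close> has a standard
  leading monomial, this monomial annihilates that of \<open>f\<close> modulo the initial ideal
  without lying in it.\<close>

lemma zero_divisor_lead_monom:
  fixes I :: "('v, 'k::field) mpoly set"
  assumes id: "mpoly_ideal I" and "zero_divisor_mod I f" "f \<noteq> 0"
  shows "zero_divisor_mod (initial_ideal prec I) (mono_poly (lead_monom prec f))"
proof -
  obtain r where r: "r \<noteq> 0" "lead_monom prec r \<notin> leads I" "r * f \<in> I"
    using zero_divisor_reduced[OF assms(1,2)] by blast
  have "lead_monom prec r + lead_monom prec f \<in> leads I"
    using leadsI[OF r(3) mult_nonzero[OF r(1) assms(3)]] by (simp add: lead_monom_mult[OF r(1) assms(3)])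
  then have "mono_poly (lead_monom prec r) \<in> colon (initial_ideal prec I) (mono_poly (lead_monom prec f))"
    by (simp add: colon_def mem_initial_ideal_iff[OF id] flip: mono_poly_add)
  moreover have "mono_poly (lead_monom prec r) \<notin> initial_ideal prec I"
    using r(2) by (simp add: mem_initial_ideal_iff[OF id])
  ultimately show ?thesis
    unfolding zero_divisor_mod_def by blast
qed

text \<open>The last hypothesis says that \<open>a\<close> involves a variable dividing one of the
  generators. That generator divided by the variable is a standard monomial \<open>k\<close>, and
  \<open>k + a\<close> is in \<open>corner\<close>.\<close>

lemma zero_divisor_monomI:
  fixes I :: "('v, 'k::field) mpoly set"
  assumes id: "mpoly_ideal I" and lI: "leads I = corner"
    and "(\<exists>v. v \<noteq> p \<and> v \<noteq> q \<and> 0 < lookup a v) \<or> 0 < lookup a q \<or> (0 < A \<and> 0 < lookup a p)"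
  shows "zero_divisor_mod (initial_ideal prec I) (mono_poly a)"
proof -
  have D0: "v = p \<or> v = q" if "D v = 0" for v
    using D_pos[of v] that by auto
  have "\<exists>k. k \<notin> corner \<and> k + a \<in> corner"
    using assms(3)
  proof (elim disjE exE conjE)
    fix v assume v: "v \<noteq> p" "v \<noteq> q" "0 < lookup a v"
    then show ?thesis
      using v D_pos[OF v(1,2)] B_pos
      by (intro exI[of _ "Poly_Mapping.single v (D v - 1)"])
        (auto simp: corner_def lookup_add lookup_single when_def not_le dest!: D0 intro!: exI[of _ v])
  next
    assume a: "0 < lookup a q"
    let ?k = "Poly_Mapping.single p A + Poly_Mapping.single q (B - 1)"
    have k: "lookup ?k w = (if w = p then A else if w = q then B - 1 else 0)" for w
      using p_neq_q by (simp add: lookup_add lookup_single when_def)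
    have "?k \<notin> corner"
      unfolding corner_def k mem_Collect_eq using B_pos p_neq_q D0 by auto
    moreover have "A \<le> lookup (?k + a) p" "B \<le> lookup (?k + a) q"
      unfolding lookup_add[of ?k] k using a p_neq_q by simp_all
    ultimately show ?thesis
      unfolding corner_def by blast
  next
    assume a: "0 < A" "0 < lookup a p"
    let ?k = "Poly_Mapping.single p (A - 1) + Poly_Mapping.single q B"
    have k: "lookup ?k w = (if w = p then A - 1 else if w = q then B else 0)" for w
      using p_neq_q by (simp add: lookup_add lookup_single when_def)
    have "?k \<notin> corner"
      unfolding corner_def k mem_Collect_eq using a(1) p_neq_q D0 by auto
    moreover have "A \<le> lookup (?k + a) p" "B \<le> lookup (?k + a) q"
      unfolding lookup_add[of ?k] k using a p_neq_q by simp_all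
    ultimately show ?thesis
      unfolding corner_def by blast
  qed
  then obtain k where k: "k \<notin> corner" "k + a \<in> corner"
    by blast
  then have "mono_poly k \<in> colon (initial_ideal prec I) (mono_poly a)"
    by (simp add: colon_def mem_initial_ideal_iff[OF id] lI flip: mono_poly_add)
  moreover have "mono_poly k \<notin> initial_ideal prec I"
    using k(1) by (simp add: mem_initial_ideal_iff[OF id] lI)
  ultimately show ?thesis
    unfolding zero_divisor_mod_def by blast
qed

end

section \<open>Rays met by the multiples of one monomial\<close>

context monomial_rays begin

text \<open>The number of rays containing a multiple of \<open>t^a\<close>. A ray in direction
  \<open>p\<close> puts no condition on the exponent of \<open>p\<close> in \<open>a\<close> and
  accounts for the summand with \<open>B\<close>; direction \<open>q\<close> accounts for the one
  with \<open>A\<close>.\<close>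

definition covered_count :: "'v expo \<Rightarrow> nat" where
  "covered_count a = ((B - lookup a q) + (A - lookup a p)) * (\<Prod>v\<in>UNIV - {p, q}. D v - lookup a v)"

lemma prod_eq_pq: "(\<Prod>v\<in>UNIV. f v) = f p * (f q * (\<Prod>v\<in>UNIV - {p, q}. f v :: nat))"
proof -
  have "(\<Prod>v\<in>UNIV. f v) = f p * (\<Prod>v\<in>UNIV - {p}. f v)"
    by (rule prod.remove) auto
  also have "(\<Prod>v\<in>UNIV - {p}. f v) = f q * (\<Prod>v\<in>UNIV - {p} - {q}. f v)"
    by (rule prod.remove) (use p_neq_q in auto)
  also have "UNIV - {p} - {q} = UNIV - {p, q}"
    by auto
  finally show ?thesis .
qed

lemma card_base_p_above:
  "card {u \<in> base_p. \<forall>w. w \<noteq> p \<longrightarrow> lookup a w \<le> lookup u w}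
    = (B - lookup a q) * (\<Prod>v\<in>UNIV - {p, q}. D v - lookup a v)"
proof -
  let ?S = "\<lambda>v. if v = p then {0} else if v = q then {lookup a q..<B} else {lookup a v..<D v}"
  have "{u \<in> base_p. \<forall>w. w \<noteq> p \<longrightarrow> lookup a w \<le> lookup u w} = {u. \<forall>v. lookup u v \<in> ?S v}"
  proof (intro equalityI subsetI CollectI conjI allI impI)
    fix u v assume "u \<in> {u \<in> base_p. \<forall>w. w \<noteq> p \<longrightarrow> lookup a w \<le> lookup u w}"
    then show "lookup u v \<in> ?S v"
      using p_neq_q by (simp add: mem_base_p)
  next
    fix u assume "u \<in> {u. \<forall>v. lookup u v \<in> ?S v}"
    then have S: "lookup u v \<in> ?S v" for v
      by blast
    show "u \<in> base_p"
      unfolding mem_base_p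
    proof (intro conjI allI impI)
      show "lookup u p = 0" "lookup u q < B"
        using S[of p] S[of q] p_neq_q by simp_all
      show "lookup u v < D v" if "v \<noteq> p" "v \<noteq> q" for v
        using S[of v] that by simp
    qed
    show "lookup a w \<le> lookup u w" if "w \<noteq> p" for w
      using S[of w] that by (simp split: if_splits)
  qed
  then have "card {u \<in> base_p. \<forall>w. w \<noteq> p \<longrightarrow> lookup a w \<le> lookup u w} = (\<Prod>v\<in>UNIV. card (?S v))"
    using card_product_box(1)[of ?S] by simp
  also have "\<dots> = (B - lookup a q) * (\<Prod>v\<in>UNIV - {p, q}. card (?S v))"
    unfolding prod_eq_pq using p_neq_q by simp
  also have "(\<Prod>v\<in>UNIV - {p, q}. card (?S v)) = (\<Prod>v\<in>UNIV - {p, q}. D v - lookup a v)"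
    by (rule prod.cong) auto
  finally show ?thesis .
qed

lemma card_base_q_above:
  "card {u \<in> base_q. \<forall>w. w \<noteq> q \<longrightarrow> lookup a w \<le> lookup u w}
    = (A - lookup a p) * (\<Prod>v\<in>UNIV - {p, q}. D v - lookup a v)"
proof -
  let ?S = "\<lambda>v. if v = q then {0} else if v = p then {lookup a p..<A} else {lookup a v..<D v}"
  have "{u \<in> base_q. \<forall>w. w \<noteq> q \<longrightarrow> lookup a w \<le> lookup u w} = {u. \<forall>v. lookup u v \<in> ?S v}"
  proof (intro equalityI subsetI CollectI conjI allI impI)
    fix u v assume "u \<in> {u \<in> base_q. \<forall>w. w \<noteq> q \<longrightarrow> lookup a w \<le> lookup u w}"
    then show "lookup u v \<in> ?S v"
      using p_neq_q by (simp add: mem_base_q)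
  next
    fix u assume "u \<in> {u. \<forall>v. lookup u v \<in> ?S v}"
    then have S: "lookup u v \<in> ?S v" for v
      by blast
    show "u \<in> base_q"
      unfolding mem_base_q
    proof (intro conjI allI impI)
      show "lookup u q = 0" "lookup u p < A"
        using S[of p] S[of q] p_neq_q by simp_all
      show "lookup u v < D v" if "v \<noteq> p" "v \<noteq> q" for v
        using S[of v] that by simp
    qed
    show "lookup a w \<le> lookup u w" if "w \<noteq> q" for w
      using S[of w] that by (simp split: if_splits)
  qed
  then have "card {u \<in> base_q. \<forall>w. w \<noteq> q \<longrightarrow> lookup a w \<le> lookup u w} = (\<Prod>v\<in>UNIV. card (?S v))"
    using card_product_box(1)[of ?S] by simp
  also have "\<dots> = (A - lookup a p) * (\<Prod>v\<in>UNIV - {p, q}. card (?S v))"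
    unfolding prod_eq_pq using p_neq_q by simp
  also have "(\<Prod>v\<in>UNIV - {p, q}. card (?S v)) = (\<Prod>v\<in>UNIV - {p, q}. D v - lookup a v)"
    by (rule prod.cong) auto
  finally show ?thesis .
qed

lemma card_covered_rays: "card {x \<in> rays. \<exists>n. mdvd a (ray x n)} = covered_count a"
proof -
  define P where "P = {u \<in> base_p. \<forall>w. w \<noteq> p \<longrightarrow> lookup a w \<le> lookup u w}"
  define Q where "Q = {u \<in> base_q. \<forall>w. w \<noteq> q \<longrightarrow> lookup a w \<le> lookup u w}"
  have iff: "(\<exists>n. mdvd a (ray (u, v) n)) \<longleftrightarrow> (\<forall>w. w \<noteq> v \<longrightarrow> lookup a w \<le> lookup u w)" for u v
  proof
    assume "\<forall>w. w \<noteq> v \<longrightarrow> lookup a w \<le> lookup u w"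
    then show "\<exists>n. mdvd a (ray (u, v) n)"
      by (intro exI[of _ "lookup a v"]) (auto simp: mdvd_def lookup_ray)
  next
    assume "\<exists>n. mdvd a (ray (u, v) n)"
    then obtain n where n: "\<And>w. lookup a w \<le> lookup (ray (u, v) n) w"
      by (auto simp: mdvd_def)
    show "\<forall>w. w \<noteq> v \<longrightarrow> lookup a w \<le> lookup u w"
    proof (intro allI impI)
      fix w assume "w \<noteq> v"
      then show "lookup a w \<le> lookup u w"
        using n[of w] by (simp add: lookup_ray)
    qed
  qed
  have "{x \<in> rays. \<exists>n. mdvd a (ray x n)} = P \<times> {p} \<union> Q \<times> {q}"
  proof (rule Set.set_eqI)
    fix x :: "'v expo \<times> 'v"
    obtain u v where x: "x = (u, v)"
      by (cases x)
    show "x \<in> {x \<in> rays. \<exists>n. mdvd a (ray x n)} \<longleftrightarrow> x \<in> P \<times> {p} \<union> Q \<times> {q}"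
      unfolding x mem_Collect_eq iff rays_def P_def Q_def by blast
  qed
  also have "card (P \<times> {p} \<union> Q \<times> {q}) = card (P \<times> {p}) + card (Q \<times> {q})"
  proof (rule card_Un_disjoint)
    have "finite base_p" "finite base_q"
      unfolding base_p_def base_q_def by (rule card_box(2))+
    moreover have "P \<subseteq> base_p" "Q \<subseteq> base_q"
      unfolding P_def Q_def by blast+
    ultimately have "finite P" "finite Q"
      using finite_subset by blast+
    then show "finite (P \<times> {p})" "finite (Q \<times> {q})"
      by simp_all
    show "P \<times> {p} \<inter> Q \<times> {q} = {}"
      using p_neq_q by blast
  qed
  also have "\<dots> = card P + card Q"
    by (simp add: card_cartesian_product)
  also have "\<dots> = covered_count a"
    unfolding P_def Q_def card_base_p_above card_base_q_above
    unfolding covered_count_def by (rule distrib_right[symmetric])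
  finally show ?thesis .
qed

lemma ray_count_corner: "ray_count corner = card rays"
  unfolding ray_count_def by (rule arg_cong[of _ _ card]) (auto simp: ray_not_in_corner)

lemma ray_count_corner_insert: "ray_count (corner \<union> {k. mdvd a k}) + covered_count a = card rays"
proof -
  let ?S = "{x \<in> rays. \<forall>n. ray x n \<notin> corner \<union> {k. mdvd a k}}"
  let ?T = "{x \<in> rays. \<exists>n. mdvd a (ray x n)}"
  have "card (?S \<union> ?T) = card ?S + card ?T"
    by (rule card_Un_disjoint) auto
  moreover have "?S \<union> ?T = rays"
    using ray_not_in_corner by auto
  ultimately show ?thesis
    by (simp add: ray_count_def card_covered_rays)
qed

lemma covered_count_0: "covered_count 0 = card rays"
  unfolding card_covered_rays[symmetric] by (rule arg_cong[of _ _ card]) (auto simp: mdvd_def)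

lemma covered_count_le: "covered_count a \<le> card rays"
  using ray_count_corner_insert[of a] by simp

end

section \<open>Footprint function and minimum distance function\<close>

locale monomial_rays_ideal = monomial_rays prec p q A B D
  for prec :: "'v::finite expo \<Rightarrow> 'v expo \<Rightarrow> bool" and p q A B D +
  fixes I :: "('v, 'k::field) mpoly set"
  assumes graded_I: "graded_ideal I" and leads_I: "leads I = corner"
begin

lemma ideal_I: "mpoly_ideal I"
  using graded_I by (simp add: graded_ideal_def)

lemma leads_initial_insert:
  "leads (ideal_gen (insert (mono_poly a) (initial_ideal prec I))) = corner \<union> {k. mdvd a k}"
proof -
  have "ideal_gen (insert (mono_poly a) (initial_ideal prec I)) = ideal_gen (mono_poly ` insert a corner)"
    unfolding initial_ideal_eq leads_I ideal_gen_insert_ideal_gen by simp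
  then have "leads (ideal_gen (insert (mono_poly a) (initial_ideal prec I))) = {k. \<exists>b\<in>insert a corner. mdvd b k}"
    using leads_mono_ideal[of "insert a corner"] by (simp only:)
  also have "\<dots> = corner \<union> {k. mdvd a k}"
    using ex_leads_mdvd_iff[OF ideal_I] unfolding leads_I by auto
  finally show ?thesis .
qed

lemma quot_degree_I: "quot_degree I = real (card rays)"
proof -
  \<comment> \<open>The ray from the monomial 1 in direction \<open>p\<close> consists of the powers
    of \<open>p\<close>, so \<open>I\<close> contains none of them.\<close>
  have "0 \<in> base_p"
    using B_pos D_pos by (simp add: mem_base_p)
  then have "(0, p) \<in> rays"
    by (simp add: rays_def)
  then have "ray (0, p) n \<notin> corner" for n
    by (rule ray_not_in_corner)
  then have "mono_poly (Poly_Mapping.single p n) \<notin> I" for n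
    using mono_poly_mem_leads[of "Poly_Mapping.single p n" I] by (auto simp: leads_I ray_def)
  then have "quot_degree I = real (ray_count (leads I))"
    by (rule quot_degree_eq_ray_count[OF graded_I eq_refl[OF leads_I[symmetric]]])
  then show ?thesis
    unfolding leads_I ray_count_corner .
qed

lemma zd_monomsD:
  assumes "a \<in> zd_monoms prec I d"
  shows "a \<notin> corner" "tdeg a = d" "zero_divisor_mod (initial_ideal prec I) (mono_poly a)"
  using assms by (auto simp: zd_monoms_def footprint_eq[OF ideal_I] leads_I)

lemma zd_monomsI:
  assumes "a \<notin> corner" "tdeg a = d"
    and "(\<exists>v. v \<noteq> p \<and> v \<noteq> q \<and> 0 < lookup a v) \<or> 0 < lookup a q \<or> (0 < A \<and> 0 < lookup a p)"
  shows "a \<in> zd_monoms prec I d"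
  using assms zero_divisor_monomI[OF ideal_I leads_I assms(3)]
  by (simp add: zd_monoms_def footprint_eq[OF ideal_I] leads_I)

lemma finite_zd_monoms: "finite (zd_monoms prec I d)"
  by (rule finite_subset[OF _ finite_tdeg_eq[of d]]) (auto simp: zd_monoms_def)

lemma quot_degree_initial_insert:
  assumes "a \<in> zd_monoms prec I d"
  shows "quot_degree (ideal_gen (insert (mono_poly a) (initial_ideal prec I))) = real (card rays) - real (covered_count a)"
proof -
  have gr: "graded_ideal (initial_ideal prec I)"
    unfolding initial_ideal_eq by (rule graded_mono_ideal)
  have lI: "leads (initial_ideal prec I) = corner"
    unfolding initial_ideal_eq leads_mono_ideal ex_leads_mdvd_iff[OF ideal_I] by (simp add: leads_I)
  have hom: "mono_poly a \<in> homogeneous_part d"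
    using zd_monomsD(2)[OF assms] by (simp add: homogeneous_part_def)
  have "quot_degree (ideal_gen (insert (mono_poly a) (initial_ideal prec I)))
      = real (ray_count (corner \<union> {k. mdvd a k}))"
    using quot_degree_insert[OF gr lI hom zd_monomsD(3)[OF assms]] unfolding leads_initial_insert .
  then show ?thesis
    using ray_count_corner_insert[of a] by linarith
qed

text \<open>Both branches of the definition become values of \<open>covered_count\<close>: without
  zero-divisors the value is that of the exponent 0, as every ray contains a multiple of 1.\<close>

lemma footprint_fun_attained:
  "(\<exists>a\<in>zd_monoms prec I d. footprint_fun prec I d = real (covered_count a))
    \<or> (zd_monoms prec I d = {} \<and> footprint_fun prec I d = real (covered_count 0))"
proof (cases "zd_monoms prec I d = {}")
  case True
  then show ?thesis
    by (simp add: footprint_fun_def quot_degree_I covered_count_0)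
next
  case False
  let ?f = "\<lambda>a. quot_degree (ideal_gen (insert (mono_poly a) (initial_ideal prec I)))"
  have "Max (?f ` zd_monoms prec I d) \<in> ?f ` zd_monoms prec I d"
    using finite_zd_monoms False by (intro Max_in) auto
  then obtain a where "a \<in> zd_monoms prec I d" "Max (?f ` zd_monoms prec I d) = ?f a"
    by blast
  then show ?thesis
    using False by (intro disjI1 bexI[of _ a]) (simp_all add: footprint_fun_def quot_degree_I quot_degree_initial_insert)
qed

lemma footprint_fun_le:
  assumes "a \<in> zd_monoms prec I d"
  shows "footprint_fun prec I d \<le> real (covered_count a)"
proof -
  let ?f = "\<lambda>a. quot_degree (ideal_gen (insert (mono_poly a) (initial_ideal prec I)))"
  have "?f a \<le> Max (?f ` zd_monoms prec I d)"
    using finite_zd_monoms assms by (intro Max_ge) auto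
  then show ?thesis
    using assms by (auto simp: footprint_fun_def quot_degree_I quot_degree_initial_insert[OF assms])
qed

lemma footprint_fun_le_0: "footprint_fun prec I d \<le> real (covered_count 0)"
  using footprint_fun_attained[of d] covered_count_le covered_count_0 by auto

lemma footprint_fun_le_min_dist_fun: "footprint_fun prec I d \<le> min_dist_fun prec I d"
proof (cases "zd_standard_polys prec I d = {}")
  case True
  then show ?thesis
    using footprint_fun_le_0 by (simp add: min_dist_fun_def quot_degree_I covered_count_0)
next
  case False
  let ?g = "\<lambda>f. quot_degree (ideal_gen (insert f I))"
  let ?F = "zd_standard_polys prec I d"
  have F: "\<exists>n\<le>card rays. ?g f = real n \<and> footprint_fun prec I d \<le> real (card rays) - real n" if f: "f \<in> ?F" for f
  proof -
    have f0: "f \<noteq> 0" and fk: "keys f \<subseteq> {a. tdeg a = d} - corner" and zd: "zero_divisor_mod I f"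
      using f by (auto simp: zd_standard_polys_def footprint_eq[OF ideal_I] leads_I)
    let ?a = "lead_monom prec f"
    let ?J = "ideal_gen (insert f I)"
    have "?a \<in> zd_monoms prec I d"
      using lead_monom(1)[OF f0] fk zero_divisor_lead_monom[OF ideal_I zd f0]
      by (auto simp: zd_monoms_def footprint_eq[OF ideal_I] leads_I)
    then have le: "footprint_fun prec I d \<le> real (covered_count ?a)"
      by (rule footprint_fun_le)
    have sub: "insert f I \<subseteq> ?J" and id: "mpoly_ideal ?J"
      by (rule genideal_type)+
    have "?a \<in> leads ?J"
      using sub by (intro leadsI f0) auto
    then have "{k. mdvd ?a k} \<subseteq> leads ?J"
      using leads_mdvd[OF id] by blast
    moreover have "corner \<subseteq> leads ?J"
      unfolding leads_I[symmetric] using sub by (intro leads_mono) auto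
    ultimately have "ray_count (leads ?J) \<le> ray_count (corner \<union> {k. mdvd ?a k})"
      unfolding ray_count_def by (intro card_mono) auto
    then have "ray_count (leads ?J) + covered_count ?a \<le> card rays"
      using ray_count_corner_insert[of ?a] by linarith
    moreover have "?g f = real (ray_count (leads ?J))"
      using fk by (intro quot_degree_insert[OF graded_I leads_I _ zd, of d]) (auto simp: homogeneous_part_def)
    ultimately show ?thesis
      using le by (intro exI[of _ "ray_count (leads ?J)"]) auto
  qed
  \<comment> \<open>The family of polynomials may be infinite, so the maximum has a meaning only
    because the degrees are natural numbers up to \<open>card rays\<close>.\<close>
  have "?g ` ?F \<subseteq> real ` {..card rays}"
    using F by fastforce
  then have "finite (?g ` ?F)"
    by (rule finite_subset) simp
  then have "Max (?g ` ?F) \<in> ?g ` ?F"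
    using False by (intro Max_in) auto
  then obtain f where "f \<in> ?F" "Max (?g ` ?F) = ?g f"
    by blast
  then show ?thesis
    using F[of f] False by (auto simp: min_dist_fun_def quot_degree_I)
qed

end

section \<open>Reduction of the footprint function to a minimum over a box\<close>

context monomial_rays_ideal begin

text \<open>\<open>S\<close> indexes the generators, \<open>j\<close> is the mixed one, and
  \<open>\<sigma>\<close> sends each other generator to its variable. The minimiser in
  \<open>attained\<close> spends all of \<open>d\<close> or fills the box, so that it can be
  completed to a monomial of degree exactly \<open>d\<close>.\<close>

lemma footprint_fun_eqI:
  fixes S :: "'i set" and dg :: "'i \<Rightarrow> nat"
  assumes fin: "finite S" and j: "j \<in> S" and \<sigma>: "bij_betw \<sigma> (S - {j}) (UNIV - {p, q})"
    and dg: "\<And>i. i \<in> S - {j} \<Longrightarrow> dg i = D (\<sigma> i)" and dgj: "dg j = A + B"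
    and d: "1 \<le> d"
    and lower: "\<And>c. (\<And>i. i \<in> S \<Longrightarrow> c i < dg i) \<Longrightarrow> sum c S \<le> d \<Longrightarrow> m \<le> (\<Prod>i\<in>S. dg i - c i)"
    and attained: "\<exists>c. (\<forall>i\<in>S. c i < dg i) \<and> sum c S = min d (\<Sum>i\<in>S. dg i - 1) \<and> (\<Prod>i\<in>S. dg i - c i) = m"
  shows "footprint_fun prec I d = real m"
proof -
  \<comment> \<open>The truncations at \<open>B\<close> and \<open>A\<close> turn
    \<open>A + B\<close> minus the entry at \<open>j\<close> into the first factor of
    \<open>covered_count\<close>.\<close>
  define co where "co a i = (if i = j then min (lookup a q) B + min (lookup a p) A else lookup a (\<sigma> i))" for a i
  have \<sigma>_pq: "\<sigma> i \<noteq> p" "\<sigma> i \<noteq> q" if "i \<in> S - {j}" for i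
    using bij_betwE[OF \<sigma>] that by auto
  have count: "covered_count a = (\<Prod>i\<in>S. dg i - co a i)" for a
  proof -
    have "(\<Prod>i\<in>S. dg i - co a i) = (dg j - co a j) * (\<Prod>i\<in>S - {j}. dg i - co a i)"
      by (rule prod.remove[OF fin j])
    also have "dg j - co a j = (B - lookup a q) + (A - lookup a p)"
      unfolding co_def dgj by simp
    also have "(\<Prod>i\<in>S - {j}. dg i - co a i) = (\<Prod>i\<in>S - {j}. D (\<sigma> i) - lookup a (\<sigma> i))"
      by (rule prod.cong) (auto simp: dg co_def)
    also have "\<dots> = (\<Prod>v\<in>UNIV - {p, q}. D v - lookup a v)"
      by (rule prod.reindex_bij_betw[OF \<sigma>])
    finally show ?thesis
      by (simp only: covered_count_def)
  qed
  have sum_co: "sum (co a) S = co a j + (\<Sum>v\<in>UNIV - {p, q}. lookup a v)" for a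
  proof -
    have "sum (co a) S = co a j + sum (co a) (S - {j})"
      by (rule sum.remove[OF fin j])
    also have "sum (co a) (S - {j}) = (\<Sum>i\<in>S - {j}. lookup a (\<sigma> i))"
      by (rule sum.cong) (auto simp: co_def)
    also have "\<dots> = (\<Sum>v\<in>UNIV - {p, q}. lookup a v)"
      by (rule sum.reindex_bij_betw[OF \<sigma>])
    finally show ?thesis .
  qed
  have lower_count: "m \<le> covered_count a" if a: "a \<notin> corner" "tdeg a \<le> d" for a
    unfolding count
  proof (rule lower)
    fix i assume i: "i \<in> S"
    show "co a i < dg i"
    proof (cases "i = j")
      case True
      have "lookup a p < A \<or> lookup a q < B"
        using a(1) by (auto simp: corner_def)
      then show ?thesis
        using B_pos by (auto simp: True co_def dgj)
    next
      case False
      then show ?thesis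
        using a(1) i \<sigma>_pq[of i] by (auto simp: co_def dg corner_def not_le)
    qed
  next
    have "co a j \<le> lookup a p + lookup a q"
      by (simp add: co_def)
    then show "sum (co a) S \<le> d"
      using a(2) unfolding sum_co tdeg_eq_pq by linarith
  qed
  have zero: "0 \<notin> corner"
  proof
    assume "0 \<in> corner"
    then obtain v where "v \<noteq> p" "v \<noteq> q" "D v \<le> 0"
      using B_pos by (auto simp: corner_def)
    then show False
      using D_pos[of v] by simp
  qed
  have "m \<le> covered_count 0"
    using lower_count[OF zero] by simp
  then have ge: "real m \<le> footprint_fun prec I d"
    using footprint_fun_attained[of d] lower_count zd_monomsD(1,2) by auto
  obtain c where c: "\<And>i. i \<in> S \<Longrightarrow> c i < dg i" "sum c S = min d (\<Sum>i\<in>S. dg i - 1)"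
    "(\<Prod>i\<in>S. dg i - c i) = m"
    using attained by blast
  have "footprint_fun prec I d \<le> real m"
  proof (cases "\<forall>i\<in>S. c i = 0")
    case True
    \<comment> \<open>A zero minimiser does not yield a zero-divisor. But \<open>1 \<le> d\<close>
      then forces every \<open>dg i\<close> to be 1, so that
      \<open>covered_count 0 \<le> 1 \<le> m\<close>.\<close>
    then have "min d (\<Sum>i\<in>S. dg i - 1) = 0"
      using c(2) by simp
    then have "(\<Sum>i\<in>S. dg i - 1) = 0"
      using d by simp
    then have dg1: "dg i = 1" if "i \<in> S" for i
    proof -
      have "dg i - 1 = 0"
        using fin \<open>(\<Sum>i\<in>S. dg i - 1) = 0\<close> that by (simp only: sum_eq_0_iff)
      then show ?thesis
        using c(1)[OF that] by linarith
    qed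
    have "covered_count 0 \<le> 1"
      unfolding count by (intro prod_le_1) (auto simp: dg1)
    moreover have "1 \<le> m"
      unfolding c(3)[symmetric] by (rule prod_ge_1) (use c(1) in \<open>simp add: Suc_leI\<close>)
    ultimately show ?thesis
      using footprint_fun_le_0[of d] by linarith
  next
    case False
    define x where "x = d - sum c S"
    define \<tau> where "\<tau> = the_inv_into (S - {j}) \<sigma>"
    have \<tau>: "\<tau> (\<sigma> i) = i" if "i \<in> S - {j}" for i
      unfolding \<tau>_def using \<sigma> that by (intro the_inv_into_f_f) (auto simp: bij_betw_def)
    \<comment> \<open>The entry \<open>c j\<close> is shared between \<open>p\<close>, which takes
      up to \<open>A\<close>, and \<open>q\<close>, which takes the rest and stays below
      \<open>B\<close>. The surplus \<open>x\<close> goes to \<open>p\<close>.\<close>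
    define a where "a = Abs_poly_mapping (\<lambda>v. if v = p then min (c j) A + x
      else if v = q then c j - min (c j) A else c (\<tau> v))"
    have la: "lookup a p = min (c j) A + x" "lookup a q = c j - min (c j) A"
      using p_neq_q by (simp_all add: a_def)
    have la\<sigma>: "lookup a (\<sigma> i) = c i" if "i \<in> S - {j}" for i
      using \<sigma>_pq[OF that] \<tau>[OF that] by (simp add: a_def)
    \<comment> \<open>A positive surplus means that \<open>c\<close> fills the box, so
      \<open>c j = A + B - 1\<close>. The exponent of \<open>p\<close> is then cut off at
      \<open>A\<close> in \<open>co\<close>, and the surplus leaves no trace there.\<close>
    have x0: "A \<le> c j" if "0 < x"
    proof -
      have "sum c S = (\<Sum>i\<in>S. dg i - 1)"
        using c(2) that by (simp add: x_def min_def split: if_splits)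
      moreover have "sum c S < (\<Sum>i\<in>S. dg i - 1)" if "c j \<noteq> dg j - 1"
      proof (rule sum_strict_mono_ex1[OF fin])
        show "\<forall>i\<in>S. c i \<le> dg i - 1"
          using c(1) by fastforce
        show "\<exists>i\<in>S. c i < dg i - 1"
          using j that c(1)[OF j] by (intro bexI[of _ j]) auto
      qed
      ultimately have "c j = dg j - 1"
        by auto
      then show ?thesis
        using B_pos by (simp add: dgj)
    qed
    have cj: "c j < A + B"
      using c(1)[OF j] by (simp add: dgj)
    have co_a: "co a i = c i" if "i \<in> S" for i
    proof (cases "i = j")
      case True
      then show ?thesis
        using x0 cj by (cases "0 < x") (auto simp: co_def la min_def)
    next
      case False
      then show ?thesis
        using la\<sigma>[of i] that by (simp add: co_def)
    qed
    have aq: "lookup a q < B"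
      using cj B_pos by (auto simp: la)
    have "a \<notin> corner"
    proof
      assume "a \<in> corner"
      then obtain v where v: "v \<noteq> p" "v \<noteq> q" "D v \<le> lookup a v"
        using aq by (auto simp: corner_def)
      then have "v \<in> \<sigma> ` (S - {j})"
        using bij_betw_imp_surj_on[OF \<sigma>] by simp
      then obtain i where i: "i \<in> S - {j}" "v = \<sigma> i"
        by blast
      then show False
        using v(3) la\<sigma>[OF i(1)] c(1)[of i] dg[OF i(1)] by simp
    qed
    moreover have "tdeg a = d"
    proof -
      have "(\<Sum>v\<in>UNIV - {p, q}. lookup a v) = (\<Sum>i\<in>S - {j}. c i)"
        unfolding sum.reindex_bij_betw[OF \<sigma>, symmetric] by (rule sum.cong) (auto simp: la\<sigma>)
      then have "tdeg a = x + (c j + sum c (S - {j}))"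
        unfolding tdeg_eq_pq la by simp
      also have "c j + sum c (S - {j}) = sum c S"
        by (rule sum.remove[OF fin j, symmetric])
      also have "x + sum c S = d"
        using c(2) by (simp add: x_def)
      finally show ?thesis .
    qed
    moreover have "(\<exists>v. v \<noteq> p \<and> v \<noteq> q \<and> 0 < lookup a v) \<or> 0 < lookup a q \<or> (0 < A \<and> 0 < lookup a p)"
    proof -
      obtain i where i: "i \<in> S" "0 < c i"
        using False by auto
      show ?thesis
      proof (cases "i = j")
        case True
        then show ?thesis
          using i(2) by (auto simp: la)
      next
        case ne: False
        then have "0 < lookup a (\<sigma> i)"
          using la\<sigma>[of i] i by simp
        then show ?thesis
          using \<sigma>_pq[of i] i(1) ne by auto
      qed
    qed
    ultimately have "a \<in> zd_monoms prec I d"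
      by (rule zd_monomsI)
    moreover have "covered_count a = m"
      unfolding count c(3)[symmetric] by (rule prod.cong) (auto simp: co_a)
    ultimately show ?thesis
      using footprint_fun_le by blast
  qed
  then show ?thesis
    using ge by simp
qed

end

section \<open>Minimising a product over a box\<close>

text \<open>
  The product left over when a budget \<open>d\<close> is used to lower the entries of a list one after the other,
  each of them down to \<open>1\<close> before the next one is touched.
\<close>
fun greedy :: "nat list \<Rightarrow> nat \<Rightarrow> nat" where
  "greedy [] d = 1"
| "greedy (x # xs) d = (if x - 1 \<le> d then greedy xs (d - (x - 1)) else (x - d) * prod_list xs)"

text \<open>Exchange argument: taking only \<open>c\<close> off the smallest entry and then
  proceeding greedily leaves no less than being greedy from the start. If the rest of the budget
  lowers \<open>y\<close> to 1, then \<open>y\<close> can be removed from both sides; otherwise the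
  claim is an inequality about \<open>x\<close> and \<open>y\<close> alone.\<close>

lemma greedy_step:
  assumes "sorted (x # xs)" "\<forall>y\<in>set (x # xs). 1 \<le> y" "c \<le> d" "c < x"
  shows "greedy (x # xs) d \<le> (x - c) * greedy xs (d - c)"
  using assms
proof (induction xs arbitrary: x c d)
  case Nil
  then show ?case by auto
next
  case (Cons y ys)
  have xy: "x \<le> y" "1 \<le> x" "1 \<le> y"
    using Cons.prems by auto
  let ?P = "prod_list ys"
  show ?case
  proof (cases "y - 1 \<le> d - c")
    case True
    let ?d = "d - (y - 1)"
    have "greedy (x # ys) ?d \<le> (x - c) * greedy ys (?d - c)"
      using Cons.prems True by (intro Cons.IH) auto
    moreover have "?d - c = d - c - (y - 1)"
      by simp
    \<comment> \<open>As \<open>x \<le> y\<close>, the budget can lower either entry to 1, and the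
      other is left with the same value in both orders.\<close>
    moreover have "greedy (x # y # ys) d = greedy (x # ys) ?d"
    proof (cases "y - 1 \<le> d - (x - 1)")
      case t: True
      have "x - 1 \<le> d"
        using True xy by linarith
      moreover have "x - 1 \<le> ?d"
        using True t xy by linarith
      moreover have "d - (x - 1) - (y - 1) = ?d - (x - 1)"
        by simp
      ultimately show ?thesis
        using t by simp
    next
      case f: False
      have "x - 1 \<le> d"
        using True xy by linarith
      moreover from this have "\<not> x - 1 \<le> ?d"
        using f True xy by linarith
      moreover have "y - (d - (x - 1)) = x - ?d"
        using True f xy \<open>x - 1 \<le> d\<close> by linarith
      ultimately show ?thesis
        using f by simp
    qed
    ultimately show ?thesis
      using True by simp
  next
    case False
    have "greedy (x # y # ys) d \<le> (x - c) * (y - (d - c)) * ?P"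
    proof -
      \<comment> \<open>In the variables \<open>e\<close>, \<open>u\<close>, \<open>w\<close> the
        claim is \<open>u + w + 1 \<le> (u + 1) * (w + 1)\<close> if \<open>u \<le> e\<close>.
        Otherwise \<open>u = e + t\<close> and it comes down to \<open>e * t \<le> e * w\<close>,
        where \<open>t \<le> w\<close> follows from \<open>x \<le> y\<close>.\<close>
      obtain e where d: "d = c + e"
        using Cons.prems(3) le_Suc_ex by blast
      obtain u where x: "x = Suc (c + u)"
        using Cons.prems(4) less_imp_Suc_add by blast
      have "e < y"
        using False by (simp add: d)
      then obtain w where y: "y = Suc (e + w)"
        using less_imp_Suc_add by blast
      show ?thesis
      proof (cases "u \<le> e")
        case True
        then have "y - (d - (x - 1)) = Suc (u + w)"
          by (simp add: x y d)
        also have "\<dots> \<le> (x - c) * (y - (d - c))"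
          by (simp add: x y d)
        finally have "y - (d - (x - 1)) \<le> (x - c) * (y - (d - c))" .
        moreover have "x - 1 \<le> d" "\<not> y - 1 \<le> d - (x - 1)"
          using True False by (simp_all add: x y d)
        ultimately show ?thesis
          by simp
      next
        case f: False
        then obtain t where u: "u = e + t"
          using le_Suc_ex[of e u] by auto
        have "t \<le> w"
          using xy(1) by (simp add: x y u)
        then have "e * t \<le> e * w"
          by simp
        then have "(x - d) * y \<le> (x - c) * (y - (d - c))"
          by (simp add: x y u d algebra_simps)
        then have "(x - d) * y * ?P \<le> (x - c) * (y - (d - c)) * ?P"
          by (rule mult_right_mono) simp
        moreover have "\<not> x - 1 \<le> d"
          using f by (simp add: x d)
        ultimately show ?thesis
          by (simp add: mult.assoc)
      qed
    qed
    then show ?thesis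
      using False by (simp add: mult.assoc)
  qed
qed

lemma greedy_le:
  assumes "sorted xs" "\<forall>y\<in>set xs. 1 \<le> y" "list_all2 (<) cs xs" "sum_list cs \<le> d"
  shows "greedy xs d \<le> prod_list (map2 (-) xs cs)"
  using assms
proof (induction xs arbitrary: cs d)
  case (Cons x xs)
  then obtain c cs' where cs: "cs = c # cs'" "c < x" "list_all2 (<) cs' xs"
    by (auto simp: list_all2_Cons2)
  have "greedy (x # xs) d \<le> (x - c) * greedy xs (d - c)"
    using Cons.prems cs by (intro greedy_step) auto
  also have "greedy xs (d - c) \<le> prod_list (map2 (-) xs cs')"
    using Cons.prems cs by (intro Cons.IH) auto
  finally show ?case
    by (simp add: cs)
qed simp

text \<open>The exact sum is recorded because the entries are later realised by a monomial of
  prescribed degree.\<close>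

lemma greedy_attained:
  assumes "\<forall>y\<in>set xs. 1 \<le> y"
  shows "\<exists>cs. list_all2 (<) cs xs \<and> sum_list cs = min d (\<Sum>x\<leftarrow>xs. x - 1)
    \<and> prod_list (map2 (-) xs cs) = greedy xs d"
  using assms
proof (induction xs arbitrary: d)
  case (Cons x xs)
  have zero: "\<exists>cs. list_all2 (<) cs xs \<and> sum_list cs = 0 \<and> prod_list (map2 (-) xs cs) = prod_list xs"
  proof -
    have "list_all2 (<) (map (\<lambda>_. 0) xs) xs" "prod_list (map2 (-) xs (map (\<lambda>_. 0) xs)) = prod_list xs"
      using Cons.prems by (induction xs) auto
    moreover have "sum_list (map (\<lambda>_. 0 :: nat) xs) = 0"
      by simp
    ultimately show ?thesis
      by blast
  qed
  show ?case
  proof (cases "x - 1 \<le> d")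
    case True
    obtain cs where "list_all2 (<) cs xs" "sum_list cs = min (d - (x - 1)) (\<Sum>x\<leftarrow>xs. x - 1)"
      "prod_list (map2 (-) xs cs) = greedy xs (d - (x - 1))"
      using Cons.IH Cons.prems by fastforce
    then show ?thesis
      using True Cons.prems by (intro exI[of _ "(x - 1) # cs"]) auto
  next
    case False
    obtain cs where "list_all2 (<) cs xs" "sum_list cs = 0" "prod_list (map2 (-) xs cs) = prod_list xs"
      using zero by blast
    then show ?thesis
      using False by (intro exI[of _ "d # cs"]) auto
  qed
qed simp

lemma greedy_pos: "\<forall>y\<in>set xs. 1 \<le> y \<Longrightarrow> 1 \<le> greedy xs d"
proof (induction xs arbitrary: d)
  case (Cons x xs)
  have "1 \<le> prod_list xs"
    using Cons.prems by (induction xs) auto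
  then show ?case
    using Cons by auto
qed simp

lemma greedy_eq_1: "(\<Sum>x\<leftarrow>xs. x - 1) \<le> d \<Longrightarrow> greedy xs d = 1"
  by (induction xs arbitrary: d) auto

lemma greedy_0: "\<forall>y\<in>set xs. 1 \<le> y \<Longrightarrow> greedy xs 0 = prod_list xs"
  by (induction xs) (auto simp: le_Suc_eq)

text \<open>The budget lowers every entry of \<open>xs\<close> to 1 and takes \<open>l\<close> off
  \<open>y\<close>. At \<open>l = y - 1\<close> the recursion passes on to \<open>ys\<close> with
  budget 0, in agreement with the formula since then \<open>y - l = 1\<close>.\<close>

lemma greedy_append:
  assumes "\<forall>y\<in>set (xs @ y # ys). 1 \<le> y" "l \<le> y - 1"
  shows "greedy (xs @ y # ys) ((\<Sum>x\<leftarrow>xs. x - 1) + l) = (y - l) * prod_list ys"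
  using assms
proof (induction xs)
  case Nil
  then show ?case
    using greedy_0[of ys] by (cases "l = y - 1") auto
next
  case (Cons x xs)
  then show ?case by simp
qed

lemma map2_map: "map2 f (map g ns) (map h ns) = map (\<lambda>i. f (g i) (h i)) ns"
  by (induction ns) auto

lemma greedy_upt_le:
  assumes "sorted (map dg [m..<n])" "\<And>i. i \<in> {m..<n} \<Longrightarrow> 1 \<le> dg i"
    and "\<And>i. i \<in> {m..<n} \<Longrightarrow> c i < dg i" "sum c {m..<n} \<le> d"
  shows "greedy (map dg [m..<n]) d \<le> (\<Prod>i\<in>{m..<n}. dg i - c i)"
proof -
  have "greedy (map dg [m..<n]) d \<le> prod_list (map2 (-) (map dg [m..<n]) (map c [m..<n]))"
    using assms by (intro greedy_le)
      (auto simp: list_all2_map1 list_all2_map2 list_all2_same interv_sum_list_conv_sum_set_nat)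
  also have "\<dots> = (\<Prod>i\<in>{m..<n}. dg i - c i)"
    using prod.distinct_set_conv_list[of "[m..<n]" "\<lambda>i. dg i - c i"] by (simp add: map2_map)
  finally show ?thesis .
qed

lemma greedy_upt_attained:
  assumes "\<And>i. i \<in> {m..<n} \<Longrightarrow> 1 \<le> dg i"
  shows "\<exists>c. (\<forall>i\<in>{m..<n}. c i < dg i) \<and> sum c {m..<n} = min d (\<Sum>i\<in>{m..<n}. dg i - 1)
    \<and> (\<Prod>i\<in>{m..<n}. dg i - c i) = greedy (map dg [m..<n]) d"
proof -
  let ?ns = "[m..<n]"
  obtain cs where cs: "list_all2 (<) cs (map dg ?ns)" "sum_list cs = min d (\<Sum>x\<leftarrow>map dg ?ns. x - 1)"
    "prod_list (map2 (-) (map dg ?ns) cs) = greedy (map dg ?ns) d"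
    using greedy_attained[of "map dg ?ns" d] assms by auto
  define c where "c i = cs ! (i - m)" for i
  have len: "length cs = n - m"
    using list_all2_lengthD[OF cs(1)] by simp
  have eq: "cs = map c ?ns"
    by (rule nth_equalityI) (simp_all add: len c_def)
  have "\<forall>i\<in>{m..<n}. c i < dg i"
    using cs(1) unfolding eq by (simp add: list_all2_map1 list_all2_map2 list_all2_same)
  moreover have "sum c {m..<n} = min d (\<Sum>i\<in>{m..<n}. dg i - 1)"
    using cs(2) unfolding eq by (simp add: interv_sum_list_conv_sum_set_nat o_def)
  moreover have "(\<Prod>i\<in>{m..<n}. dg i - c i) = greedy (map dg ?ns) d"
    using cs(3) prod.distinct_set_conv_list[of ?ns "\<lambda>i. dg i - c i"] unfolding eq by (simp add: map2_map)
  ultimately show ?thesis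
    by blast
qed

section \<open>Monomial complete intersections of dimension one\<close>

text \<open>Representatives of the sets form a cover, so minimality makes them distinct, and a
  single point \<open>p\<close> is left over. Since the sets turn out disjoint, each contains only
  its representative and possibly \<open>p\<close>, the latter for at most one index.\<close>

lemma disjoint_up_to_one_variable:
  fixes T :: "'i \<Rightarrow> 'v::finite set"
  assumes fin: "finite S" and "S \<noteq> {}" and card_S: "card S + 1 = CARD('v)"
    and ne: "\<And>i. i \<in> S \<Longrightarrow> T i \<noteq> {}"
    and cover: "\<And>C. (\<And>i. i \<in> S \<Longrightarrow> T i \<inter> C \<noteq> {}) \<Longrightarrow> card S \<le> card C"
  shows "\<exists>p q j \<sigma>. p \<noteq> q \<and> j \<in> S \<and> bij_betw \<sigma> (S - {j}) (UNIV - {p, q}) \<and>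
    (\<forall>i\<in>S - {j}. T i = {\<sigma> i}) \<and> q \<in> T j \<and> T j \<subseteq> {p, q}"
proof -
  define \<sigma> where "\<sigma> i = (SOME v. v \<in> T i)" for i
  have \<sigma>: "\<sigma> i \<in> T i" if "i \<in> S" for i
    using ne[OF that] unfolding \<sigma>_def by (simp add: some_in_eq)
  have "card S \<le> card (\<sigma> ` S)"
    by (rule cover) (use \<sigma> in blast)
  then have card_im: "card (\<sigma> ` S) = card S"
    using card_image_le[OF fin, of \<sigma>] by simp
  then have inj: "inj_on \<sigma> S"
    by (rule eq_card_imp_inj_on[OF fin])
  have disj: "i = k" if ik: "i \<in> S" "k \<in> S" "v \<in> T i" "v \<in> T k" for i k v
  proof (rule ccontr)
    assume "i \<noteq> k"
    \<comment> \<open>The common point \<open>v\<close> replaces the representatives of both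
      \<open>i\<close> and \<open>k\<close>, giving a cover with at most \<open>card S - 1\<close>
      points.\<close>
    have "card S \<le> card (insert v (\<sigma> ` (S - {i, k})))"
    proof (rule cover)
      fix l assume "l \<in> S"
      then show "T l \<inter> insert v (\<sigma> ` (S - {i, k})) \<noteq> {}"
        using ik(3,4) \<sigma>[of l] by (cases "l = i \<or> l = k") auto
    qed
    also have "\<dots> \<le> Suc (card (S - {i, k}))"
      using card_insert_le_m1[of "Suc (card (S - {i, k}))" "\<sigma> ` (S - {i, k})" v]
        card_image_le[of "S - {i, k}" \<sigma>] fin by simp
    also have "card (S - {i, k}) = card S - 2"
      using ik(1,2) \<open>i \<noteq> k\<close> fin by (simp add: card_Diff_subset)
    finally have "card S \<le> Suc (card S - 2)" .
    moreover have "2 \<le> card S"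
      using card_mono[OF fin, of "{i, k}"] ik(1,2) \<open>i \<noteq> k\<close> by simp
    ultimately show False
      by simp
  qed
  have "card (UNIV - \<sigma> ` S) = 1"
    using card_S card_im by (simp add: card_Diff_subset fin)
  then obtain p where p: "UNIV - \<sigma> ` S = {p}"
    by (rule card_1_singletonE)
  \<comment> \<open>If \<open>p\<close> lies in no set, any index will do; every generator is then a
    power of one variable.\<close>
  define j where "j = (if \<exists>j\<in>S. p \<in> T j then (SOME j. j \<in> S \<and> p \<in> T j) else (SOME j. j \<in> S))"
  have j: "j \<in> S \<and> ((\<exists>i\<in>S. p \<in> T i) \<longrightarrow> p \<in> T j)"
  proof (cases "\<exists>j\<in>S. p \<in> T j")
    case True
    then have "\<exists>j. j \<in> S \<and> p \<in> T j" by blast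
    from someI_ex[OF this] show ?thesis
      using True by (simp add: j_def)
  next
    case False
    then show ?thesis
      using \<open>S \<noteq> {}\<close> by (simp add: j_def some_in_eq)
  qed
  have T: "T i \<subseteq> insert (\<sigma> i) (if i = j then {p} else {})" if i: "i \<in> S" for i
  proof
    fix v assume v: "v \<in> T i"
    show "v \<in> insert (\<sigma> i) (if i = j then {p} else {})"
    proof (cases "v = p")
      case True
      then have "i = j"
        using disj[of i j p] i j v by blast
      then show ?thesis
        using True by simp
    next
      case False
      then obtain k where "k \<in> S" "v = \<sigma> k"
        using p by blast
      then show ?thesis
        using disj[of i k v] \<sigma>[of k] i v by auto
    qed
  qed
  have "p \<noteq> \<sigma> j"
    using p j by blast
  moreover have "bij_betw \<sigma> (S - {j}) (UNIV - {p, \<sigma> j})"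
  proof (rule bij_betw_imageI)
    show "inj_on \<sigma> (S - {j})"
      using inj by (rule inj_on_subset) auto
    have "\<sigma> ` (S - {j}) = \<sigma> ` S - {\<sigma> j}"
      using inj_on_image_set_diff[OF inj, of S "{j}"] j by simp
    also have "\<sigma> ` S = UNIV - {p}"
      using p by blast
    finally show "\<sigma> ` (S - {j}) = UNIV - {p, \<sigma> j}"
      by auto
  qed
  moreover have "T i = {\<sigma> i}" if "i \<in> S - {j}" for i
    using T[of i] \<sigma>[of i] that by auto
  moreover have "T j \<subseteq> {p, \<sigma> j}"
    using T[of j] j by auto
  ultimately show ?thesis
    using j \<sigma>[of j] by blast
qed

section \<open>From the height hypothesis to the closed formula\<close>

theorem theorem3p14:
  fixes I :: "('v::finite, 'k::field) mpoly set"
    and prec :: "'v expo \<Rightarrow> 'v expo \<Rightarrow> bool"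
    and \<alpha> :: "nat \<Rightarrow> 'v expo"
    and dg :: "nat \<Rightarrow> nat"
    and s :: nat
  assumes "s = CARD('v)" and "s \<ge> 2"
    and "graded_ideal I"
    and "graded_monomial_order prec"
    and "complete_intersection mpoly_ring (initial_ideal prec I)"
    and "ideal_height mpoly_ring (initial_ideal prec I) = enat (s - 1)"
    and "initial_ideal prec I = ideal_gen {mono_poly (\<alpha> i) | i. i \<in> {2..s}}"
    and "\<forall>i\<in>{2..s}. dg i = tdeg (\<alpha> i)"
    and "\<forall>i\<in>{2..s}. 1 \<le> dg i"
    and "\<forall>i\<in>{2..<s}. dg i \<le> dg (i + 1)"
  shows "\<forall>d\<ge>1.
      min_dist_fun prec I d \<ge> footprint_fun prec I d \<and>
      footprint_fun prec I d \<ge> 1 \<and>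
      (int d \<le> (\<Sum>i=2..s. (int (dg i) - 1)) - 1 \<longrightarrow>
         (\<exists>(k::nat) (l::int). k \<le> s - 2 \<and> int d = (\<Sum>i=2..k+1. (int (dg i) - 1)) + l \<and>
            1 \<le> l \<and> l \<le> int (dg (k + 2)) - 1) \<and>
         (\<forall>(k::nat) (l::int). k \<le> s - 2 \<and> int d = (\<Sum>i=2..k+1. (int (dg i) - 1)) + l \<and>
            1 \<le> l \<and> l \<le> int (dg (k + 2)) - 1 \<longrightarrow>
            footprint_fun prec I d = real_of_int ((int (dg (k + 2)) - l) * (\<Prod>i=k+3..s. int (dg i))))) \<and>
      (int d \<ge> (\<Sum>i=2..s. (int (dg i) - 1)) \<longrightarrow> footprint_fun prec I d = 1)"
proof -
  interpret graded_order prec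
    by (rule graded_order.intro) (rule assms(4))
  have id: "mpoly_ideal I"
    using assms(3) by (simp add: graded_ideal_def)
  let ?S = "{2..<Suc s}"
  have S: "{2..s} = ?S"
    by auto
  have init: "initial_ideal prec I = ideal_gen (mono_poly ` \<alpha> ` ?S)"
    unfolding assms(7) S by (rule arg_cong[of _ _ ideal_gen]) auto
  define T where "T i = {v. 0 < lookup (\<alpha> i) v}" for i
  have "\<exists>p q j \<sigma>. p \<noteq> q \<and> j \<in> ?S \<and> bij_betw \<sigma> (?S - {j}) (UNIV - {p, q}) \<and>
    (\<forall>i\<in>?S - {j}. T i = {\<sigma> i}) \<and> q \<in> T j \<and> T j \<subseteq> {p, q}"
  proof (rule disjoint_up_to_one_variable)
    show "finite ?S" "?S \<noteq> {}" "card ?S + 1 = CARD('v)"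
      using assms(1,2) by auto
    show "T i \<noteq> {}" if "i \<in> ?S" for i
    proof
      assume "T i = {}"
      then have "tdeg (\<alpha> i) = 0"
        by (auto simp: T_def tdeg_def)
      then show False
        using assms(8,9) that unfolding S by force
    qed
    \<comment> \<open>Variables meeting the support of every generator generate an ideal that
      contains the initial ideal, so the height \<open>s - 1\<close> is at most
      \<open>card C\<close>.\<close>
    fix C assume C: "\<And>i. i \<in> ?S \<Longrightarrow> T i \<inter> C \<noteq> {}"
    have "initial_ideal prec I \<subseteq> coord_ideal C"
    proof
      fix f assume "f \<in> initial_ideal prec I"
      then have f: "\<forall>k\<in>keys f. \<exists>a\<in>\<alpha> ` ?S. mdvd a k"
        unfolding init mem_mono_ideal_iff .
      show "f \<in> coord_ideal C"
        unfolding mem_coord_ideal_iff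
      proof
        fix k assume "k \<in> keys f"
        then obtain i where i: "i \<in> ?S" "mdvd (\<alpha> i) k"
          using f by blast
        then obtain v where "v \<in> C" "0 < lookup (\<alpha> i) v"
          using C[OF i(1)] by (auto simp: T_def)
        then show "\<exists>v\<in>C. 0 < lookup k v"
          using i(2) unfolding mdvd_def by (meson less_le_trans)
      qed
    qed
    from ideal_height_le_card[OF this] show "card ?S \<le> card C"
      using assms(6) by simp
  qed
  then obtain p q j \<sigma> where pq: "p \<noteq> q" and j: "j \<in> ?S"
    and \<sigma>: "bij_betw \<sigma> (?S - {j}) (UNIV - {p, q})"
    and T: "\<And>i. i \<in> ?S - {j} \<Longrightarrow> T i = {\<sigma> i}" and qj: "q \<in> T j" and Tj: "T j \<subseteq> {p, q}"
    by blast
  define A where "A = lookup (\<alpha> j) p"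
  define B where "B = lookup (\<alpha> j) q"
  define \<tau> where "\<tau> = the_inv_into (?S - {j}) \<sigma>"
  define D where "D v = lookup (\<alpha> (\<tau> v)) v" for v
  have \<tau>: "\<tau> (\<sigma> i) = i" if "i \<in> ?S - {j}" for i
    unfolding \<tau>_def using \<sigma> that by (intro the_inv_into_f_f) (auto simp: bij_betw_def)
  have D\<sigma>: "D (\<sigma> i) = lookup (\<alpha> i) (\<sigma> i)" if "i \<in> ?S - {j}" for i
    unfolding D_def \<tau>[OF that] by (rule refl)
  have ex_\<sigma>: "\<exists>i\<in>?S - {j}. v = \<sigma> i" if "v \<noteq> p" "v \<noteq> q" for v
    using bij_betw_imp_surj_on[OF \<sigma>] that by blast
  have \<sigma>_pq: "\<sigma> i \<noteq> p" "\<sigma> i \<noteq> q" if "i \<in> ?S - {j}" for i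
    using bij_betwE[OF \<sigma>] that by auto
  have \<alpha>0: "lookup (\<alpha> i) v = 0" if "i \<in> ?S - {j}" "v \<noteq> \<sigma> i" for i v
  proof -
    have "v \<notin> T i"
      unfolding T[OF that(1)] using that(2) by simp
    then show ?thesis
      by (simp add: T_def)
  qed
  have \<alpha>j0: "lookup (\<alpha> j) v = 0" if "v \<noteq> p" "v \<noteq> q" for v
    using Tj that by (auto simp: T_def)
  interpret monomial_rays prec p q A B D
  proof unfold_locales
    show "p \<noteq> q"
      by (rule pq)
    show "0 < B"
      using qj by (simp add: T_def B_def)
    fix v assume "v \<noteq> p" "v \<noteq> q"
    then obtain i where i: "i \<in> ?S - {j}" "v = \<sigma> i"
      using ex_\<sigma> by blast
    have "\<sigma> i \<in> T i"
      by (simp only: T[OF i(1)] singletonI)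
    then show "0 < D v"
      unfolding i(2) D\<sigma>[OF i(1)] by (simp add: T_def)
  qed
  have dvd_j: "mdvd (\<alpha> j) k \<longleftrightarrow> A \<le> lookup k p \<and> B \<le> lookup k q" for k
  proof
    assume "A \<le> lookup k p \<and> B \<le> lookup k q"
    then show "mdvd (\<alpha> j) k"
      unfolding mdvd_def A_def B_def using \<alpha>j0 by (metis le0)
  qed (simp add: mdvd_def A_def B_def)
  have dvd_i: "mdvd (\<alpha> i) k \<longleftrightarrow> D (\<sigma> i) \<le> lookup k (\<sigma> i)" if "i \<in> ?S - {j}" for i k
  proof
    assume "D (\<sigma> i) \<le> lookup k (\<sigma> i)"
    then show "mdvd (\<alpha> i) k"
      unfolding mdvd_def D\<sigma>[OF that] using \<alpha>0[OF that] by (metis le0)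
  qed (simp add: mdvd_def D\<sigma>[OF that])
  have "leads I = corner"
  proof (intro Set.set_eqI)
    fix k
    have "k \<in> leads I \<longleftrightarrow> mono_poly k \<in> initial_ideal prec I"
      by (simp add: mem_initial_ideal_iff[OF id])
    also have "\<dots> \<longleftrightarrow> (\<exists>i\<in>?S. mdvd (\<alpha> i) k)"
      unfolding init mono_mem_mono_ideal_iff by blast
    also have "\<dots> \<longleftrightarrow> mdvd (\<alpha> j) k \<or> (\<exists>i\<in>?S - {j}. mdvd (\<alpha> i) k)"
      using j by blast
    also have "\<dots> \<longleftrightarrow> (A \<le> lookup k p \<and> B \<le> lookup k q) \<or> (\<exists>i\<in>?S - {j}. D (\<sigma> i) \<le> lookup k (\<sigma> i))"
      using dvd_i dvd_j by blast
    also have "(\<exists>i\<in>?S - {j}. D (\<sigma> i) \<le> lookup k (\<sigma> i)) \<longleftrightarrow> (\<exists>v. v \<noteq> p \<and> v \<noteq> q \<and> D v \<le> lookup k v)"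
      using ex_\<sigma> \<sigma>_pq by metis
    finally show "k \<in> leads I \<longleftrightarrow> k \<in> corner"
      unfolding corner_def by simp
  qed
  then interpret monomial_rays_ideal prec p q A B D I
    using assms(3) by unfold_locales
  have dg_i: "dg i = D (\<sigma> i)" if i: "i \<in> ?S - {j}" for i
  proof -
    have "tdeg (\<alpha> i) = (\<Sum>v\<in>{\<sigma> i}. lookup (\<alpha> i) v)"
      unfolding tdeg_def by (rule sum.mono_neutral_right) (use \<alpha>0[OF i] in auto)
    then show ?thesis
      using assms(8) i D\<sigma>[OF i] unfolding S by simp
  qed
  have dg_j: "dg j = A + B"
    using assms(8) j \<alpha>j0 unfolding S by (simp add: tdeg_eq_pq A_def B_def)
  let ?xs = "map dg [2..<Suc s]"
  have dg1: "1 \<le> dg i" if "i \<in> ?S" for i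
    using assms(9) that unfolding S by blast
  have sorted: "sorted ?xs"
    unfolding sorted_iff_nth_Suc
  proof (intro allI impI)
    fix i assume "Suc i < length ?xs"
    then have "2 + i \<in> {2..<s}"
      by (simp del: upt_Suc)
    then have "dg (2 + i) \<le> dg (2 + i + 1)"
      using assms(10) by blast
    then show "?xs ! i \<le> ?xs ! Suc i"
      using \<open>Suc i < length ?xs\<close> by (simp del: upt_Suc)
  qed
  have fp: "footprint_fun prec I d = real (greedy ?xs d)" if d: "1 \<le> d" for d
  proof (rule footprint_fun_eqI[OF _ j \<sigma> dg_i dg_j d])
    show "greedy ?xs d \<le> (\<Prod>i\<in>?S. dg i - c i)"
      if "\<And>i. i \<in> ?S \<Longrightarrow> c i < dg i" "sum c ?S \<le> d" for c
      by (rule greedy_upt_le[OF sorted dg1 that])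
    show "\<exists>c. (\<forall>i\<in>?S. c i < dg i) \<and> sum c ?S = min d (\<Sum>i\<in>?S. dg i - 1)
        \<and> (\<Prod>i\<in>?S. dg i - c i) = greedy ?xs d"
      by (rule greedy_upt_attained[OF dg1])
  qed simp_all
  \<comment> \<open>The amount needed to exhaust the first \<open>k\<close> degrees, whose indices
    start at 2. The subtraction is on natural numbers; \<open>F_int\<close> relates it to the
    integer sums of the statement by means of \<open>1 \<le> dg i\<close>.\<close>
  define F where "F k = (\<Sum>i\<in>{2..<k + 2}. dg i - 1)" for k
  have F_int: "int (F k) = (\<Sum>i=2..k + 1. int (dg i) - 1)" if "k \<le> s - 1" for k
  proof -
    have "int (F k) = (\<Sum>i\<in>{2..<k + 2}. int (dg i - 1))"
      by (simp add: F_def)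
    also have "\<dots> = (\<Sum>i\<in>{2..<k + 2}. int (dg i) - 1)"
    proof (rule sum.cong)
      fix i assume "i \<in> {2..<k + 2}"
      then have "1 \<le> dg i"
        using that assms(2) by (intro dg1) auto
      then show "int (dg i - 1) = int (dg i) - 1"
        by simp
    qed simp
    also have "{2..<k + 2} = {2..k + 1}"
      by auto
    finally show ?thesis .
  qed
  have s1: "s - 1 + 1 = s"
    using assms(2) by simp
  have total: "(\<Sum>i=2..s. int (dg i) - 1) = int (F (s - 1))"
    using F_int[of "s - 1"] s1 by simp
  have F_sum_list: "F k = (\<Sum>x\<leftarrow>map dg [2..<k + 2]. x - 1)" for k
    by (simp add: F_def interv_sum_list_conv_sum_set_nat o_def)
  show ?thesis
  proof (intro allI impI conjI)
    fix d :: nat assume d: "1 \<le> d"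
    show "footprint_fun prec I d \<le> min_dist_fun prec I d"
      by (rule footprint_fun_le_min_dist_fun)
    have "1 \<le> greedy ?xs d"
      by (rule greedy_pos) (use dg1 in \<open>auto simp del: upt_Suc\<close>)
    then show "1 \<le> footprint_fun prec I d"
      unfolding fp[OF d] by simp
    show "footprint_fun prec I d = 1" if "(\<Sum>i=2..s. int (dg i) - 1) \<le> int d"
    proof -
      have "F (s - 1) \<le> d"
        using that unfolding total by simp
      then have "(\<Sum>x\<leftarrow>?xs. x - 1) \<le> d"
        using F_sum_list[of "s - 1"] assms(2) by (simp add: Suc_diff_Suc numeral_2_eq_2 del: upt_Suc)
      then show ?thesis
        using fp[OF d] greedy_eq_1[of ?xs d] by (simp del: upt_Suc)
    qed
    show "\<exists>k l. k \<le> s - 2 \<and> int d = (\<Sum>i=2..k + 1. int (dg i) - 1) + l \<and> 1 \<le> l \<and> l \<le> int (dg (k + 2)) - 1"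
      if le: "int d \<le> (\<Sum>i=2..s. int (dg i) - 1) - 1"
    proof -
      have ex: "d \<le> F (Suc (s - 2))"
        using le assms(2) unfolding total by (simp add: Suc_diff_Suc numeral_2_eq_2)
      \<comment> \<open>The first block that \<open>d\<close> does not overrun: minimality gives
        \<open>F k < d\<close>, so \<open>d - F k\<close> is a value for \<open>l\<close> between 1
        and \<open>dg (k + 2) - 1\<close>.\<close>
      define k where "k = (LEAST k. d \<le> F (Suc k))"
      have k: "d \<le> F (Suc k)" "k \<le> s - 2"
        unfolding k_def using ex by (rule LeastI, rule Least_le)
      have "F k < d"
      proof (cases k)
        case 0
        then show ?thesis
          using d by (simp add: F_def)
      next
        case (Suc k')
        then show ?thesis
          using not_less_Least[of k' "\<lambda>k. d \<le> F (Suc k)"] by (simp add: k_def[symmetric])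
      qed
      moreover have "F (Suc k) = F k + (dg (k + 2) - 1)"
        by (simp add: F_def)
      moreover have "1 \<le> dg (k + 2)"
        using k(2) assms(2) by (intro dg1) auto
      moreover have "int (F k) = (\<Sum>i=2..k + 1. int (dg i) - 1)"
        using k(2) by (intro F_int) simp
      ultimately show ?thesis
        using k by (intro exI[of _ k] exI[of _ "int d - int (F k)"]) auto
    qed
    show "footprint_fun prec I d = real_of_int ((int (dg (k + 2)) - l) * (\<Prod>i=k + 3..s. int (dg i)))"
      if kl: "k \<le> s - 2 \<and> int d = (\<Sum>i=2..k + 1. int (dg i) - 1) + l \<and> 1 \<le> l \<and> l \<le> int (dg (k + 2)) - 1"
      for k :: nat and l :: int
    proof -
      define n where "n = nat l"
      have l: "l = int n" "n \<le> dg (k + 2) - 1" "n \<le> dg (k + 2)"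
        using kl by (auto simp: n_def)
      have "k \<le> s - 1"
        using kl by linarith
      then have "int d = int (F k + n)"
        using kl F_int[of k] l(1) unfolding of_nat_add by linarith
      then have dF: "d = F k + n"
        by (simp only: of_nat_eq_iff)
      have ks: "k + 2 \<le> s"
        using kl assms(2) by linarith
      then have "Suc s = k + 2 + (Suc s - (k + 2))"
        by simp
      \<comment> \<open>The list of degrees splits into the entries exhausted by the budget, the one
        at index \<open>k + 2\<close> lowered by \<open>n\<close>, and the untouched rest.\<close>
      then have "[2..<Suc s] = [2..<k + 2] @ [k + 2..<Suc s]"
        using upt_add_eq_append[of 2 "k + 2" "Suc s - (k + 2)"] by (simp only: le_add2)
      also have "[k + 2..<Suc s] = (k + 2) # [k + 3..<Suc s]"
        using ks upt_conv_Cons[of "k + 2" "Suc s"] by (simp add: eval_nat_numeral del: upt_Suc)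
      finally have xs: "?xs = map dg [2..<k + 2] @ dg (k + 2) # map dg [k + 3..<Suc s]"
        by simp
      have "greedy ?xs d = (dg (k + 2) - n) * prod_list (map dg [k + 3..<Suc s])"
        unfolding dF F_sum_list xs
      proof (rule greedy_append)
        have "\<forall>y\<in>set ?xs. 1 \<le> y"
          using dg1 by (auto simp del: upt_Suc)
        then show "\<forall>y\<in>set (map dg [2..<k + 2] @ dg (k + 2) # map dg [k + 3..<Suc s]). 1 \<le> y"
          unfolding xs .
      qed (rule l(2))
      also have "prod_list (map dg [k + 3..<Suc s]) = (\<Prod>i=k + 3..s. dg i)"
        using prod.distinct_set_conv_list[of "[k + 3..<Suc s]" dg]
        by (simp add: atLeastLessThanSuc_atLeastAtMost del: upt_Suc)
      finally have "int (greedy ?xs d) = (int (dg (k + 2)) - l) * (\<Prod>i=k + 3..s. int (dg i))"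
        using l by (simp add: of_nat_diff)
      then show "footprint_fun prec I d = real_of_int ((int (dg (k + 2)) - l) * (\<Prod>i=k + 3..s. int (dg i)))"
        unfolding fp[OF d] by (metis of_int_of_nat_eq)
    qed
  qed
qed

end
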